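(* Suppose that $f(X_1,\dots,X_d)\in L^p$ with $p\ge2$. Then, as $n\to\infty$, $$V_n:=\frac{U_n-\binom nd\mu}{n^{d-1/2}}\ \overset{\mathrm d}{\longrightarrow}\ N(0,\sigma^2)$$ holds with convergence of all moments and absolute moments of order $\le p$; that is, with $\zeta\sim N(0,\sigma^2)$, also $\mathbb E V_n^k\to\mathbb E\zeta^k$ for every integer $1\le k\le p$ and $\mathbb E|V_n|^r\to\mathbb E|\zeta|^r$ for every real $0<r\le p$. Here $$\sigma^2:=\sum_{i,j=1}^d\frac{(i+j-2)!\,(2d-i-j)!}{(i-1)!\,(j-1)!\,(d-i)!\,(d-j)!\,(2d-1)!}\,\sigma_{ij}.$$
   Context: $X,X_1,X_2,\dots$ is an i.i.d. sequence of random variables with values in an arbitrary measurable space $(S,\mathcal S)$; $d\ge1$ is a fixed integer and $f:S^d\to\mathbb R$ is measurable (no symmetry assumed). $U_n:=\sum_{1\le i_1<\dots<i_d\le n}f(X_{i_1},\dots,X_{i_d})$, $\mu:=\mathbb Ef(X_1,\dots,X_d)$; for $i=1,\dots,d$, $f_i(x):=\mathbb Ef(X_1,\dots,X_{i-1},x,X_{i+1},\dots,X_d)-\mu$, and $\sigma_{ij}:=\operatorname{Cov}(f_i(X),f_j(X))$. $N(0,0)$ is the point mass at $0$. *)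

theory Defs
  imports "HOL-Probability.Probability"
begin

text \<open>
  A function of \<open>d\<close> variables in \<open>S\<close> is represented by its values on
  \<open>space (PiM {1..d} (\<lambda>_. S))\<close>, that is, on extensional functions with domain \<open>{1..d}\<close>.
  This is why all its arguments below are restricted to \<open>{1..d}\<close>.
  A sequence of random variables \<open>X\<close> is used from index 1 on; \<open>X 0\<close> is never referred to.
\<close>

definition U_stat ::
  "nat \<Rightarrow> ((nat \<Rightarrow> 's) \<Rightarrow> real) \<Rightarrow> (nat \<Rightarrow> 'a \<Rightarrow> 's) \<Rightarrow> nat \<Rightarrow> 'a \<Rightarrow> real" where
  "U_stat d f X n \<omega> =
     (\<Sum>s | s \<in> {1..d} \<rightarrow>\<^sub>E {1..n} \<and> strict_mono_on {1..d} s. f (\<lambda>j\<in>{1..d}. X (s j) \<omega>))"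

definition U_mean ::
  "'a measure \<Rightarrow> nat \<Rightarrow> ((nat \<Rightarrow> 's) \<Rightarrow> real) \<Rightarrow> (nat \<Rightarrow> 'a \<Rightarrow> 's) \<Rightarrow> real" where
  "U_mean M d f X = (LINT \<omega>|M. f (\<lambda>j\<in>{1..d}. X j \<omega>))"

text \<open>
  The integral below need only exist for almost every \<open>x\<close> with respect to the law of the
  \<open>X j\<close>; for the other \<open>x\<close> it has the default value 0.
\<close>

definition U_proj ::
  "'a measure \<Rightarrow> nat \<Rightarrow> ((nat \<Rightarrow> 's) \<Rightarrow> real) \<Rightarrow> (nat \<Rightarrow> 'a \<Rightarrow> 's) \<Rightarrow> nat \<Rightarrow> 's \<Rightarrow> real" where
  "U_proj M d f X i x =
     (LINT \<omega>|M. f (\<lambda>j\<in>{1..d}. if j = i then x else X j \<omega>)) - U_mean M d f X"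

definition covariance :: "'a measure \<Rightarrow> ('a \<Rightarrow> real) \<Rightarrow> ('a \<Rightarrow> real) \<Rightarrow> real" where
  "covariance M A B =
     (LINT \<omega>|M. (A \<omega> - (LINT \<omega>'|M. A \<omega>')) * (B \<omega> - (LINT \<omega>'|M. B \<omega>')))"

text \<open>\<open>Y\<close> is a generic random variable with the common law of the \<open>X j\<close>.\<close>

definition U_asymp_var ::
  "'a measure \<Rightarrow> nat \<Rightarrow> ((nat \<Rightarrow> 's) \<Rightarrow> real) \<Rightarrow> (nat \<Rightarrow> 'a \<Rightarrow> 's) \<Rightarrow> ('a \<Rightarrow> 's) \<Rightarrow> real" where
  "U_asymp_var M d f X Y =
     (\<Sum>i=1..d. \<Sum>j=1..d.
        (fact (i + j - 2) * fact (2 * d - i - j)) /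
        (fact (i - 1) * fact (j - 1) * fact (d - i) * fact (d - j) * fact (2 * d - 1)) *
        covariance M (\<lambda>\<omega>. U_proj M d f X i (Y \<omega>)) (\<lambda>\<omega>. U_proj M d f X j (Y \<omega>)))"

text \<open>
  The normal law with mean \<open>m\<close> and variance \<open>v \<ge> 0\<close>. The case \<open>v = 0\<close> is separate because
  \<^const>\<open>normal_density\<close> takes the standard deviation and degenerates at 0.
\<close>

definition normal_law :: "real \<Rightarrow> real \<Rightarrow> real measure" where
  "normal_law m v =
     (if v = 0 then return borel m else density lborel (normal_density m (sqrt v)))"

end

(*
  Sums over all d-subsets A of {1..n} are compared with sums of independent variables in two ways.

  Distribution: f - mu is the sum of its projections f_i(x_i) and of a remainder h all of whose
  one-variable conditional means vanish. Hence E h(X_A) h(X_B) = 0 whenever A and B meet in at most one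
  point, and h contributes O(n^(2d-2)) to the second moment, which is negligible. The projections add up
  to a sum over k of functions of X_k with polynomial weights, to which a Lindeberg argument with
  characteristic functions applies; the limiting variance comes from
  sum_k C(k-1,s) C(n-k,t) = C(n,s+t+1).

  Moments: by Hoeffding's averaging over permutations and convexity, the q-th absolute moment of a
  normalized sum of a centred kernel is bounded by a constant times the q-th moment of the kernel, for
  every q >= 2. Applied with q = 2p to a truncated kernel and with q = p to the rest, this gives uniform
  integrability of |V_n|^p, which upgrades weak convergence to convergence of moments.
*)

theory Submission
  imports Defs
begin

section \<open>Moments of sums of independent variables\<close>

text \<open>As \<open>f\<close> is not symmetric, the contribution of X_k depends on the ranks that
  k takes in the samples, so the linear part is a sum of independent but not identically distributed
  terms; a common dominating function replaces identical distribution in the Lindeberg condition.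
  Each weight is of order n^(d-1) and n terms are added, whence the scale n^(d-1/2). Averaging over
  permutations survives the lack of symmetry because permutations act on index sets, which are then
  read in increasing order. With only p moments at hand, bounded p-th moments of V_n would not give
  convergence at the order p itself. A bounded kernel has moments of all orders, and 2p is a
  convenient order above p; what truncation cuts off is small in L^p uniformly in n, because the
  moment bound scales with the kernel. That bound needs kernels of mean zero, not vanishing
  conditional means, so it suffices to recentre the truncated pieces.\<close>

lemma powr_ge_tangent:
  fixes u a :: real
  assumes "u \<ge> 0" "a \<ge> 1"
  shows "1 + a * (u - 1) \<le> u powr a"
proof (cases "u = 0")
  case True then show ?thesis using assms by simp
next
  case False
  then have u: "u > 0" using assms by simp
  have "a * 1 powr (a - 1) * (u - 1) \<le> u powr a - 1 powr a"
  proof (rule convex_on_imp_above_tangent[OF powr_convex[OF assms(2)]])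
    show "((\<lambda>x. x powr a) has_real_derivative a * 1 powr (a - 1)) (at 1 within {0<..})"
      by (rule DERIV_subset[OF has_real_derivative_powr]) auto
    show "(1::real) \<in> interior {0<..}" "u \<in> {0<..}" using u by (auto simp: interior_open)
  qed auto
  then show ?thesis by simp
qed

text \<open>Equivalent to the tangent inequality at \<open>u\<close>, evaluated at 1; obtained from
  the tangent at 1, evaluated at \<open>1/u\<close>, on multiplying by
  \<open>u powr a\<close>.\<close>

lemma powr_diff_one_le:
  fixes u a :: real
  assumes "u > 0" "a \<ge> 1"
  shows "u powr a - 1 \<le> a * u powr (a - 1) * (u - 1)"
proof -
  have "u powr a * (1 + a * (1/u - 1)) \<le> u powr a * (1/u) powr a"
    using powr_ge_tangent[of "1/u" a] assms by (intro mult_left_mono) auto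
  also have "\<dots> = 1" using assms by (simp add: powr_mult[symmetric])
  finally have *: "u powr a * (1 + a * (1/u - 1)) \<le> 1" .
  have "u powr a = u powr (a - 1) * u" using assms by (simp add: powr_diff)
  then have "u powr a * (1/u - 1) = u powr (a - 1) * (1 - u)" using assms by (simp add: field_simps)
  moreover have "u powr a * (1 + a * (1/u - 1)) = u powr a + a * (u powr a * (1/u - 1))"
    by (simp only: ring_distribs mult_ac)
  ultimately have "u powr a * (1 + a * (1/u - 1)) = u powr a + a * u powr (a - 1) * (1 - u)"
    by simp
  then show ?thesis using * by (simp add: algebra_simps)
qed

text \<open>The first-order remainder is at most
  \<open>p * (t * ((1 + t) powr (p - 1) - 1))\<close>, and the inner difference is itself of order
  \<open>t\<close>. It needs an upper bound for positive \<open>t\<close> and a lower bound for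
  negative \<open>t\<close>, since multiplying by \<open>t\<close> then reverses the
  inequality.\<close>

lemma one_plus_powr_le_quadratic:
  fixes t p :: real
  assumes "p \<ge> 2" "\<bar>t\<bar> \<le> 1/2"
  shows "(1 + t) powr p \<le> 1 + p * t + p * p * 2 powr p * t\<^sup>2"
proof -
  have u: "1 + t > 0" using assms by auto
  have a: "(1 + t) powr p - 1 - p * t \<le> p * (t * ((1 + t) powr (p - 1) - 1))"
    using powr_diff_one_le[OF u, of p] assms by (simp add: algebra_simps)
  have "t * ((1 + t) powr (p - 1) - 1) \<le> p * 2 powr p * t\<^sup>2"
  proof (cases "t \<ge> 0")
    case True
    have "(1 + t) powr (p - 1) - 1 \<le> (p - 1) * (1 + t) powr (p - 1 - 1) * t"
      using powr_diff_one_le[OF u, of "p - 1"] assms by simp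
    also have "\<dots> \<le> p * 2 powr p * t"
    proof (intro mult_right_mono mult_mono)
      have "(1 + t) powr (p - 1 - 1) \<le> 2 powr (p - 1 - 1)"
        using assms True by (intro powr_mono2) auto
      also have "\<dots> \<le> 2 powr p" by (intro powr_mono) auto
      finally show "(1 + t) powr (p - 1 - 1) \<le> 2 powr p" .
    qed (use assms True in auto)
    finally have "t * ((1 + t) powr (p - 1) - 1) \<le> t * (p * 2 powr p * t)"
      using True by (rule mult_left_mono)
    then show ?thesis by (simp add: power2_eq_square mult_ac)
  next
    case False
    have "(p - 1) * t \<le> (1 + t) powr (p - 1) - 1"
      using powr_ge_tangent[of "1 + t" "p - 1"] assms u by auto
    then have "t * ((1 + t) powr (p - 1) - 1) \<le> t * ((p - 1) * t)"
      using False by (intro mult_left_mono_neg) auto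
    also have "\<dots> = (p - 1) * 1 * t\<^sup>2" by (simp add: power2_eq_square)
    also have "\<dots> \<le> p * 2 powr p * t\<^sup>2"
      using assms by (intro mult_right_mono mult_mono) (auto intro: ge_one_powr_ge_zero)
    finally show ?thesis .
  qed
  then have "p * (t * ((1 + t) powr (p - 1) - 1)) \<le> p * (p * 2 powr p * t\<^sup>2)"
    using assms by (intro mult_left_mono) auto
  then show ?thesis using a by (simp add: mult_ac)
qed

text \<open>In \<open>abs_add_powr_le\<close> the first summand pays for |x + y|^p when
  \<open>y\<close> dominates; the second pays for the linear term in that case and for the quadratic
  remainder in the other.\<close>

definition expansion_const :: "real \<Rightarrow> real" where
  "expansion_const p = 3 powr p + p * p * 2 powr p"

lemma expansion_const_ge_1: "p \<ge> 0 \<Longrightarrow> expansion_const p \<ge> 1"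
  unfolding expansion_const_def by (smt (verit) ge_one_powr_ge_zero mult_nonneg_nonneg powr_ge_zero)

text \<open>A second-order Taylor bound, the coefficient of \<open>y\<close> being the derivative of
  |x|^p; the term |y|^p takes over where \<open>y\<close> is not small against \<open>x\<close>.
  With \<open>y\<close> centred and independent of \<open>x\<close>, the linear term will have
  expectation 0.\<close>

lemma abs_add_powr_le:
  fixes x y p :: real
  assumes p: "p \<ge> 2"
  shows "\<bar>x + y\<bar> powr p \<le> \<bar>x\<bar> powr p + p * (sgn x * \<bar>x\<bar> powr (p - 1)) * y
           + expansion_const p * (\<bar>x\<bar> powr (p - 2) * y\<^sup>2 + \<bar>y\<bar> powr p)"
proof (cases "\<bar>y\<bar> < \<bar>x\<bar> / 2")
  case False
  have "\<bar>x + y\<bar> powr p \<le> (3 * \<bar>y\<bar>) powr p"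
    using False p by (intro powr_mono2) auto
  then have 1: "\<bar>x + y\<bar> powr p \<le> 3 powr p * \<bar>y\<bar> powr p" by (simp add: powr_mult)
  \<comment> \<open>The linear term may be negative, so its size has to be absorbed by the constant
    as well.\<close>
  have "\<bar>x\<bar> powr (p - 1) \<le> (2 * \<bar>y\<bar>) powr (p - 1)"
    using False p by (intro powr_mono2) auto
  also have "\<dots> = 2 powr (p - 1) * \<bar>y\<bar> powr (p - 1)" by (simp add: powr_mult)
  also have "\<dots> \<le> 2 powr p * \<bar>y\<bar> powr (p - 1)"
    by (intro mult_right_mono powr_mono) auto
  finally have "\<bar>x\<bar> powr (p - 1) * \<bar>y\<bar> \<le> 2 powr p * \<bar>y\<bar> powr (p - 1) * \<bar>y\<bar>"
    by (intro mult_right_mono) auto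
  also have "\<bar>y\<bar> powr p = \<bar>y\<bar> * \<bar>y\<bar> powr (p - 1)" using powr_mult_base[of "\<bar>y\<bar>" "p - 1"] by simp
  then have "2 powr p * \<bar>y\<bar> powr (p - 1) * \<bar>y\<bar> = 2 powr p * \<bar>y\<bar> powr p" by (simp add: mult_ac)
  finally have "p * (\<bar>x\<bar> powr (p - 1) * \<bar>y\<bar>) \<le> p * (2 powr p * \<bar>y\<bar> powr p)"
    using p by (intro mult_left_mono) auto
  also have "\<dots> \<le> p * p * 2 powr p * \<bar>y\<bar> powr p"
    using p mult_right_mono[of 1 p "p * (2 powr p * \<bar>y\<bar> powr p)"] by (simp add: mult_ac)
  finally have 2: "p * (\<bar>x\<bar> powr (p - 1) * \<bar>y\<bar>) \<le> p * p * 2 powr p * \<bar>y\<bar> powr p" .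
  have "\<bar>p * (sgn x * \<bar>x\<bar> powr (p - 1)) * y\<bar> \<le> p * (\<bar>x\<bar> powr (p - 1) * \<bar>y\<bar>)"
    using p by (auto simp: abs_mult sgn_if)
  moreover have "0 \<le> expansion_const p * (\<bar>x\<bar> powr (p - 2) * y\<^sup>2)"
    using expansion_const_ge_1[of p] p by auto
  moreover have "\<bar>x\<bar> powr p \<ge> 0" by simp
  ultimately show ?thesis using 1 2 unfolding expansion_const_def ring_distribs by linarith
next
  case True
  then have x: "x \<noteq> 0" by auto
  define t where "t = y / x"
  have t: "\<bar>t\<bar> \<le> 1/2" using True x by (auto simp: t_def abs_divide field_simps)
  have y: "y = x * t" using x by (simp add: t_def)
  have xt: "x + y = x * (1 + t)" by (simp add: y algebra_simps)
  have "\<bar>1 + t\<bar> = 1 + t" using t by auto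
  then have "\<bar>x + y\<bar> powr p = \<bar>x\<bar> powr p * (1 + t) powr p"
    unfolding xt abs_mult by (simp add: powr_mult)
  also have "\<dots> \<le> \<bar>x\<bar> powr p * (1 + p * t + p * p * 2 powr p * t\<^sup>2)"
    using one_plus_powr_le_quadratic[OF p t] by (intro mult_left_mono) auto
  also have "\<dots> = \<bar>x\<bar> powr p + p * (\<bar>x\<bar> powr p * t) + p * p * 2 powr p * (\<bar>x\<bar> powr p * t\<^sup>2)"
    by (simp add: algebra_simps)
  also have "\<bar>x\<bar> powr p * t = sgn x * \<bar>x\<bar> powr (p - 1) * y"
    using x by (auto simp: y powr_diff sgn_if field_simps)
  also have "\<bar>x\<bar> powr p * t\<^sup>2 = \<bar>x\<bar> powr (p - 2) * y\<^sup>2"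
    using x by (simp add: y powr_diff power_mult_distrib)
  also have "p * p * 2 powr p * (\<bar>x\<bar> powr (p - 2) * y\<^sup>2)
      \<le> expansion_const p * (\<bar>x\<bar> powr (p - 2) * y\<^sup>2 + \<bar>y\<bar> powr p)"
    unfolding expansion_const_def using p by (intro mult_mono) auto
  finally show ?thesis by (simp add: mult_ac)
qed

text \<open>Jensen's inequality: add up the tangent inequalities at the average \<open>a\<close> of
  the absolute values; their linear parts cancel.\<close>

lemma powr_average_le:
  fixes x :: "'i \<Rightarrow> real"
  assumes J: "finite J" "J \<noteq> {}" and q: "q \<ge> 1"
  shows "\<bar>(\<Sum>j\<in>J. x j) / real (card J)\<bar> powr q \<le> (\<Sum>j\<in>J. \<bar>x j\<bar> powr q) / real (card J)"
proof -
  define a where "a = (\<Sum>j\<in>J. \<bar>x j\<bar>) / real (card J)"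
  have c: "real (card J) > 0" using J by (simp add: card_gt_0_iff)
  have a0: "a \<ge> 0" by (simp add: a_def sum_nonneg)
  have "a powr q \<le> (\<Sum>j\<in>J. \<bar>x j\<bar> powr q) / real (card J)"
  proof (cases "a = 0")
    case True then show ?thesis by (simp add: sum_nonneg)
  next
    case False
    then have a: "a > 0" using a0 by simp
    have "a powr q * (1 + q * (\<bar>x j\<bar> / a - 1)) \<le> \<bar>x j\<bar> powr q" for j
    proof -
      have "a powr q * (1 + q * (\<bar>x j\<bar> / a - 1)) \<le> a powr q * (\<bar>x j\<bar> / a) powr q"
        using powr_ge_tangent[of "\<bar>x j\<bar> / a" q] a q by (intro mult_left_mono) auto
      also have "\<dots> = \<bar>x j\<bar> powr q" using a by (simp add: powr_divide)
      finally show ?thesis .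
    qed
    then have "(\<Sum>j\<in>J. a powr q * (1 + q * (\<bar>x j\<bar> / a - 1))) \<le> (\<Sum>j\<in>J. \<bar>x j\<bar> powr q)"
      by (intro sum_mono)
    also have "(\<Sum>j\<in>J. a powr q * (1 + q * (\<bar>x j\<bar> / a - 1)))
        = a powr q * (real (card J) + q * ((\<Sum>j\<in>J. \<bar>x j\<bar>) / a - real (card J)))"
      by (simp add: sum_distrib_left[symmetric] sum.distrib sum_subtractf sum_divide_distrib)
    also have "(\<Sum>j\<in>J. \<bar>x j\<bar>) / a = real (card J)"
      using a c by (simp add: a_def field_simps)
    finally show ?thesis using c by (simp add: field_simps)
  qed
  moreover have "\<bar>(\<Sum>j\<in>J. x j) / real (card J)\<bar> \<le> a"
    unfolding a_def abs_divide using c by (simp add: divide_right_mono sum_abs)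
  then have "\<bar>(\<Sum>j\<in>J. x j) / real (card J)\<bar> powr q \<le> a powr q"
    using q by (intro powr_mono2) auto
  ultimately show ?thesis by linarith
qed

text \<open>Below the level \<open>a\<close> the first term suffices; above it the surplus factor
  \<open>x powr (r - s)\<close> is at most \<open>a powr (r - s)\<close>. With a level that balances
  the two terms this replaces Hoelder's inequality in comparing moments of different orders.\<close>

lemma powr_le_split:
  fixes x a r s :: real
  assumes "x \<ge> 0" "a > 0" "0 \<le> r" "r \<le> s"
  shows "x powr r \<le> a powr r + a powr (r - s) * x powr s"
proof (cases "x \<le> a")
  case True
  have "x powr r \<le> a powr r" using True assms by (intro powr_mono2) auto
  then show ?thesis by (smt (verit) mult_nonneg_nonneg powr_ge_zero)
next
  case False
  then have "x powr (r - s) \<le> a powr (r - s)" using assms by (intro powr_mono2') auto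
  then have "x powr (r - s) * x powr s \<le> a powr (r - s) * x powr s" by (intro mult_right_mono) auto
  also have "x powr (r - s) * x powr s = x powr r" by (simp add: powr_add[symmetric])
  finally show ?thesis by (smt (verit) powr_ge_zero)
qed

section \<open>Integrability of powers\<close>

lemma (in finite_measure) integrable_powr_mono:
  fixes X :: "'a \<Rightarrow> real"
  assumes [measurable]: "X \<in> borel_measurable M"
    and "integrable M (\<lambda>\<omega>. \<bar>X \<omega>\<bar> powr s)" "0 \<le> r" "r \<le> s"
  shows "integrable M (\<lambda>\<omega>. \<bar>X \<omega>\<bar> powr r)"
  by (rule Bochner_Integration.integrable_bound[where f = "\<lambda>\<omega>. 1 + \<bar>X \<omega>\<bar> powr s"])
     (use assms powr_le_split[of "\<bar>X \<omega>\<bar>" 1 r s for \<omega>] in auto)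

lemma abs_add_powr_le_two:
  fixes x y q :: real assumes "q \<ge> 0"
  shows "\<bar>x + y\<bar> powr q \<le> 2 powr q * (\<bar>x\<bar> powr q + \<bar>y\<bar> powr q)"
proof -
  have "\<bar>x + y\<bar> powr q \<le> (2 * max \<bar>x\<bar> \<bar>y\<bar>) powr q" using assms by (intro powr_mono2) auto
  also have "\<dots> = 2 powr q * (max \<bar>x\<bar> \<bar>y\<bar>) powr q" by (simp add: powr_mult)
  also have "\<dots> \<le> 2 powr q * (\<bar>x\<bar> powr q + \<bar>y\<bar> powr q)"
    by (intro mult_left_mono) (auto simp: max_def)
  finally show ?thesis .
qed

lemma integrable_powr_add:
  fixes X Y :: "'a \<Rightarrow> real"
  assumes [measurable]: "X \<in> borel_measurable M" "Y \<in> borel_measurable M"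
    and "integrable M (\<lambda>\<omega>. \<bar>X \<omega>\<bar> powr q)" "integrable M (\<lambda>\<omega>. \<bar>Y \<omega>\<bar> powr q)" "q \<ge> 0"
  shows "integrable M (\<lambda>\<omega>. \<bar>X \<omega> + Y \<omega>\<bar> powr q)"
  by (rule Bochner_Integration.integrable_bound[where f = "\<lambda>\<omega>. 2 powr q * (\<bar>X \<omega>\<bar> powr q + \<bar>Y \<omega>\<bar> powr q)"])
     (use assms abs_add_powr_le_two in auto)

lemma integrable_powr_sum:
  fixes X :: "'i \<Rightarrow> 'a \<Rightarrow> real"
  assumes "finite I" "\<And>i. i \<in> I \<Longrightarrow> X i \<in> borel_measurable M"
    and "\<And>i. i \<in> I \<Longrightarrow> integrable M (\<lambda>\<omega>. \<bar>X i \<omega>\<bar> powr q)" "q \<ge> 0"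
  shows "integrable M (\<lambda>\<omega>. \<bar>\<Sum>i\<in>I. X i \<omega>\<bar> powr q)"
  using assms(1-3)
proof (induction I)
  case (insert i I)
  then show ?case using assms(4) by (auto intro!: integrable_powr_add)
qed simp

lemma integrable_if_powr_1:
  fixes X :: "'a \<Rightarrow> real"
  assumes "X \<in> borel_measurable M" "integrable M (\<lambda>\<omega>. \<bar>X \<omega>\<bar> powr 1)"
  shows "integrable M X"
  using assms by (simp add: integrable_abs_iff)

section \<open>Moments of sums of independent centred variables\<close>

definition moment_const :: "real \<Rightarrow> real" where
  "moment_const p = (5 * expansion_const p) powr (p / 2)"

text \<open>Induction on the summands: |S + xi|^p is expanded around the sum \<open>S\<close> of the
  earlier ones, and the linear term drops out by independence and centring. The quadratic term is a
  second moment times a moment of \<open>S\<close> of order \<open>p - 2\<close>, which the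
  induction hypothesis bounds by a multiple of m^(p/2-1) B^p. These increments add up to the order
  m^(p/2).\<close>

lemma (in prob_space) moment_indep_sum_le:
  fixes \<xi> :: "'i \<Rightarrow> 'a \<Rightarrow> real"
  assumes I: "finite I" and ind: "indep_vars (\<lambda>_. borel) \<xi> I"
    and p: "p \<ge> 2" and B: "B > 0"
    and int: "\<And>i. i \<in> I \<Longrightarrow> integrable M (\<lambda>\<omega>. \<bar>\<xi> i \<omega>\<bar> powr p)"
    and bound: "\<And>i. i \<in> I \<Longrightarrow> expectation (\<lambda>\<omega>. \<bar>\<xi> i \<omega>\<bar> powr p) \<le> B powr p"
    and mean: "\<And>i. i \<in> I \<Longrightarrow> expectation (\<xi> i) = 0"
  shows "expectation (\<lambda>\<omega>. \<bar>\<Sum>i\<in>I. \<xi> i \<omega>\<bar> powr p)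
           \<le> moment_const p * (real (card I) powr (p / 2) * B powr p)"
  using I ind int bound mean
proof (induction I)
  case empty then show ?case by simp
next
  case (insert i I)
  define C where "C = expansion_const p"
  define S where "S \<omega> = (\<Sum>i\<in>I. \<xi> i \<omega>)" for \<omega>
  define m where "m = real (card I)"
  have C: "C \<ge> 1" using expansion_const_ge_1 p by (simp add: C_def)
  have rv[measurable]: "j \<in> insert i I \<Longrightarrow> \<xi> j \<in> borel_measurable M" for j
    using insert.prems(1) by (auto simp: indep_vars_def)
  have xi[measurable]: "\<xi> i \<in> borel_measurable M" and S[measurable]: "S \<in> borel_measurable M"
    unfolding S_def by (auto intro: rv borel_measurable_sum)
  have IH: "expectation (\<lambda>\<omega>. \<bar>S \<omega>\<bar> powr p) \<le> moment_const p * (m powr (p / 2) * B powr p)"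
    unfolding S_def m_def using insert by (auto intro: indep_vars_subset)
  have Sp: "integrable M (\<lambda>\<omega>. \<bar>S \<omega>\<bar> powr p)"
    unfolding S_def using insert p by (intro integrable_powr_sum) auto
  have xp: "integrable M (\<lambda>\<omega>. \<bar>\<xi> i \<omega>\<bar> powr p)" using insert.prems by auto
  have iv: "indep_var borel (\<xi> i) borel S"
    unfolding S_def by (rule indep_vars_sum) (use insert in auto)
  have S1: "integrable M (\<lambda>\<omega>. sgn (S \<omega>) * \<bar>S \<omega>\<bar> powr (p - 1))"
    by (rule Bochner_Integration.integrable_bound[OF integrable_powr_mono[OF S Sp, of "p - 1"]])
       (use p in \<open>auto simp: abs_mult sgn_if\<close>)
  have S2: "integrable M (\<lambda>\<omega>. \<bar>S \<omega>\<bar> powr (p - 2))"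
    using p by (intro integrable_powr_mono[OF S Sp]) auto
  have x1: "integrable M (\<xi> i)"
    by (rule integrable_if_powr_1[OF xi integrable_powr_mono[OF xi xp]]) (use p in auto)
  have x2: "integrable M (\<lambda>\<omega>. (\<xi> i \<omega>)\<^sup>2)"
    using integrable_powr_mono[OF xi xp, of 2] p by simp
  have iv1: "indep_var borel (\<xi> i) borel (\<lambda>\<omega>. sgn (S \<omega>) * \<bar>S \<omega>\<bar> powr (p - 1))"
    using indep_var_compose[OF iv, of "\<lambda>x. x" borel "\<lambda>x. sgn x * \<bar>x\<bar> powr (p - 1)" borel]
    by (simp add: comp_def)
  have iv2: "indep_var borel (\<lambda>\<omega>. (\<xi> i \<omega>)\<^sup>2) borel (\<lambda>\<omega>. \<bar>S \<omega>\<bar> powr (p - 2))"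
    using indep_var_compose[OF iv, of "\<lambda>x. x\<^sup>2" borel "\<lambda>x. \<bar>x\<bar> powr (p - 2)" borel]
    by (simp add: comp_def)
  have E1: "expectation (\<lambda>\<omega>. \<xi> i \<omega> * (sgn (S \<omega>) * \<bar>S \<omega>\<bar> powr (p - 1))) = 0"
    using indep_var_lebesgue_integral[OF iv1 x1 S1] insert.prems(4) by simp
  have I1: "integrable M (\<lambda>\<omega>. \<xi> i \<omega> * (sgn (S \<omega>) * \<bar>S \<omega>\<bar> powr (p - 1)))"
    by (rule indep_var_integrable[OF iv1 x1 S1])
  have E2: "expectation (\<lambda>\<omega>. (\<xi> i \<omega>)\<^sup>2 * \<bar>S \<omega>\<bar> powr (p - 2))
      = expectation (\<lambda>\<omega>. (\<xi> i \<omega>)\<^sup>2) * expectation (\<lambda>\<omega>. \<bar>S \<omega>\<bar> powr (p - 2))"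
    by (rule indep_var_lebesgue_integral[OF iv2 x2 S2])
  have I2: "integrable M (\<lambda>\<omega>. (\<xi> i \<omega>)\<^sup>2 * \<bar>S \<omega>\<bar> powr (p - 2))"
    by (rule indep_var_integrable[OF iv2 x2 S2])
  have step: "expectation (\<lambda>\<omega>. \<bar>\<Sum>j\<in>insert i I. \<xi> j \<omega>\<bar> powr p)
     \<le> expectation (\<lambda>\<omega>. \<bar>S \<omega>\<bar> powr p) +
        C * (expectation (\<lambda>\<omega>. (\<xi> i \<omega>)\<^sup>2) * expectation (\<lambda>\<omega>. \<bar>S \<omega>\<bar> powr (p - 2)) + B powr p)"
  proof -
    have "expectation (\<lambda>\<omega>. \<bar>\<Sum>j\<in>insert i I. \<xi> j \<omega>\<bar> powr p)
      \<le> expectation (\<lambda>\<omega>. \<bar>S \<omega>\<bar> powr p + p * (\<xi> i \<omega> * (sgn (S \<omega>) * \<bar>S \<omega>\<bar> powr (p - 1)))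
            + C * ((\<xi> i \<omega>)\<^sup>2 * \<bar>S \<omega>\<bar> powr (p - 2) + \<bar>\<xi> i \<omega>\<bar> powr p))"
    proof (rule integral_mono)
      show "integrable M (\<lambda>\<omega>. \<bar>\<Sum>j\<in>insert i I. \<xi> j \<omega>\<bar> powr p)"
        using insert p by (intro integrable_powr_sum) auto
      show "integrable M (\<lambda>\<omega>. \<bar>S \<omega>\<bar> powr p + p * (\<xi> i \<omega> * (sgn (S \<omega>) * \<bar>S \<omega>\<bar> powr (p - 1)))
            + C * ((\<xi> i \<omega>)\<^sup>2 * \<bar>S \<omega>\<bar> powr (p - 2) + \<bar>\<xi> i \<omega>\<bar> powr p))"
        using Sp I1 I2 xp by auto
    next
      fix \<omega>
      have "(\<Sum>j\<in>insert i I. \<xi> j \<omega>) = S \<omega> + \<xi> i \<omega>" using insert.hyps by (simp add: S_def)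
      then show "\<bar>\<Sum>j\<in>insert i I. \<xi> j \<omega>\<bar> powr p \<le> \<bar>S \<omega>\<bar> powr p + p * (\<xi> i \<omega> * (sgn (S \<omega>) * \<bar>S \<omega>\<bar> powr (p - 1)))
            + C * ((\<xi> i \<omega>)\<^sup>2 * \<bar>S \<omega>\<bar> powr (p - 2) + \<bar>\<xi> i \<omega>\<bar> powr p)"
        using abs_add_powr_le[OF p, of "S \<omega>" "\<xi> i \<omega>"] by (simp add: C_def mult_ac)
    qed
    also have "\<dots> = expectation (\<lambda>\<omega>. \<bar>S \<omega>\<bar> powr p) +
        C * (expectation (\<lambda>\<omega>. (\<xi> i \<omega>)\<^sup>2) * expectation (\<lambda>\<omega>. \<bar>S \<omega>\<bar> powr (p - 2)) + expectation (\<lambda>\<omega>. \<bar>\<xi> i \<omega>\<bar> powr p))"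
      using Sp I1 I2 xp E1 E2 by simp
    also have "\<dots> \<le> expectation (\<lambda>\<omega>. \<bar>S \<omega>\<bar> powr p) +
        C * (expectation (\<lambda>\<omega>. (\<xi> i \<omega>)\<^sup>2) * expectation (\<lambda>\<omega>. \<bar>S \<omega>\<bar> powr (p - 2)) + B powr p)"
      using insert.prems(3)[of i] C by (intro add_left_mono mult_left_mono) auto
    finally show ?thesis .
  qed
  show ?case
  proof (cases "I = {}")
    \<comment> \<open>Treated separately because the level \<open>a\<close> used below would be
      0.\<close>
    case True
    have "expectation (\<lambda>\<omega>. \<bar>\<xi> i \<omega>\<bar> powr p) \<le> 1 * B powr p" using insert.prems by auto
    also have "\<dots> \<le> moment_const p * B powr p"
      unfolding moment_const_def using C p
      by (intro mult_right_mono ge_one_powr_ge_zero) (auto simp: C_def)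
    finally show ?thesis using True by simp
  next
    case False
    have m: "m \<ge> 1" using False insert.hyps by (simp add: m_def Suc_le_eq card_gt_0_iff)
    \<comment> \<open>For this level \<open>a powr p\<close> is exactly the bound of the induction
      hypothesis, so each term of \<open>powr_le_split\<close> contributes at most
      \<open>a powr (p - 2)\<close>.\<close>
    define a where "a = (5 * C * m) powr (1/2) * B"
    have a: "a > 0" using C m B by (simp add: a_def)
    have ar: "a powr r = (5 * C) powr (r / 2) * m powr (r / 2) * B powr r" for r
      using C m B by (simp add: a_def powr_mult powr_powr)
    have "expectation (\<lambda>\<omega>. \<bar>S \<omega>\<bar> powr (p - 2))
        \<le> expectation (\<lambda>\<omega>. a powr (p - 2) + a powr ((p - 2) - p) * \<bar>S \<omega>\<bar> powr p)"
      using a p by (intro integral_mono S2 powr_le_split) (auto simp: Sp)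
    also have "\<dots> = a powr (p - 2) + a powr ((p - 2) - p) * expectation (\<lambda>\<omega>. \<bar>S \<omega>\<bar> powr p)"
      using Sp by (simp add: prob_space)
    also have "\<dots> \<le> a powr (p - 2) + a powr ((p - 2) - p) * a powr p"
      using IH unfolding ar[of p] moment_const_def C_def[symmetric] by (intro add_left_mono mult_left_mono) auto
    also have "a powr ((p - 2) - p) * a powr p = a powr (p - 2)" by (simp only: powr_add[symmetric]) simp
    finally have s: "expectation (\<lambda>\<omega>. \<bar>S \<omega>\<bar> powr (p - 2)) \<le> 2 * a powr (p - 2)" by simp
    have "expectation (\<lambda>\<omega>. (\<xi> i \<omega>)\<^sup>2) = expectation (\<lambda>\<omega>. \<bar>\<xi> i \<omega>\<bar> powr 2)" by simp
    also have "\<dots> \<le> expectation (\<lambda>\<omega>. B powr 2 + B powr (2 - p) * \<bar>\<xi> i \<omega>\<bar> powr p)"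
      using B p xp x2 by (intro integral_mono powr_le_split) auto
    also have "\<dots> = B powr 2 + B powr (2 - p) * expectation (\<lambda>\<omega>. \<bar>\<xi> i \<omega>\<bar> powr p)"
      using xp by (simp add: prob_space)
    also have "\<dots> \<le> B powr 2 + B powr (2 - p) * B powr p"
      using insert.prems(3)[of i] by (intro add_left_mono mult_left_mono) auto
    also have "B powr (2 - p) * B powr p = B powr 2" by (simp only: powr_add[symmetric]) simp
    finally have x: "expectation (\<lambda>\<omega>. (\<xi> i \<omega>)\<^sup>2) \<le> 2 * B powr 2" by simp
    \<comment> \<open>The two moment bounds produce the factor 2 * 2 = 4; as both powers here are at
      least 1, the leftover \<open>B powr p\<close> can be counted as a fifth copy. This is the 5 in
      \<open>moment_const\<close>.\<close>
    have D: "(5 * C) powr ((p - 2) / 2) \<ge> 1" "m powr ((p - 2) / 2) \<ge> 1"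
      using C p m by (auto intro!: ge_one_powr_ge_zero)
    have "expectation (\<lambda>\<omega>. (\<xi> i \<omega>)\<^sup>2) * expectation (\<lambda>\<omega>. \<bar>S \<omega>\<bar> powr (p - 2))
        \<le> (2 * B powr 2) * (2 * a powr (p - 2))"
      using x s by (intro mult_mono) auto
    also have "\<dots> = 4 * ((5 * C) powr ((p - 2) / 2) * m powr ((p - 2) / 2)) * (B powr 2 * B powr (p - 2))"
      unfolding ar by simp
    also have "B powr 2 * B powr (p - 2) = B powr p" by (simp only: powr_add[symmetric]) simp
    finally have "C * (expectation (\<lambda>\<omega>. (\<xi> i \<omega>)\<^sup>2) * expectation (\<lambda>\<omega>. \<bar>S \<omega>\<bar> powr (p - 2)) + B powr p)
      \<le> C * (4 * ((5 * C) powr ((p - 2) / 2) * m powr ((p - 2) / 2)) * B powr p + 1 * B powr p)"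
      using C by (intro mult_left_mono) auto
    also have "\<dots> \<le> C * (4 * ((5 * C) powr ((p - 2) / 2) * m powr ((p - 2) / 2)) * B powr p
         + ((5 * C) powr ((p - 2) / 2) * m powr ((p - 2) / 2)) * B powr p)"
      using D C mult_mono[OF D] by (intro mult_left_mono add_left_mono mult_right_mono) auto
    also have "\<dots> = ((5 * C) * (5 * C) powr ((p - 2) / 2)) * m powr ((p - 2) / 2) * B powr p"
      by (simp add: algebra_simps)
    also have "(5 * C) * (5 * C) powr ((p - 2) / 2) = moment_const p"
      using powr_mult_base[of "5 * C" "(p - 2) / 2"] C
      unfolding moment_const_def C_def[symmetric] by (simp add: diff_divide_distrib)
    finally have inc: "C * (expectation (\<lambda>\<omega>. (\<xi> i \<omega>)\<^sup>2) * expectation (\<lambda>\<omega>. \<bar>S \<omega>\<bar> powr (p - 2)) + B powr p)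
       \<le> moment_const p * m powr ((p - 2) / 2) * B powr p" .
    \<comment> \<open>The bound for \<open>m\<close> summands plus the increment must fit under the
      bound for \<open>m + 1\<close>. This is Bernoulli's inequality for the ratio (m + 1) / m with
      exponent p/2, which is at least 1.\<close>
    have "m powr (p / 2) + m powr ((p - 2) / 2) = m powr (p/2) * (1 + 1 / m)"
    proof -
      have "(p - 2) / 2 = p / 2 - 1" by simp
      then show ?thesis using m by (simp only: powr_diff) (simp add: field_simps)
    qed
    also have "\<dots> \<le> m powr (p/2) * (1 + (p/2) * ((m + 1) / m - 1))"
      using m p by (intro mult_left_mono add_left_mono) (auto simp: field_simps)
    also have "\<dots> \<le> m powr (p/2) * ((m + 1) / m) powr (p/2)"
      using m p by (intro mult_left_mono powr_ge_tangent) auto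
    also have "\<dots> = (m + 1) powr (p / 2)" using m by (simp add: powr_divide)
    finally have mm: "m powr (p / 2) + m powr ((p - 2) / 2) \<le> (m + 1) powr (p / 2)" .
    have K: "moment_const p * B powr p \<ge> 0" by (simp add: moment_const_def)
    have "expectation (\<lambda>\<omega>. \<bar>\<Sum>j\<in>insert i I. \<xi> j \<omega>\<bar> powr p)
      \<le> (moment_const p * B powr p) * (m powr (p / 2) + m powr ((p - 2) / 2))"
      using step IH inc by (simp add: algebra_simps)
    also have "\<dots> \<le> (moment_const p * B powr p) * (m + 1) powr (p / 2)"
      using mult_left_mono[OF mm K] .
    finally show ?thesis using insert.hyps by (simp add: m_def mult_ac add.commute)
  qed
qed

section \<open>Subsets and their increasing enumerations\<close>

definition subsets_of_size :: "nat \<Rightarrow> nat \<Rightarrow> nat set set" where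
  "subsets_of_size n d = {A. A \<subseteq> {1..n} \<and> card A = d}"

text \<open>Positions are counted from 1, so \<open>enum A 1\<close> is the least element of \<open>A\<close>.\<close>

definition enum :: "nat set \<Rightarrow> nat \<Rightarrow> nat" where
  "enum A j = sorted_list_of_set A ! (j - 1)"

lemma finite_subsets_of_size [simp]: "finite (subsets_of_size n d)"
  unfolding subsets_of_size_def by (rule finite_subset[of _ "Pow {1..n}"]) auto

lemma card_subsets_of_size: "card (subsets_of_size n d) = n choose d"
  unfolding subsets_of_size_def using n_subsets[of "{1..n}" d] by simp

lemma subsets_of_sizeD:
  assumes "A \<in> subsets_of_size n d"
  shows "A \<subseteq> {1..n}" "card A = d" "finite A"
  using assms finite_subset[of A "{1..n}"] by (auto simp: subsets_of_size_def)

lemma strict_mono_on_enum: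
  assumes "finite A" shows "strict_mono_on {1..card A} (enum A)"
proof (rule strict_mono_onI)
  fix r s assume "r \<in> {1..card A}" "s \<in> {1..card A}" "r < s"
  then show "enum A r < enum A s"
    unfolding enum_def using sorted_wrt_nth_less[of "(<)" "sorted_list_of_set A" "r - 1" "s - 1"] assms
    by auto
qed

lemma enum_image:
  assumes "finite A" shows "enum A ` {1..card A} = A"
proof -
  have "enum A ` {1..card A} = (!) (sorted_list_of_set A) ` {0..<card A}"
  proof -
    have "(\<lambda>j. j - 1) ` {1..card A} = {0..<card A}"
      by (force simp: image_iff Bex_def intro: exI[of _ "Suc x" for x])
    then show ?thesis unfolding enum_def by (metis (no_types, lifting) image_cong image_image)
  qed
  also have "\<dots> = set (sorted_list_of_set A)"
    using assms by (metis atLeast0LessThan nth_image length_sorted_list_of_set order_refl take_all)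
  finally show ?thesis using assms by simp
qed

lemma inj_on_enum: "finite A \<Longrightarrow> inj_on (enum A) {1..card A}"
  using strict_mono_on_enum strict_mono_on_imp_inj_on by blast

lemma enum_in: "finite A \<Longrightarrow> j \<in> {1..card A} \<Longrightarrow> enum A j \<in> A"
  using enum_image by blast

lemma card_below_enum:
  assumes "finite A" "j \<in> {1..card A}"
  shows "card (A \<inter> {..<enum A j}) = j - 1"
proof -
  have "A \<inter> {..<enum A j} = enum A ` {1..<j}"
  proof -
    have "x < enum A j \<longleftrightarrow> i < j" if "x = enum A i" "i \<in> {1..card A}" for x i
      using that strict_mono_on_less[OF strict_mono_on_enum[OF assms(1)], of i j] assms(2) by auto
    then have "{x \<in> enum A ` {1..card A}. x < enum A j} = enum A ` {i \<in> {1..card A}. i < j}" by auto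
    moreover have "{i \<in> {1..card A}. i < j} = {1..<j}" using assms(2) by auto
    ultimately show ?thesis using enum_image[OF assms(1)] by auto
  qed
  moreover have "inj_on (enum A) {1..<j}"
    by (rule inj_on_subset[OF inj_on_enum[OF assms(1)]]) (use assms(2) in auto)
  ultimately show ?thesis by (simp add: card_image)
qed

text \<open>Replaces positions in a sorted list by cardinalities; the counting below argues through
  this criterion.\<close>

lemma enum_eq_iff:
  assumes "finite A" "j \<in> {1..card A}" "k \<in> A"
  shows "enum A j = k \<longleftrightarrow> card (A \<inter> {..<k}) = j - 1"
proof
  assume "card (A \<inter> {..<k}) = j - 1"
  moreover obtain i where i: "i \<in> {1..card A}" "k = enum A i"
    using enum_image[OF assms(1)] assms(3) by blast
  ultimately have "i - 1 = j - 1" using card_below_enum[OF assms(1) i(1)] by simp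
  then show "enum A j = k" using i assms(2) by (cases i; cases j) auto
qed (use card_below_enum assms in auto)

lemma enum_strict_mono_image:
  assumes "strict_mono_on {1..d} s" "j \<in> {1..d}"
  shows "enum (s ` {1..d}) j = s j"
proof -
  have inj: "inj_on s {1..d}" using assms(1) strict_mono_on_imp_inj_on by blast
  have fin: "finite (s ` {1..d})" and crd: "card (s ` {1..d}) = d"
    using inj by (simp_all add: card_image)
  have "s ` {1..d} \<inter> {..<s j} = s ` {1..<j}"
  proof -
    have "{x \<in> s ` {1..d}. x < s j} = s ` {i \<in> {1..d}. i < j}"
      using strict_mono_on_less[OF assms(1) _ assms(2)] by auto
    moreover have "{i \<in> {1..d}. i < j} = {1..<j}" using assms(2) by auto
    ultimately show ?thesis by auto
  qed
  moreover have "inj_on s {1..<j}" by (rule inj_on_subset[OF inj]) (use assms(2) in auto)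
  ultimately have "card (s ` {1..d} \<inter> {..<s j}) = j - 1" by (simp add: card_image)
  then show ?thesis using enum_eq_iff[OF fin, of j "s j"] crd assms(2) by simp
qed

text \<open>An increasing map is determined by its image, which it enumerates. Over sets,
  intersections and permutations become available.\<close>

lemma sum_strict_mono_eq_sum_subsets:
  "(\<Sum>s | s \<in> {1..d} \<rightarrow>\<^sub>E {1..n} \<and> strict_mono_on {1..d} s. F s)
     = (\<Sum>A\<in>subsets_of_size n d. F (\<lambda>j\<in>{1..d}. enum A j))"
proof (rule sum.reindex_bij_witness[where i = "\<lambda>A. \<lambda>j\<in>{1..d}. enum A j" and j = "\<lambda>s. s ` {1..d}"])
  fix s assume s: "s \<in> {s. s \<in> {1..d} \<rightarrow>\<^sub>E {1..n} \<and> strict_mono_on {1..d} s}"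
  then show *: "(\<lambda>j\<in>{1..d}. enum (s ` {1..d}) j) = s"
    by (auto simp: fun_eq_iff restrict_def PiE_def extensional_def intro!: enum_strict_mono_image[simplified])
  have "inj_on s {1..d}" using s strict_mono_on_imp_inj_on by blast
  then show "s ` {1..d} \<in> subsets_of_size n d"
    using s by (auto simp: subsets_of_size_def card_image PiE_def)
  show "F (\<lambda>j\<in>{1..d}. enum (s ` {1..d}) j) = F s" unfolding * ..
next
  fix A assume A: "A \<in> subsets_of_size n d"
  note D = subsets_of_sizeD[OF A]
  show "(\<lambda>j\<in>{1..d}. enum A j) ` {1..d} = A"
    using enum_image[OF D(3)] D(2) by simp
  show "(\<lambda>j\<in>{1..d}. enum A j) \<in> {s. s \<in> {1..d} \<rightarrow>\<^sub>E {1..n} \<and> strict_mono_on {1..d} s}"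
    using strict_mono_on_enum[OF D(3)] enum_in[OF D(3)] D
    by (auto simp: strict_mono_on_def)
qed

text \<open>Cut the set at \<open>k\<close>: the \<open>i - 1\<close> points below and the
  \<open>d - i\<close> points above are chosen freely and independently of each other.\<close>

lemma card_enum_eq:
  assumes i: "i \<in> {1..d}" and k: "k \<in> {1..n}"
  shows "card {A \<in> subsets_of_size n d. enum A i = k} = ((k - 1) choose (i - 1)) * ((n - k) choose (d - i))"
proof -
  let ?L = "{B. B \<subseteq> {1..<k} \<and> card B = i - 1}" and ?R = "{C. C \<subseteq> {k<..n} \<and> card C = d - i}"
  have "bij_betw (\<lambda>A. (A \<inter> {..<k}, A \<inter> {k<..})) {A \<in> subsets_of_size n d. enum A i = k} (?L \<times> ?R)"
  proof (rule bij_betw_byWitness[where f' = "\<lambda>(B, C). insert k (B \<union> C)"])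
    have split: "A = insert k ((A \<inter> {..<k}) \<union> (A \<inter> {k<..}))" if "k \<in> A" for A :: "nat set"
      using that by auto
    show "\<forall>A\<in>{A \<in> subsets_of_size n d. enum A i = k}.
        (case (A \<inter> {..<k}, A \<inter> {k<..}) of (B, C) \<Rightarrow> insert k (B \<union> C)) = A"
    proof
      fix A assume "A \<in> {A \<in> subsets_of_size n d. enum A i = k}"
      then have "k \<in> A" using enum_in[of A i] subsets_of_sizeD[of A n d] i by auto
      then show "(case (A \<inter> {..<k}, A \<inter> {k<..}) of (B, C) \<Rightarrow> insert k (B \<union> C)) = A"
        using split[of A] by simp
    qed
    show "\<forall>BC\<in>?L \<times> ?R. ((case BC of (B, C) \<Rightarrow> insert k (B \<union> C)) \<inter> {..<k},
        (case BC of (B, C) \<Rightarrow> insert k (B \<union> C)) \<inter> {k<..}) = BC"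
      by auto
    show "(\<lambda>A. (A \<inter> {..<k}, A \<inter> {k<..})) ` {A \<in> subsets_of_size n d. enum A i = k} \<subseteq> ?L \<times> ?R"
    proof safe
      fix A assume A: "A \<in> subsets_of_size n d" and k_def: "k = enum A i"
      note D = subsets_of_sizeD[OF A]
      have kA: "k \<in> A" using enum_in[of A i] D i k_def by auto
      show c1: "card (A \<inter> {..<enum A i}) = i - 1" using card_below_enum D i by simp
      have "card A = Suc (card ((A \<inter> {..<k}) \<union> (A \<inter> {k<..})))"
        by (subst split[OF kA], subst card_insert_disjoint) (use D in auto)
      also have "card ((A \<inter> {..<k}) \<union> (A \<inter> {k<..})) = card (A \<inter> {..<k}) + card (A \<inter> {k<..})"
        by (intro card_Un_disjoint) (use D in auto)
      finally show "card (A \<inter> {enum A i<..}) = d - i" using c1 D i k_def by auto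
      show "x \<in> {1..<enum A i}" if "x \<in> A" "x < enum A i" for x using that D by auto
      show "x \<in> {enum A i<..n}" if "x \<in> A" "enum A i < x" for x using that D by auto
    qed
    show "(\<lambda>(B, C). insert k (B \<union> C)) ` (?L \<times> ?R) \<subseteq> {A \<in> subsets_of_size n d. enum A i = k}"
    proof safe
      fix B C assume B: "B \<subseteq> {1..<k}" "card B = i - 1" and C: "C \<subseteq> {k<..n}" "card C = d - i"
      have fin: "finite B" "finite C" using B C by (auto intro: finite_subset)
      have "card (insert k (B \<union> C)) = Suc (card (B \<union> C))"
        by (subst card_insert_disjoint) (use fin B C in auto)
      also have "card (B \<union> C) = card B + card C"
        by (intro card_Un_disjoint) (use fin B C in force)+
      finally have crd: "card (insert k (B \<union> C)) = d" using B C i by auto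
      have "B \<subseteq> {1..n}" by (rule order.trans[OF B(1)]) (use k in auto)
      moreover have "C \<subseteq> {1..n}" by (rule order.trans[OF C(1)]) (use k in auto)
      ultimately show "insert k (B \<union> C) \<in> subsets_of_size n d"
        using crd k by (simp add: subsets_of_size_def)
      have "insert k (B \<union> C) \<inter> {..<k} = B" using B C by auto
      then show "enum (insert k (B \<union> C)) i = k"
        using enum_eq_iff[of "insert k (B \<union> C)" i k] fin crd i B by auto
    qed
  qed
  then have "card {A \<in> subsets_of_size n d. enum A i = k} = card (?L \<times> ?R)"
    by (rule bij_betw_same_card)
  also have "\<dots> = ((k - 1) choose (i - 1)) * ((n - k) choose (d - i))"
    by (simp add: card_cartesian_product n_subsets)
  finally show ?thesis .
qed

section \<open>Averaging over permutations\<close>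

lemma ex_permutes_image_eq:
  assumes "finite V" "A \<subseteq> V" "B \<subseteq> V" "card A = card B"
  obtains \<tau> where "\<tau> permutes V" "\<tau> ` A = B"
proof -
  have fin: "finite A" "finite B" using assms finite_subset by auto
  obtain f where f: "bij_betw f A B" using finite_same_card_bij[OF fin assms(4)] by auto
  have "card (V - A) = card (V - B)" using assms fin by (simp add: card_Diff_subset)
  then obtain g where g: "bij_betw g (V - A) (V - B)"
    using finite_same_card_bij[of "V - A" "V - B"] assms by auto
  define \<tau> where "\<tau> x = (if x \<in> A then f x else if x \<in> V then g x else x)" for x
  have "bij_betw \<tau> (A \<union> (V - A)) (B \<union> (V - B))"
  proof (rule bij_betw_combine)
    show "bij_betw \<tau> A B" using f by (rule bij_betw_cong[THEN iffD1, rotated]) (auto simp: \<tau>_def)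
    show "bij_betw \<tau> (V - A) (V - B)"
      using g by (rule bij_betw_cong[THEN iffD1, rotated]) (auto simp: \<tau>_def)
  qed auto
  moreover have "A \<union> (V - A) = V" "B \<union> (V - B) = V" using assms by auto
  ultimately have "\<tau> permutes V" using assms(2) by (intro bij_imp_permutes) (auto simp: \<tau>_def)
  moreover have "\<tau> ` A = B" using f by (auto simp: \<tau>_def bij_betw_def)
  ultimately show ?thesis using that by blast
qed

text \<open>The sum over permutations is the same for all \<open>d\<close>-sets, since composing
  with a permutation that carries one set to another merely reorders it. Adding it up over all
  \<open>d\<close>-sets and exchanging the sums leaves, for each permutation, the full sum over
  \<open>d\<close>-sets.\<close>

lemma sum_permutes_image:
  fixes g :: "nat set \<Rightarrow> real"
  assumes B: "B \<in> subsets_of_size n d"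
  shows "real (n choose d) * (\<Sum>\<pi> | \<pi> permutes {1..n}. g (\<pi> ` B))
           = fact n * (\<Sum>A\<in>subsets_of_size n d. g A)"
proof -
  define T where "T B = (\<Sum>\<pi> | \<pi> permutes {1..n}. g (\<pi> ` B))" for B
  have T: "T A = T B" if A: "A \<in> subsets_of_size n d" for A
  proof -
    obtain \<tau> where \<tau>: "\<tau> permutes {1..n}" "\<tau> ` B = A"
      using ex_permutes_image_eq[of "{1..n}" B A] A B subsets_of_sizeD[OF A] subsets_of_sizeD[OF B] by auto
    have "T B = (\<Sum>\<pi> | \<pi> permutes {1..n}. g ((\<pi> \<circ> \<tau>) ` B))"
      unfolding T_def by (rule sum_permutations_compose_right[OF \<tau>(1)])
    also have "\<dots> = T A" unfolding T_def image_comp[symmetric] \<tau>(2) ..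
    finally show ?thesis ..
  qed
  have perm: "(\<Sum>A\<in>subsets_of_size n d. g (\<pi> ` A)) = (\<Sum>A\<in>subsets_of_size n d. g A)"
    if \<pi>: "\<pi> permutes {1..n}" for \<pi>
  proof (rule sum.reindex_bij_witness[where i = "\<lambda>A. inv \<pi> ` A" and j = "\<lambda>A. \<pi> ` A"])
    have *: "\<sigma> ` A \<in> subsets_of_size n d" if "\<sigma> permutes {1..n}" "A \<in> subsets_of_size n d" for \<sigma> A
    proof -
      have "\<sigma> ` A \<subseteq> \<sigma> ` {1..n}" using that by (intro image_mono) (auto simp: subsets_of_size_def)
      then show ?thesis using that permutes_image[OF that(1)] permutes_inj_on[OF that(1)]
        by (auto simp: subsets_of_size_def card_image)
    qed
    fix A assume A: "A \<in> subsets_of_size n d"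
    show "\<pi> ` A \<in> subsets_of_size n d" "inv \<pi> ` A \<in> subsets_of_size n d"
      using * A \<pi> permutes_inv[OF \<pi>] by auto
    show "inv \<pi> ` \<pi> ` A = A" "\<pi> ` inv \<pi> ` A = A"
      using permutes_inverses[OF \<pi>] by (auto simp: image_image)
  qed auto
  have "real (n choose d) * T B = (\<Sum>A\<in>subsets_of_size n d. T A)"
    using T by (simp add: card_subsets_of_size)
  also have "\<dots> = (\<Sum>\<pi> | \<pi> permutes {1..n}. \<Sum>A\<in>subsets_of_size n d. g (\<pi> ` A))"
    unfolding T_def by (rule sum.swap)
  also have "\<dots> = (\<Sum>\<pi> | \<pi> permutes {1..n}. \<Sum>A\<in>subsets_of_size n d. g A)"
    by (rule sum.cong[OF refl]) (use perm in simp)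
  also have "\<dots> = fact n * (\<Sum>A\<in>subsets_of_size n d. g A)"
    using card_permutations[of "{1..n}" n] by simp
  finally show ?thesis unfolding T_def .
qed

section \<open>Binomial counts and their asymptotics\<close>

lemma binomial_le_power: "n choose k \<le> n ^ k"
  by (cases "k \<le> n") (auto simp: binomial_le_pow binomial_eq_0)

text \<open>Two distinct common points can be chosen in at most n^2 ways, and each of the two sets
  is then determined by its other \<open>d - 2\<close> points.\<close>

lemma card_pairs_meeting_twice_le:
  "card {(A, B). A \<in> subsets_of_size n d \<and> B \<in> subsets_of_size n d \<and> card (A \<inter> B) \<ge> 2} \<le> n ^ (2 * d - 2)"
proof (cases "d \<ge> 2")
  \<comment> \<open>No pair qualifies here, whereas the exponent \<open>d - 2\<close> of the count
    below would be truncated.\<close>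
  case False
  have "card (A \<inter> B) < 2" if "A \<in> subsets_of_size n d" for A B
    using False card_mono[of A "A \<inter> B"] subsets_of_sizeD[OF that] by auto
  then have "{(A, B). A \<in> subsets_of_size n d \<and> B \<in> subsets_of_size n d \<and> card (A \<inter> B) \<ge> 2} = {}"
    by (force simp: not_le[symmetric])
  then show ?thesis by (simp only: card.empty)
next
  case True
  define D where "D k l = {A \<in> subsets_of_size n d. k \<in> A \<and> l \<in> A}" for k l
  have cD: "card (D k l) \<le> n ^ (d - 2)" if "k \<noteq> l" for k l
  proof -
    have "card (D k l) \<le> card (subsets_of_size n (d - 2))"
    proof (rule card_inj_on_le[where f = "\<lambda>A. A - {k, l}"])
      show "inj_on (\<lambda>A. A - {k, l}) (D k l)"
        by (rule inj_onI) (auto simp: D_def)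
      have "card (A - {k, l}) = d - 2" if "A \<in> D k l" for A
        using that \<open>k \<noteq> l\<close> subsets_of_sizeD[of A n d] by (subst card_Diff_subset) (auto simp: D_def)
      then show "(\<lambda>A. A - {k, l}) ` D k l \<subseteq> subsets_of_size n (d - 2)"
        by (auto simp: D_def subsets_of_size_def)
    qed simp
    then show ?thesis using binomial_le_power[of n "d - 2"] by (simp add: card_subsets_of_size)
  qed
  have fD: "finite (D k l)" for k l by (simp add: D_def)
  let ?P = "{p \<in> {1..n} \<times> {1..n}. fst p \<noteq> snd p}"
  have "{(A, B). A \<in> subsets_of_size n d \<and> B \<in> subsets_of_size n d \<and> card (A \<inter> B) \<ge> 2}
      \<subseteq> (\<Union>p\<in>?P. D (fst p) (snd p) \<times> D (fst p) (snd p))"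
  proof clarify
    fix A B assume A: "A \<in> subsets_of_size n d" and B: "B \<in> subsets_of_size n d" and 2: "2 \<le> card (A \<inter> B)"
    obtain k l where "k \<in> A \<inter> B" "l \<in> A \<inter> B" "k \<noteq> l"
      using 2 card_le_Suc0_iff_eq[of "A \<inter> B"] subsets_of_sizeD[OF A] by fastforce
    then show "(A, B) \<in> (\<Union>p\<in>?P. D (fst p) (snd p) \<times> D (fst p) (snd p))"
      using A B subsets_of_sizeD(1)[OF A] by (intro UN_I[of "(k, l)"]) (auto simp: D_def)
  qed
  then have "card {(A, B). A \<in> subsets_of_size n d \<and> B \<in> subsets_of_size n d \<and> card (A \<inter> B) \<ge> 2}
      \<le> card (\<Union>p\<in>?P. D (fst p) (snd p) \<times> D (fst p) (snd p))"
    by (intro card_mono) (auto simp: fD)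
  also have "\<dots> \<le> (\<Sum>p\<in>?P. card (D (fst p) (snd p) \<times> D (fst p) (snd p)))"
    by (rule card_UN_le) auto
  also have "\<dots> \<le> (\<Sum>p\<in>?P. n ^ (d - 2) * n ^ (d - 2))"
    unfolding card_cartesian_product by (intro sum_mono mult_mono cD) auto
  also have "\<dots> \<le> (n * n) * (n ^ (d - 2) * n ^ (d - 2))"
    using card_mono[of "{1..n} \<times> {1..n}" ?P] by (simp add: card_cartesian_product)
  also have "\<dots> = n ^ (1 + 1 + (d - 2) + (d - 2))" by (simp add: power_add)
  also have "1 + 1 + (d - 2) + (d - 2) = 2 * d - 2" using True by simp
  finally show ?thesis .
qed

text \<open>Both sides count the (s + t + 1)-subsets of {0..<n}; on the left they are sorted by the
  element \<open>k\<close> that has \<open>s\<close> chosen elements below and \<open>t\<close>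
  above it. The proof goes through Pascal's rule, which lowers \<open>t\<close>, so \<open>t\<close>
  varies in the induction.\<close>

lemma sum_choose_mult_choose:
  "(\<Sum>k<n. (k choose s) * ((n - 1 - k) choose t)) = n choose (s + t + 1)"
proof (induction n arbitrary: t)
  case (Suc n)
  have hockey: "(\<Sum>k<n. k choose s) = n choose Suc s" for n :: nat
    by (induction n) auto
  show ?case
  proof (cases t)
    case 0 then show ?thesis using hockey[of "Suc n"] by simp
  next
    case (Suc t')
    have "(\<Sum>k<n. (k choose s) * ((n - k) choose Suc t'))
      = (\<Sum>k<n. (k choose s) * ((n - 1 - k) choose t') + (k choose s) * ((n - 1 - k) choose Suc t'))"
    proof (intro sum.cong refl)
      fix k assume "k \<in> {..<n}"
      then have "n - k = Suc (n - 1 - k)" by auto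
      then show "(k choose s) * ((n - k) choose Suc t')
          = (k choose s) * ((n - 1 - k) choose t') + (k choose s) * ((n - 1 - k) choose Suc t')"
        by (simp add: distrib_left)
    qed
    then show ?thesis using Suc.IH[of t'] Suc.IH[of "Suc t'"] Suc by (simp add: sum.distrib)
  qed
qed simp

text \<open>The ratio is a falling factorial of \<open>m\<close> over m^a. For \<open>a\<close> at
  most \<open>m\<close> each of its \<open>a\<close> factors is at least 1 - a/m, and Bernoulli's
  inequality bounds the product below by 1 - a^2/m.\<close>

lemma choose_power_bounds:
  fixes m a :: nat
  assumes "m > 0"
  shows "fact a * real (m choose a) / real m ^ a \<le> 1"
    and "1 - (real a)\<^sup>2 / real m \<le> fact a * real (m choose a) / real m ^ a"
proof -
  have "fact a * real (m choose a) \<le> real m ^ a"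
    by (metis binomial_fact_pow mult.commute of_nat_fact of_nat_le_iff of_nat_mult of_nat_power)
  then show "fact a * real (m choose a) / real m ^ a \<le> 1" using assms by (simp add: divide_le_eq)
  show "1 - (real a)\<^sup>2 / real m \<le> fact a * real (m choose a) / real m ^ a"
  proof (cases "a \<le> m")
    \<comment> \<open>Now a^2 is at least \<open>m\<close>, so the lower bound is not
      positive.\<close>
    case False
    then have "real m \<le> (real a)\<^sup>2"
      using assms by (smt (verit) le_square nat_le_linear of_nat_le_iff of_nat_mult of_nat_mono power2_eq_square)
    then show ?thesis using assms by (smt (verit) divide_nonneg_nonneg fact_ge_zero le_divide_eq_1_pos mult_nonneg_nonneg of_nat_0_le_iff of_nat_0_less_iff zero_le_power)
  next
    case True
    have "1 - (real a)\<^sup>2 / real m = 1 + real a * (- real a / real m)" by (simp add: power2_eq_square)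
    also have "\<dots> \<le> (1 + (- real a / real m)) ^ a"
      using True assms by (intro Bernoulli_inequality) (auto simp: field_simps)
    also have "\<dots> = (real (m - a)) ^ a / real m ^ a"
      using True assms by (simp add: power_divide[symmetric] of_nat_diff diff_divide_distrib)
    also have "real (m - a) ^ a \<le> fact a * real (m choose a)"
    proof -
      have "real (m - a) ^ a = (\<Prod>i<a. real (m - a))" by simp
      also have "\<dots> \<le> (\<Prod>i<a. real (m - i))" by (intro prod_mono) auto
      also have "\<dots> = fact a * real (m choose a)"
        unfolding binomial_altdef_of_nat[OF True] using True
        by (simp add: fact_prod_rev prod_dividef of_nat_diff atLeast0LessThan)
      finally show ?thesis .
    qed
    then have "real (m - a) ^ a / real m ^ a \<le> fact a * real (m choose a) / real m ^ a"
      by (intro divide_right_mono) auto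
    finally show ?thesis .
  qed
qed


text \<open>As polynomials in \<open>m\<close> the two terms have the same leading coefficient, so
  they differ in lower orders only. The error is stated after multiplication by \<open>n\<close>
  because the exponent a + b - 1 would be truncated for a + b = 0, and with \<open>n\<close> instead
  of \<open>m\<close> to be uniform over \<open>m\<close> up to \<open>n\<close>.\<close>

lemma choose_mult_choose_approx:
  fixes n m a b :: nat
  assumes n: "n > 0" "m \<le> n"
  shows "\<bar>real (m choose a) * real (m choose b) - fact (a + b) / (fact a * fact b) * real (m choose (a + b))\<bar> * real n
           \<le> (real (a + b))\<^sup>2 * real n ^ (a + b)"
proof (cases "m = 0")
  case True
  then show ?thesis by (cases a; cases b) auto
next
  case False
  then have m: "m > 0" by simp
  define r where "r c = fact c * real (m choose c) / real m ^ c" for c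
  have r: "r c \<le> 1" "1 - (real c)\<^sup>2 / real m \<le> r c" "0 \<le> r c" for c
    using choose_power_bounds[OF m, of c] by (auto simp: r_def)
  have C: "real (m choose c) = real m ^ c * r c / fact c" for c
    using m by (simp add: r_def)
  have "1 - r a * r b = (1 - r a) + r a * (1 - r b)" by (simp add: algebra_simps)
  also have "\<dots> \<le> (1 - r a) + 1 * (1 - r b)"
    using r by (intro add_left_mono mult_right_mono) auto
  also have "\<dots> \<le> (real a)\<^sup>2 / real m + (real b)\<^sup>2 / real m" using r(2)[of a] r(2)[of b] by simp
  also have "\<dots> \<le> (real (a + b))\<^sup>2 / real m"
    by (simp add: add_divide_distrib[symmetric] divide_right_mono power2_sum)
  finally have "1 - r a * r b \<le> (real (a + b))\<^sup>2 / real m" .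
  moreover have "r a * r b \<le> 1" using r by (simp add: mult_le_one)
  ultimately have d: "\<bar>r a * r b - r (a + b)\<bar> \<le> (real (a + b))\<^sup>2 / real m"
    using r(1,2)[of "a + b"] by linarith
  have "real (m choose a) * real (m choose b) - fact (a + b) / (fact a * fact b) * real (m choose (a + b))
      = real m ^ (a + b) / (fact a * fact b) * (r a * r b - r (a + b))"
    unfolding C by (simp add: power_add field_simps)
  then have "\<bar>real (m choose a) * real (m choose b) - fact (a + b) / (fact a * fact b) * real (m choose (a + b))\<bar>
      = real m ^ (a + b) / (fact a * fact b) * \<bar>r a * r b - r (a + b)\<bar>"
    by (simp add: abs_mult)
  also have "\<dots> \<le> real m ^ (a + b) / 1 * ((real (a + b))\<^sup>2 / real m)"
    by (intro mult_mono d divide_left_mono mult_ge1_I) auto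
  finally have "\<bar>real (m choose a) * real (m choose b) - fact (a + b) / (fact a * fact b) * real (m choose (a + b))\<bar> * real n
     \<le> real m ^ (a + b) / 1 * ((real (a + b))\<^sup>2 / real m) * real n"
    by (rule mult_right_mono) simp
  also have "\<dots> \<le> (real (a + b))\<^sup>2 * real n ^ (a + b)"
  proof (cases "a + b")
    case (Suc s)
    have "real m ^ s * real n \<le> real n ^ s * real n" using n by (intro mult_right_mono power_mono) auto
    then have "(real (Suc s))\<^sup>2 * (real m ^ s * real n) \<le> (real (Suc s))\<^sup>2 * (real n ^ s * real n)"
      by (intro mult_left_mono) auto
    then show ?thesis unfolding Suc using m by (simp add: field_simps)
  qed simp
  finally show ?thesis .
qed

text \<open>By \<open>card_enum_eq\<close>, for \<open>i\<close> in {1..d} and \<open>k\<close> in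
  {1..n}, this is the number of \<open>d\<close>-subsets of {1..n} with \<open>i\<close>-th smallest
  element \<open>k\<close>: the weight with which X_k enters the \<open>i\<close>-th
  projection.\<close>

definition rank_count :: "nat \<Rightarrow> nat \<Rightarrow> nat \<Rightarrow> nat \<Rightarrow> nat" where
  "rank_count d n i k = ((k - 1) choose (i - 1)) * ((n - k) choose (d - i))"

lemma rank_count_le:
  assumes "i \<in> {1..d}" "k \<in> {1..n}" shows "real (rank_count d n i k) \<le> real n ^ (d - 1)"
proof -
  have "rank_count d n i k \<le> (k - 1) ^ (i - 1) * (n - k) ^ (d - i)"
    unfolding rank_count_def by (intro mult_mono binomial_le_power) auto
  also have "\<dots> \<le> n ^ (i - 1) * n ^ (d - i)"
    using assms by (intro mult_mono power_mono) auto
  also have "\<dots> = n ^ (d - 1)" using assms by (simp add: power_add[symmetric])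
  finally show ?thesis by (metis of_nat_le_iff of_nat_power)
qed

text \<open>Merge the two binomials in \<open>k\<close>, and the two in \<open>n - 1 - k\<close>,
  into one each with the same leading term; the resulting sum is exactly a binomial by
  \<open>sum_choose_mult_choose\<close>. Each of the \<open>n\<close> summands changes by one order
  less than its size, so the total error is one order below the main term.\<close>

lemma rank_count_sum_approx:
  fixes a b a' b' n :: nat
  assumes n: "n > 0"
  defines "c \<equiv> fact (a + b) / (fact a * fact b) :: real" and "c' \<equiv> fact (a' + b') / (fact a' * fact b') :: real"
  shows "\<bar>(\<Sum>k<n. real ((k choose a) * ((n - 1 - k) choose a')) * real ((k choose b) * ((n - 1 - k) choose b')))
          - c * c' * real (n choose (a + b + (a' + b') + 1))\<bar>
         \<le> ((real (a + b))\<^sup>2 + (real (a' + b'))\<^sup>2) * real n ^ (a + b + (a' + b'))"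
proof -
  have "c * c' * real (n choose (a + b + (a' + b') + 1))
      = (\<Sum>k<n. (c * real (k choose (a + b))) * (c' * real ((n - 1 - k) choose (a' + b'))))"
    unfolding sum_choose_mult_choose[symmetric] by (simp add: sum_distrib_left mult_ac)
  then have "\<bar>(\<Sum>k<n. real ((k choose a) * ((n - 1 - k) choose a')) * real ((k choose b) * ((n - 1 - k) choose b')))
          - c * c' * real (n choose (a + b + (a' + b') + 1))\<bar>
     = \<bar>\<Sum>k<n. real ((k choose a) * ((n - 1 - k) choose a')) * real ((k choose b) * ((n - 1 - k) choose b'))
          - (c * real (k choose (a + b))) * (c' * real ((n - 1 - k) choose (a' + b')))\<bar>"
    by (simp add: sum_subtractf)
  also have "\<dots> \<le> (\<Sum>k<n. ((real (a + b))\<^sup>2 + (real (a' + b'))\<^sup>2) * real n ^ (a + b + (a' + b')) / real n)"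
  proof (rule order.trans[OF sum_abs sum_mono])
    fix k assume k: "k \<in> {..<n}"
    define x where "x = real (k choose a) * real (k choose b)"
    define x' where "x' = c * real (k choose (a + b))"
    define y where "y = real ((n - 1 - k) choose a') * real ((n - 1 - k) choose b')"
    define y' where "y' = c' * real ((n - 1 - k) choose (a' + b'))"
    have dx: "\<bar>x - x'\<bar> * real n \<le> (real (a + b))\<^sup>2 * real n ^ (a + b)"
      unfolding x_def x'_def c_def using k n by (intro choose_mult_choose_approx) auto
    have dy: "\<bar>y - y'\<bar> * real n \<le> (real (a' + b'))\<^sup>2 * real n ^ (a' + b')"
      unfolding y_def y'_def c'_def using k n by (intro choose_mult_choose_approx) auto
    have pw: "real (m choose s) \<le> real n ^ s" if "m \<le> n" for m s
      by (metis binomial_le_power order_trans of_nat_le_iff of_nat_power power_mono that zero_le)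
    have y: "\<bar>y\<bar> \<le> real n ^ (a' + b')"
    proof -
      have "y \<le> real n ^ (a' + b')"
        unfolding y_def power_add using k by (intro mult_mono pw) auto
      then show ?thesis by (simp add: y_def)
    qed
    have x': "\<bar>x'\<bar> \<le> real n ^ (a + b)"
    proof -
      have "\<bar>x'\<bar> = (fact (a + b) * real (k choose (a + b))) / (fact a * fact b)"
        by (simp add: x'_def c_def abs_mult)
      also have "\<dots> \<le> (real k ^ (a + b)) / 1"
      proof (intro frac_le)
        show "fact (a + b) * real (k choose (a + b)) \<le> real k ^ (a + b)"
          by (metis binomial_fact_pow mult.commute of_nat_fact of_nat_le_iff of_nat_mult of_nat_power)
      qed (auto intro: mult_ge1_I)
      also have "\<dots> \<le> real n ^ (a + b)" using k by (auto intro: power_mono)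
      finally show ?thesis .
    qed
    have "\<bar>x * y - x' * y'\<bar> * real n = \<bar>(x - x') * y + x' * (y - y')\<bar> * real n" by (simp add: algebra_simps)
    also have "\<dots> \<le> (\<bar>x - x'\<bar> * \<bar>y\<bar> + \<bar>x'\<bar> * \<bar>y - y'\<bar>) * real n"
      by (intro mult_right_mono) (auto simp: abs_mult[symmetric])
    also have "\<dots> = (\<bar>x - x'\<bar> * real n) * \<bar>y\<bar> + \<bar>x'\<bar> * (\<bar>y - y'\<bar> * real n)" by (simp add: algebra_simps)
    also have "\<dots> \<le> ((real (a + b))\<^sup>2 * real n ^ (a + b)) * real n ^ (a' + b')
        + real n ^ (a + b) * ((real (a' + b'))\<^sup>2 * real n ^ (a' + b'))"
      by (intro add_mono mult_mono dx dy y x') auto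
    also have "\<dots> = ((real (a + b))\<^sup>2 + (real (a' + b'))\<^sup>2) * real n ^ (a + b + (a' + b'))"
      by (simp add: power_add algebra_simps)
    finally have "\<bar>x * y - x' * y'\<bar> \<le> ((real (a + b))\<^sup>2 + (real (a' + b'))\<^sup>2) * real n ^ (a + b + (a' + b')) / real n"
      using n by (simp add: field_simps)
    then show "\<bar>real ((k choose a) * ((n - 1 - k) choose a')) * real ((k choose b) * ((n - 1 - k) choose b'))
          - (c * real (k choose (a + b))) * (c' * real ((n - 1 - k) choose (a' + b')))\<bar>
       \<le> ((real (a + b))\<^sup>2 + (real (a' + b'))\<^sup>2) * real n ^ (a + b + (a' + b')) / real n"
      by (simp add: x_def x'_def y_def y'_def mult_ac)
  qed
  also have "\<dots> = ((real (a + b))\<^sup>2 + (real (a' + b'))\<^sup>2) * real n ^ (a + b + (a' + b'))" using n by simp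
  finally show ?thesis .
qed

lemma choose_over_power_tendsto:
  "(\<lambda>n. real (n choose a) / real n ^ a) \<longlonglongrightarrow> 1 / fact a"
proof -
  have "(\<lambda>n. fact a * real (n choose a) / real n ^ a) \<longlonglongrightarrow> 1"
  proof (rule tendsto_sandwich)
    show "\<forall>\<^sub>F n in sequentially. 1 - (real a)\<^sup>2 / real n \<le> fact a * real (n choose a) / real n ^ a"
      using eventually_gt_at_top[of 0] by eventually_elim (rule choose_power_bounds)
    show "\<forall>\<^sub>F n in sequentially. fact a * real (n choose a) / real n ^ a \<le> 1"
      using eventually_gt_at_top[of 0] by eventually_elim (rule choose_power_bounds)
    show "(\<lambda>n. 1 - (real a)\<^sup>2 / real n) \<longlonglongrightarrow> 1"
      using tendsto_diff[OF tendsto_const lim_const_over_n[of "(real a)\<^sup>2"], of 1] by simp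
  qed simp
  from tendsto_divide[OF this tendsto_const, of "fact a"] show ?thesis by simp
qed

text \<open>The origin of the coefficients in the limiting variance: merging binomials gives
  (i+j-2)! / ((i-1)! (j-1)!) and (2d-i-j)! / ((d-i)! (d-j)!), and the remaining factor 1 / (2d-1)!
  is the limit of C(n,2d-1) / n^(2d-1).\<close>

lemma rank_count_sum_tendsto:
  assumes i: "i \<in> {1..d}" and j: "j \<in> {1..d}"
  shows "(\<lambda>n. (\<Sum>k=1..n. real (rank_count d n i k) * real (rank_count d n j k)) / real n ^ (2 * d - 1))
     \<longlonglongrightarrow> fact (i + j - 2) * fact (2 * d - i - j) /
        (fact (i - 1) * fact (j - 1) * fact (d - i) * fact (d - j) * fact (2 * d - 1))"
proof -
  define a b a' b' where "a = i - 1" and "b = j - 1" and "a' = d - i" and "b' = d - j"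
  have e: "a + b = i + j - 2" "a' + b' = 2 * d - i - j" "a + b + (a' + b') = 2 * d - 2"
    "a + b + (a' + b') + 1 = 2 * d - 1"
    using i j by (auto simp: a_def b_def a'_def b'_def)
  define c where "c = (fact (a + b) / (fact a * fact b) :: real) * (fact (a' + b') / (fact a' * fact b'))"
  define K where "K = (real (a + b))\<^sup>2 + (real (a' + b'))\<^sup>2"
  define s where "s n = (\<Sum>k=1..n. real (rank_count d n i k) * real (rank_count d n j k))" for n
  have lim0: "(\<lambda>n. c * (real (n choose (2 * d - 1)) / real n ^ (2 * d - 1))) \<longlonglongrightarrow> c * (1 / fact (2 * d - 1))"
    by (intro tendsto_mult_left choose_over_power_tendsto)
  have "(\<lambda>n. s n / real n ^ (2 * d - 1) - c * (real (n choose (2 * d - 1)) / real n ^ (2 * d - 1))) \<longlonglongrightarrow> 0"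
  proof (rule Lim_null_comparison)
    show "(\<lambda>n. K / real n) \<longlonglongrightarrow> 0" by (rule lim_const_over_n)
    show "\<forall>\<^sub>F n in sequentially. norm (s n / real n ^ (2 * d - 1)
        - c * (real (n choose (2 * d - 1)) / real n ^ (2 * d - 1))) \<le> K / real n"
      using eventually_gt_at_top[of 0]
    proof eventually_elim
      case (elim n)
      \<comment> \<open>Counting \<open>k\<close> from 0 instead of 1 turns \<open>n - k\<close>
        into \<open>n - 1 - k\<close>.\<close>
      have "s n = (\<Sum>k<n. real ((k choose a) * ((n - 1 - k) choose a')) * real ((k choose b) * ((n - 1 - k) choose b')))"
        unfolding s_def rank_count_def a_def b_def a'_def b'_def
        by (rule sum.reindex_bij_witness[where i = Suc and j = "\<lambda>k. k - 1"]) auto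
      then have "\<bar>s n - c * real (n choose (2 * d - 1))\<bar> \<le> K * real n ^ (2 * d - 2)"
        using rank_count_sum_approx[OF elim, where a = a and b = b and a' = a' and b' = b', unfolded e(4), unfolded e(3)]
        by (simp add: c_def K_def)
      then have "\<bar>s n - c * real (n choose (2 * d - 1))\<bar> / real n ^ (2 * d - 1) \<le> K * real n ^ (2 * d - 2) / real n ^ (2 * d - 1)"
        by (rule divide_right_mono) simp
      moreover have "2 * d - 1 = Suc (2 * d - 2)" using i by auto
      then have "K * real n ^ (2 * d - 2) / real n ^ (2 * d - 1) = K / real n" using elim by simp
      moreover have "norm (s n / real n ^ (2 * d - 1) - c * (real (n choose (2 * d - 1)) / real n ^ (2 * d - 1)))
        = \<bar>s n - c * real (n choose (2 * d - 1))\<bar> / real n ^ (2 * d - 1)"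
        by (simp add: diff_divide_distrib[symmetric])
      ultimately show ?case by simp
    qed
  qed
  from tendsto_add[OF this lim0] show ?thesis
    unfolding c_def e(1,2) unfolding s_def a_def b_def a'_def b'_def by (simp add: mult_ac)
qed

section \<open>Samples from an i.i.d. sequence\<close>

text \<open>The common law is a parameter of its own so that it can be instantiated with the law of
  a generic copy such as \<open>Y\<close>.\<close>

locale iid_sequence = prob_space M for M :: "'a measure" +
  fixes S :: "'s measure" and X :: "nat \<Rightarrow> 'a \<Rightarrow> 's" and N :: "'s measure"
  assumes indep: "indep_vars (\<lambda>_. S) X {1..}"
    and law: "i \<ge> 1 \<Longrightarrow> distr M S (X i) = N"
begin

lemma X_measurable [measurable]: "i \<ge> 1 \<Longrightarrow> X i \<in> M \<rightarrow>\<^sub>M S"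
  using indep by (auto simp: indep_vars_def)

lemma sets_N [measurable_cong, simp]: "sets N = sets S"
  using law[of 1] by auto

lemma space_N [simp]: "space N = space S"
  by (rule sets_eq_imp_space_eq) simp

lemma prob_space_N: "prob_space N"
  using prob_space_distr[OF X_measurable[of 1]] law[of 1] by simp

sublocale N: prob_space N by (rule prob_space_N)

lemma sets_PiM_N [measurable_cong]: "sets (PiM J (\<lambda>_. N)) = sets (PiM J (\<lambda>_. S))"
  by (rule sets_PiM_cong) auto

lemma prob_space_PiM_N: "prob_space (PiM J (\<lambda>_::'i. N))"
  by (intro prob_space_PiM prob_space_N)

section \<open>Laws of finite samples\<close>

lemma tuple_measurable:
  assumes "s ` J \<subseteq> {1..}"
  shows "(\<lambda>\<omega>. \<lambda>j\<in>J. X (s j) \<omega>) \<in> M \<rightarrow>\<^sub>M PiM J (\<lambda>_. S)"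
  using assms by (intro measurable_restrict X_measurable) auto

text \<open>The whole sequence has an infinite product law, and selecting coordinates along an
  injection pushes it forward to a product again. Hence expectations do not depend on which distinct
  indices are sampled.\<close>

lemma distr_tuple:
  assumes "inj_on s J" "s ` J \<subseteq> {1..}"
  shows "distr M (PiM J (\<lambda>_. S)) (\<lambda>\<omega>. \<lambda>j\<in>J. X (s j) \<omega>) = PiM J (\<lambda>_. N)"
proof -
  have ne: "{1..} \<noteq> ({} :: nat set)" by auto
  have full: "distr M (PiM {1..} (\<lambda>_. S)) (\<lambda>\<omega>. \<lambda>i\<in>{1..}. X i \<omega>) = PiM {1..} (\<lambda>_. N)"
  proof -
    have "PiM {1..} (\<lambda>i. distr M S (X i)) = PiM {1..} (\<lambda>_. N)"
      by (rule PiM_cong) (auto intro: law[simplified])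
    then show ?thesis
      using indep_vars_iff_distr_eq_PiM'[OF ne, where M' = "\<lambda>_. S" and X = X] indep X_measurable by simp
  qed
  have "PiM J (\<lambda>_. N) = distr (PiM {1..} (\<lambda>_. N)) (PiM J (\<lambda>_. N)) (\<lambda>x. \<lambda>j\<in>J. x (s j))"
    using assms by (intro distr_PiM_reindex[symmetric] prob_space_N) auto
  also have "\<dots> = distr (PiM {1..} (\<lambda>_. N)) (PiM J (\<lambda>_. S)) (\<lambda>x. \<lambda>j\<in>J. x (s j))"
    by (intro distr_cong) (auto simp: sets_PiM_N)
  also have "\<dots> = distr M (PiM J (\<lambda>_. S)) ((\<lambda>x. \<lambda>j\<in>J. x (s j)) \<circ> (\<lambda>\<omega>. \<lambda>i\<in>{1..}. X i \<omega>))"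
    unfolding full[symmetric] using assms
    by (intro distr_distr) (auto intro!: measurable_restrict measurable_component_singleton)
  also have "(\<lambda>x. \<lambda>j\<in>J. x (s j)) \<circ> (\<lambda>\<omega>. \<lambda>i\<in>{1..}. X i \<omega>) = (\<lambda>\<omega>. \<lambda>j\<in>J. X (s j) \<omega>)"
    using assms by (auto simp: fun_eq_iff)
  finally show ?thesis ..
qed

lemma integrable_tuple_iff:
  fixes h :: "('i \<Rightarrow> 's) \<Rightarrow> real" and s :: "'i \<Rightarrow> nat"
  assumes "inj_on s J" "s ` J \<subseteq> {1..}" "h \<in> borel_measurable (PiM J (\<lambda>_. S))"
  shows "integrable M (\<lambda>\<omega>. h (\<lambda>j\<in>J. X (s j) \<omega>)) \<longleftrightarrow> integrable (PiM J (\<lambda>_. N)) h"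
  unfolding distr_tuple[OF assms(1,2), symmetric]
  by (rule integrable_distr_eq[OF tuple_measurable[OF assms(2)] assms(3), symmetric])

lemma expectation_tuple:
  fixes h :: "('i \<Rightarrow> 's) \<Rightarrow> real" and s :: "'i \<Rightarrow> nat"
  assumes "inj_on s J" "s ` J \<subseteq> {1..}" "h \<in> borel_measurable (PiM J (\<lambda>_. S))"
  shows "expectation (\<lambda>\<omega>. h (\<lambda>j\<in>J. X (s j) \<omega>)) = integral\<^sup>L (PiM J (\<lambda>_. N)) h"
  unfolding distr_tuple[OF assms(1,2), symmetric]
  by (rule integral_distr[OF tuple_measurable[OF assms(2)] assms(3), symmetric])

lemma integrable_X_iff:
  fixes g :: "'s \<Rightarrow> real"
  assumes "g \<in> borel_measurable S" "i \<ge> 1"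
  shows "integrable M (\<lambda>\<omega>. g (X i \<omega>)) \<longleftrightarrow> integrable N g"
  using integrable_distr_eq[OF X_measurable[OF assms(2)] assms(1)] law[OF assms(2)] by simp

lemma expectation_X:
  fixes g :: "'s \<Rightarrow> real"
  assumes "g \<in> borel_measurable S" "i \<ge> 1"
  shows "expectation (\<lambda>\<omega>. g (X i \<omega>)) = integral\<^sup>L N g"
  using integral_distr[OF X_measurable[OF assms(2)] assms(1)] law[OF assms(2)] by simp

text \<open>The arguments are read in increasing order of their indices, which matters for a kernel
  without symmetry.\<close>

definition sample :: "nat \<Rightarrow> nat set \<Rightarrow> 'a \<Rightarrow> nat \<Rightarrow> 's" where
  "sample d A \<omega> = (\<lambda>j\<in>{1..d}. X (enum A j) \<omega>)"

lemma sample_index: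
  assumes "A \<in> subsets_of_size n d"
  shows "inj_on (enum A) {1..d}" "enum A ` {1..d} \<subseteq> {1..}"
  using inj_on_enum[of A] enum_image[of A] subsets_of_sizeD[OF assms] by auto

lemma sample_measurable [measurable]:
  "A \<in> subsets_of_size n d \<Longrightarrow> sample d A \<in> M \<rightarrow>\<^sub>M PiM {1..d} (\<lambda>_. S)"
  unfolding sample_def using tuple_measurable[OF sample_index(2)] by simp

lemma sample_comp_measurable:
  "A \<in> subsets_of_size n d \<Longrightarrow> h \<in> borel_measurable (PiM {1..d} (\<lambda>_. S))
    \<Longrightarrow> (\<lambda>\<omega>. h (sample d A \<omega>) :: real) \<in> borel_measurable M"
  using measurable_compose[OF sample_measurable] .

lemma integrable_sample_iff:
  fixes h :: "(nat \<Rightarrow> 's) \<Rightarrow> real"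
  assumes "A \<in> subsets_of_size n d" "h \<in> borel_measurable (PiM {1..d} (\<lambda>_. S))"
  shows "integrable M (\<lambda>\<omega>. h (sample d A \<omega>)) \<longleftrightarrow> integrable (PiM {1..d} (\<lambda>_. N)) h"
  unfolding sample_def by (rule integrable_tuple_iff[OF sample_index[OF assms(1)] assms(2)])

lemma expectation_sample:
  fixes h :: "(nat \<Rightarrow> 's) \<Rightarrow> real"
  assumes "A \<in> subsets_of_size n d" "h \<in> borel_measurable (PiM {1..d} (\<lambda>_. S))"
  shows "expectation (\<lambda>\<omega>. h (sample d A \<omega>)) = integral\<^sup>L (PiM {1..d} (\<lambda>_. N)) h"
  unfolding sample_def by (rule expectation_tuple[OF sample_index[OF assms(1)] assms(2)])

lemma indep_vars_samples:
  fixes h :: "(nat \<Rightarrow> 's) \<Rightarrow> real"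
  assumes A: "\<And>b. b \<in> L \<Longrightarrow> A b \<in> subsets_of_size n d" and disj: "disjoint_family_on A L"
    and h: "h \<in> borel_measurable (PiM {1..d} (\<lambda>_. S))"
  shows "indep_vars (\<lambda>_. borel) (\<lambda>b \<omega>. h (sample d (A b) \<omega>)) L"
proof -
  have "indep_vars (\<lambda>b. PiM (A b) (\<lambda>_. S)) (\<lambda>b \<omega>. restrict (\<lambda>i. X i \<omega>) (A b)) L"
    by (rule indep_vars_restrict[OF indep _ disj]) (use subsets_of_sizeD(1)[OF A] in force)
  then have "indep_vars (\<lambda>_. borel) (\<lambda>b \<omega>. h (\<lambda>j\<in>{1..d}. restrict (\<lambda>i. X i \<omega>) (A b) (enum (A b) j))) L"
  proof (rule indep_vars_compose2)
    fix b assume b: "b \<in> L"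
    have "(\<lambda>x. \<lambda>j\<in>{1..d}. x (enum (A b) j)) \<in> PiM (A b) (\<lambda>_. S) \<rightarrow>\<^sub>M PiM {1..d} (\<lambda>_. S)"
      using enum_in subsets_of_sizeD[OF A[OF b]]
      by (intro measurable_restrict measurable_component_singleton) auto
    then show "(\<lambda>x. h (\<lambda>j\<in>{1..d}. x (enum (A b) j))) \<in> borel_measurable (PiM (A b) (\<lambda>_. S))"
      using h by (rule measurable_compose)
  qed
  moreover have "(\<lambda>j\<in>{1..d}. restrict (\<lambda>i. X i \<omega>) (A b) (enum (A b) j)) = sample d (A b) \<omega>" if "b \<in> L" for b \<omega>
    using enum_in subsets_of_sizeD[OF A[OF that]] by (auto simp: sample_def fun_eq_iff)
  ultimately show ?thesis by (simp cong: indep_vars_cong)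
qed

text \<open>
  Hoeffding's averaging trick: split \<open>{1..n}\<close> into \<open>m = n div d\<close> blocks of size \<open>d\<close>. Up to a factor,
  the sum over all \<open>d\<close>-subsets is the average over all permutations of \<open>{1..n}\<close> of the sums
  over the permuted blocks, and each of these is a sum of \<open>m\<close> independent variables.
\<close>

lemma moment_subset_sum_le:
  fixes h :: "(nat \<Rightarrow> 's) \<Rightarrow> real"
  assumes d: "d \<ge> 1" and h: "h \<in> borel_measurable (PiM {1..d} (\<lambda>_. S))" and q: "q \<ge> 2" and B: "B > 0"
    and int: "integrable (PiM {1..d} (\<lambda>_. N)) (\<lambda>x. \<bar>h x\<bar> powr q)"
    and bound: "(\<integral>x. \<bar>h x\<bar> powr q \<partial>PiM {1..d} (\<lambda>_. N)) \<le> B powr q"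
    and mean: "integral\<^sup>L (PiM {1..d} (\<lambda>_. N)) h = 0"
  shows "expectation (\<lambda>\<omega>. \<bar>\<Sum>A\<in>subsets_of_size n d. h (sample d A \<omega>)\<bar> powr q)
      \<le> moment_const q * (2 * real d) powr (q / 2) * (real n powr (real d - 1 / 2)) powr q * B powr q"
proof (cases "d \<le> n")
  case False
  then have "subsets_of_size n d = {}" using card_subsets_of_size[of n d] by (simp add: binomial_eq_0)
  then show ?thesis by (simp add: moment_const_def)
next
  case True
  define m where "m = n div d"
  have m: "m > 0" using True d by (simp add: m_def div_greater_zero_iff)
  have md: "m * d \<le> n" by (simp add: m_def)
  define block where "block b = {b * d + 1..(b + 1) * d}" for b
  have block_le: "(b + 1) * d \<le> n" if "b < m" for b
    using mult_right_mono[of "b + 1" m d] that md by linarith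
  have block: "block b \<in> subsets_of_size n d" if "b < m" for b
    using block_le[OF that] by (auto simp: block_def subsets_of_size_def)
  have disj: "disjoint_family_on block {..<m}"
  proof -
    have "block b \<inter> block c = {}" if "b < c" for b c
    proof -
      have "(b + 1) * d \<le> c * d" using that by (intro mult_right_mono) auto
      then show ?thesis unfolding block_def by auto
    qed
    then show ?thesis unfolding disjoint_family_on_def by (metis Int_commute linorder_neqE_nat)
  qed
  define P where "P = {\<pi>. \<pi> permutes {1..n}}"
  have P: "finite P" "P \<noteq> {}" "card P = fact n"
    using finite_permutations[of "{1..n}"] card_permutations[of "{1..n}" n]
    unfolding P_def by (auto intro: exI[of _ id] permutes_id)
  have pblock: "\<pi> ` block b \<in> subsets_of_size n d" if "\<pi> \<in> P" "b < m" for \<pi> b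
  proof -
    have \<pi>: "\<pi> permutes {1..n}" using that by (simp add: P_def)
    have "\<pi> ` block b \<subseteq> \<pi> ` {1..n}" using block[OF that(2)] by (intro image_mono) (auto simp: subsets_of_size_def)
    then show ?thesis using permutes_image[OF \<pi>] permutes_inj_on[OF \<pi>] block[OF that(2)]
      by (auto simp: subsets_of_size_def card_image)
  qed
  have pdisj: "disjoint_family_on (\<lambda>b. \<pi> ` block b) {..<m}" if "\<pi> \<in> P" for \<pi>
  proof -
    have "inj \<pi>" using that by (auto simp: P_def dest: permutes_inj)
    then show ?thesis using disj unfolding disjoint_family_on_def by (metis image_Int image_empty)
  qed
  define U where "U \<omega> = (\<Sum>A\<in>subsets_of_size n d. h (sample d A \<omega>))" for \<omega>
  \<comment> \<open>The permuted block is used as a set and is sorted again by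
    \<open>sample\<close>, so the permutations average over sets and not over orderings of the
    arguments.\<close>
  define W where "W \<pi> \<omega> = (\<Sum>b<m. h (sample d (\<pi> ` block b) \<omega>))" for \<pi> \<omega>
  \<comment> \<open>The permutation average of one block term is \<open>U\<close> divided by C(n,d),
    and \<open>W\<close> adds up \<open>m\<close> such terms.\<close>
  define c where "c = real (n choose d) / real m"
  have U_eq: "U \<omega> = c * ((\<Sum>\<pi>\<in>P. W \<pi> \<omega>) / real (card P))" for \<omega>
  proof -
    have "(\<Sum>b<m. fact n * U \<omega>) = (\<Sum>b<m. real (n choose d) * (\<Sum>\<pi>\<in>P. h (sample d (\<pi> ` block b) \<omega>)))"
      unfolding U_def P_def using sum_permutes_image[OF block, of _ "\<lambda>A. h (sample d A \<omega>)"]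
      by (intro sum.cong) auto
    also have "\<dots> = real (n choose d) * (\<Sum>\<pi>\<in>P. W \<pi> \<omega>)"
      unfolding W_def sum_distrib_left[symmetric] by (subst sum.swap) simp
    finally show ?thesis using m P by (simp add: c_def field_simps)
  qed
  have hq: "(\<lambda>x. \<bar>h x\<bar> powr q) \<in> borel_measurable (PiM {1..d} (\<lambda>_. S))" using h by measurable
  have Wint: "integrable M (\<lambda>\<omega>. \<bar>W \<pi> \<omega>\<bar> powr q)" if "\<pi> \<in> P" for \<pi>
    unfolding W_def using pblock[OF that] q integrable_sample_iff[OF _ hq] int sample_comp_measurable[OF _ h]
    by (intro integrable_powr_sum) auto
  have WE: "expectation (\<lambda>\<omega>. \<bar>W \<pi> \<omega>\<bar> powr q) \<le> moment_const q * (real m powr (q / 2) * B powr q)"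
    if "\<pi> \<in> P" for \<pi>
  proof -
    have "expectation (\<lambda>\<omega>. \<bar>W \<pi> \<omega>\<bar> powr q) \<le> moment_const q * (real (card {..<m}) powr (q / 2) * B powr q)"
      unfolding W_def using pblock[OF that] q B int bound mean
      by (intro moment_indep_sum_le indep_vars_samples[OF _ pdisj[OF that] h])
        (auto simp: integrable_sample_iff[OF pblock[OF that] hq] expectation_sample[OF pblock[OF that] hq]
          expectation_sample[OF pblock[OF that] h])
    then show ?thesis by simp
  qed
  have c0: "c \<ge> 0" by (simp add: c_def)
  \<comment> \<open>The left-hand side is C(n,d)^q m^(-q/2). Here C(n,d) is at most n^d, and
    rounding in \<open>n div d\<close> costs at most a factor 2, that is, 1/m is at most 2d/n; hence
    the constant \<open>2 * real d\<close>.\<close>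
  have cle: "c powr q * real m powr (q / 2) \<le> (2 * real d) powr (q / 2) * (real n powr (real d - 1 / 2)) powr q"
  proof -
    have n: "real n > 0" using True d by auto
    have "n < Suc m * d" unfolding m_def using d dividend_less_div_times[of d n] by (simp add: mult_ac)
    also have "\<dots> \<le> (2 * m) * d" using m by (intro mult_right_mono) auto
    finally have "real n \<le> 2 * real d * real m"
      by (metis less_imp_le mult.commute mult.left_commute of_nat_le_iff of_nat_mult of_nat_numeral)
    then have nm: "1 / real m \<le> 2 * real d / real n" using n m by (simp add: field_simps)
    have "c powr q * real m powr (q / 2) = real (n choose d) powr q * (1 / real m) powr (q / 2)"
    proof -
      have "real m powr q = real m powr (q/2) * real m powr (q/2)" by (simp add: powr_add[symmetric])
      then show ?thesis using m by (simp add: c_def powr_divide)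
    qed
    also have "\<dots> \<le> (real n powr d) powr q * (2 * real d / real n) powr (q / 2)"
    proof (intro mult_mono powr_mono2)
      show "real (n choose d) \<le> real n powr real d"
        using n by (simp add: powr_realpow) (metis binomial_le_power of_nat_le_iff of_nat_power)
    qed (use nm q in auto)
    also have "\<dots> = (2 * real d) powr (q / 2) * ((real n powr d) powr q / real n powr (q / 2))"
      by (simp add: powr_divide)
    also have "(real n powr d) powr q / real n powr (q / 2) = (real n powr (real d - 1 / 2)) powr q"
      by (simp add: powr_powr powr_diff[symmetric] algebra_simps)
    finally show ?thesis .
  qed
  have "expectation (\<lambda>\<omega>. \<bar>U \<omega>\<bar> powr q) \<le> expectation (\<lambda>\<omega>. c powr q * ((\<Sum>\<pi>\<in>P. \<bar>W \<pi> \<omega>\<bar> powr q) / real (card P)))"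
  proof (rule integral_mono)
    show "integrable M (\<lambda>\<omega>. \<bar>U \<omega>\<bar> powr q)"
      unfolding U_def using q integrable_sample_iff[OF _ hq] int sample_comp_measurable[OF _ h]
      by (intro integrable_powr_sum) auto
    show "integrable M (\<lambda>\<omega>. c powr q * ((\<Sum>\<pi>\<in>P. \<bar>W \<pi> \<omega>\<bar> powr q) / real (card P)))"
      using Wint by (intro integrable_mult_right integrable_divide integrable_sum) auto
    show "\<bar>U \<omega>\<bar> powr q \<le> c powr q * ((\<Sum>\<pi>\<in>P. \<bar>W \<pi> \<omega>\<bar> powr q) / real (card P))" for \<omega>
      unfolding U_eq abs_mult powr_mult abs_of_nonneg[OF c0]
      by (intro mult_left_mono powr_average_le P) (use q in auto)
  qed
  also have "\<dots> = c powr q * ((\<Sum>\<pi>\<in>P. expectation (\<lambda>\<omega>. \<bar>W \<pi> \<omega>\<bar> powr q)) / real (card P))"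
    using Wint by simp
  also have "\<dots> \<le> c powr q * ((\<Sum>\<pi>\<in>P. moment_const q * (real m powr (q / 2) * B powr q)) / real (card P))"
    using WE by (intro mult_left_mono divide_right_mono sum_mono) auto
  also have "\<dots> = (c powr q * real m powr (q / 2)) * (moment_const q * B powr q)"
    using P by simp
  also have "\<dots> \<le> ((2 * real d) powr (q / 2) * (real n powr (real d - 1 / 2)) powr q) * (moment_const q * B powr q)"
    by (intro mult_right_mono cle) (simp add: moment_const_def)
  finally show ?thesis unfolding U_def by (simp add: mult_ac)
qed

end

section \<open>Conditional means and orthogonality\<close>

lemma (in prob_space) square_expectation_le:
  fixes Z :: "'a \<Rightarrow> real"
  assumes "Z \<in> borel_measurable M" "integrable M (\<lambda>\<omega>. (Z \<omega>)\<^sup>2)"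
  shows "(expectation Z)\<^sup>2 \<le> expectation (\<lambda>\<omega>. (Z \<omega>)\<^sup>2)"
proof -
  have "integrable M Z" by (rule square_integrable_imp_integrable[OF assms])
  from variance_eq[OF this assms(2)] variance_positive[of Z] show ?thesis by simp
qed

lemma abs_mult_le_squares: "\<bar>a * b\<bar> \<le> (a\<^sup>2 + b\<^sup>2) / 2" for a b :: real
  using sum_squares_bound[of "\<bar>a\<bar>" "\<bar>b\<bar>"] by (simp add: abs_mult)

lemma integrable_mult_square:
  fixes u v :: "'a \<Rightarrow> real"
  assumes "u \<in> borel_measurable M" "v \<in> borel_measurable M"
    and "integrable M (\<lambda>\<omega>. (u \<omega>)\<^sup>2)" "integrable M (\<lambda>\<omega>. (v \<omega>)\<^sup>2)"
  shows "integrable M (\<lambda>\<omega>. u \<omega> * v \<omega>)"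
  by (rule Bochner_Integration.integrable_bound[where f = "\<lambda>\<omega>. ((u \<omega>)\<^sup>2 + (v \<omega>)\<^sup>2) / 2"])
    (use assms abs_mult_le_squares in auto)

lemma integrable_square_add:
  fixes u v :: "'a \<Rightarrow> real"
  assumes "u \<in> borel_measurable M" "v \<in> borel_measurable M"
    and "integrable M (\<lambda>\<omega>. (u \<omega>)\<^sup>2)" "integrable M (\<lambda>\<omega>. (v \<omega>)\<^sup>2)"
  shows "integrable M (\<lambda>\<omega>. (u \<omega> + v \<omega>)\<^sup>2)"
  using assms integrable_mult_square[OF assms]
  by (simp add: power2_sum mult.assoc)

lemma integrable_square_sum:
  fixes u :: "'i \<Rightarrow> 'a \<Rightarrow> real"
  assumes "finite I" "\<And>i. i \<in> I \<Longrightarrow> u i \<in> borel_measurable M"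
    and "\<And>i. i \<in> I \<Longrightarrow> integrable M (\<lambda>\<omega>. (u i \<omega>)\<^sup>2)"
  shows "integrable M (\<lambda>\<omega>. (\<Sum>i\<in>I. u i \<omega>)\<^sup>2)"
  using assms
proof (induction I)
  case (insert i I)
  then show ?case by (auto intro!: integrable_square_add)
qed simp

context iid_sequence
begin

section \<open>Conditional means given one argument\<close>

lemma rest_index: "inj_on (\<lambda>j. j) ({1..d} - {i})" "(\<lambda>j. j) ` ({1..d} - {i}) \<subseteq> {1..}" for d i :: nat
  by auto

lemma initial_index: "inj_on (\<lambda>j. j) {1..d}" "(\<lambda>j. j) ` {1..d} \<subseteq> {1..}" for d :: nat
  by auto

lemmas rest_measurable = tuple_measurable[OF rest_index(2)]

lemma section_arg_measurable:
  assumes "i \<in> {1..d}"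
  shows "(\<lambda>(x, y). \<lambda>j\<in>{1..d}. if j = i then x else y j)
     \<in> S \<Otimes>\<^sub>M PiM ({1..d} - {i}) (\<lambda>_. S) \<rightarrow>\<^sub>M PiM {1..d} (\<lambda>_. S)"
  unfolding case_prod_beta
proof (rule measurable_restrict)
  fix j assume j: "j \<in> {1..d}"
  show "(\<lambda>p. if j = i then fst p else snd p j) \<in> S \<Otimes>\<^sub>M PiM ({1..d} - {i}) (\<lambda>_. S) \<rightarrow>\<^sub>M S"
  proof (cases "j = i")
    case False
    then have "(\<lambda>p. snd p j) \<in> S \<Otimes>\<^sub>M PiM ({1..d} - {i}) (\<lambda>_. S) \<rightarrow>\<^sub>M S"
      using j by (intro measurable_compose[OF measurable_snd measurable_component_singleton]) auto
    then show ?thesis using False by simp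
  qed simp
qed

lemma section_fun_measurable:
  fixes h :: "(nat \<Rightarrow> 's) \<Rightarrow> real"
  assumes "i \<in> {1..d}" "h \<in> borel_measurable (PiM {1..d} (\<lambda>_. S))"
  shows "(\<lambda>(x, y). h (\<lambda>j\<in>{1..d}. if j = i then x else y j))
     \<in> borel_measurable (S \<Otimes>\<^sub>M PiM ({1..d} - {i}) (\<lambda>_. S))"
  using measurable_compose[OF section_arg_measurable[OF assms(1)] assms(2)] by (simp add: case_prod_beta)

lemma section_fun_measurable':
  fixes h :: "(nat \<Rightarrow> 's) \<Rightarrow> real"
  assumes "i \<in> {1..d}" "h \<in> borel_measurable (PiM {1..d} (\<lambda>_. S))" "x \<in> space S"
  shows "(\<lambda>y. h (\<lambda>j\<in>{1..d}. if j = i then x else y j)) \<in> borel_measurable (PiM ({1..d} - {i}) (\<lambda>_. S))"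
  using measurable_compose[OF measurable_Pair1'[OF assms(3)] section_fun_measurable[OF assms(1,2)]] by simp

text \<open>The index map \<open>s\<close> is left free: the conditional mean of \<open>h\<close>
  over any sample of distinct indices is then one and the same integral.\<close>

lemma section_eq:
  fixes h :: "(nat \<Rightarrow> 's) \<Rightarrow> real" and s :: "nat \<Rightarrow> nat"
  assumes i: "i \<in> {1..d}" and h: "h \<in> borel_measurable (PiM {1..d} (\<lambda>_. S))" and x: "x \<in> space S"
    and s: "inj_on s ({1..d} - {i})" "s ` ({1..d} - {i}) \<subseteq> {1..}"
  shows "integrable M (\<lambda>\<omega>. h (\<lambda>j\<in>{1..d}. if j = i then x else X (s j) \<omega>))
      \<longleftrightarrow> integrable (PiM ({1..d} - {i}) (\<lambda>_. N)) (\<lambda>y. h (\<lambda>j\<in>{1..d}. if j = i then x else y j))"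
    and "expectation (\<lambda>\<omega>. h (\<lambda>j\<in>{1..d}. if j = i then x else X (s j) \<omega>))
      = (\<integral>y. h (\<lambda>j\<in>{1..d}. if j = i then x else y j) \<partial>PiM ({1..d} - {i}) (\<lambda>_. N))"
proof -
  have *: "(\<lambda>j\<in>{1..d}. if j = i then x else (\<lambda>j\<in>{1..d} - {i}. X (s j) \<omega>) j)
      = (\<lambda>j\<in>{1..d}. if j = i then x else X (s j) \<omega>)" for \<omega>
    by auto
  show "integrable M (\<lambda>\<omega>. h (\<lambda>j\<in>{1..d}. if j = i then x else X (s j) \<omega>))
      \<longleftrightarrow> integrable (PiM ({1..d} - {i}) (\<lambda>_. N)) (\<lambda>y. h (\<lambda>j\<in>{1..d}. if j = i then x else y j))"
    using integrable_tuple_iff[OF s section_fun_measurable'[OF i h x]] unfolding * .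
  show "expectation (\<lambda>\<omega>. h (\<lambda>j\<in>{1..d}. if j = i then x else X (s j) \<omega>))
      = (\<integral>y. h (\<lambda>j\<in>{1..d}. if j = i then x else y j) \<partial>PiM ({1..d} - {i}) (\<lambda>_. N))"
    using expectation_tuple[OF s section_fun_measurable'[OF i h x]] unfolding * .
qed

lemma distr_coordinate_rest:
  assumes i: "i \<in> {1..d}"
  shows "distr M (S \<Otimes>\<^sub>M PiM ({1..d} - {i}) (\<lambda>_. S)) (\<lambda>\<omega>. (X i \<omega>, \<lambda>j\<in>{1..d} - {i}. X j \<omega>))
           = N \<Otimes>\<^sub>M PiM ({1..d} - {i}) (\<lambda>_. N)"
proof -
  let ?A = "PiM {i} (\<lambda>_. S)" and ?B = "PiM ({1..d} - {i}) (\<lambda>_. S)"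
  let ?a = "\<lambda>\<omega>. \<lambda>j\<in>{i}. X j \<omega>" and ?b = "\<lambda>\<omega>. \<lambda>j\<in>{1..d} - {i}. X j \<omega>"
  have "indep_var ?A ?a ?B ?b"
    by (rule indep_var_restrict[OF indep]) (use i in auto)
  then have mA: "?a \<in> M \<rightarrow>\<^sub>M ?A" and mB: "?b \<in> M \<rightarrow>\<^sub>M ?B"
    and joint: "distr M ?A ?a \<Otimes>\<^sub>M distr M ?B ?b = distr M (?A \<Otimes>\<^sub>M ?B) (\<lambda>\<omega>. (?a \<omega>, ?b \<omega>))"
    unfolding indep_var_distribution_eq by auto
  interpret B: prob_space "distr (distr M ?B ?b) ?B (\<lambda>y. y)"
    by (intro prob_space.prob_space_distr prob_space_distr mB) simp
  have 1: "distr (distr M ?A ?a) S (\<lambda>g. g i) = N"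
    using mA i law[of i] by (subst distr_distr) (auto simp: comp_def)
  have 2: "distr (distr M ?B ?b) ?B (\<lambda>y. y) = PiM ({1..d} - {i}) (\<lambda>_. N)"
    using distr_tuple[OF rest_index] mB by (subst distr_distr) (auto simp: comp_def)
  have "(\<lambda>g. g i) \<in> distr M ?A ?a \<rightarrow>\<^sub>M S" "(\<lambda>y. y) \<in> distr M ?B ?b \<rightarrow>\<^sub>M ?B"
    using measurable_component_singleton[of i "{i}" "\<lambda>_. S"] by simp_all
  from pair_measure_distr[OF this B.sigma_finite_measure_axioms]
  have "N \<Otimes>\<^sub>M PiM ({1..d} - {i}) (\<lambda>_. N)
     = distr (distr M ?A ?a \<Otimes>\<^sub>M distr M ?B ?b) (S \<Otimes>\<^sub>M ?B) (\<lambda>(x, y). (x i, y))"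
    unfolding 1 2 .
  also have "\<dots> = distr M (S \<Otimes>\<^sub>M ?B) (\<lambda>\<omega>. (X i \<omega>, ?b \<omega>))"
    unfolding joint using mA mB by (subst distr_distr) (auto simp: comp_def)
  finally show ?thesis ..
qed

text \<open>Regards the arguments as a pair, the \<open>i\<close>-th one and the others, to which
  Fubini's theorem applies.\<close>

lemma integrable_pair_iff:
  fixes h :: "(nat \<Rightarrow> 's) \<Rightarrow> real"
  assumes i: "i \<in> {1..d}" and h: "h \<in> borel_measurable (PiM {1..d} (\<lambda>_. S))"
  shows "integrable (N \<Otimes>\<^sub>M PiM ({1..d} - {i}) (\<lambda>_. N)) (\<lambda>(x, y). h (\<lambda>j\<in>{1..d}. if j = i then x else y j))
      \<longleftrightarrow> integrable (PiM {1..d} (\<lambda>_. N)) h"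
    and "(\<integral>p. (case p of (x, y) \<Rightarrow> h (\<lambda>j\<in>{1..d}. if j = i then x else y j)) \<partial>(N \<Otimes>\<^sub>M PiM ({1..d} - {i}) (\<lambda>_. N)))
      = integral\<^sup>L (PiM {1..d} (\<lambda>_. N)) h"
proof -
  have m: "(\<lambda>\<omega>. (X i \<omega>, \<lambda>j\<in>{1..d} - {i}. X j \<omega>)) \<in> M \<rightarrow>\<^sub>M S \<Otimes>\<^sub>M PiM ({1..d} - {i}) (\<lambda>_. S)"
    using i by (intro measurable_Pair rest_measurable X_measurable) auto
  have *: "h (\<lambda>j\<in>{1..d}. if j = i then X i \<omega> else (\<lambda>j\<in>{1..d} - {i}. X j \<omega>) j) = h (\<lambda>j\<in>{1..d}. X j \<omega>)" for \<omega>
    by (rule arg_cong[where f = h]) auto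
  show "integrable (N \<Otimes>\<^sub>M PiM ({1..d} - {i}) (\<lambda>_. N)) (\<lambda>(x, y). h (\<lambda>j\<in>{1..d}. if j = i then x else y j))
      \<longleftrightarrow> integrable (PiM {1..d} (\<lambda>_. N)) h"
    using integrable_distr_eq[OF m section_fun_measurable[OF i h]] integrable_tuple_iff[OF initial_index h]
    unfolding distr_coordinate_rest[OF i] by (simp only: * prod.case)
  show "(\<integral>p. (case p of (x, y) \<Rightarrow> h (\<lambda>j\<in>{1..d}. if j = i then x else y j)) \<partial>(N \<Otimes>\<^sub>M PiM ({1..d} - {i}) (\<lambda>_. N)))
      = integral\<^sup>L (PiM {1..d} (\<lambda>_. N)) h"
    using integral_distr[OF m section_fun_measurable[OF i h]] expectation_tuple[OF initial_index h]
    unfolding distr_coordinate_rest[OF i] by (simp only: * prod.case)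
qed

text \<open>The conditional mean of the kernel given that its \<open>i\<close>-th argument is
  \<open>x\<close>; \<open>U_proj\<close> is its centred version.\<close>

definition section_mean :: "nat \<Rightarrow> ((nat \<Rightarrow> 's) \<Rightarrow> real) \<Rightarrow> nat \<Rightarrow> 's \<Rightarrow> real" where
  "section_mean d h i x = expectation (\<lambda>\<omega>. h (\<lambda>j\<in>{1..d}. if j = i then x else X j \<omega>))"

lemma section_mean_eq:
  assumes "i \<in> {1..d}" "h \<in> borel_measurable (PiM {1..d} (\<lambda>_. S))" "x \<in> space S"
  shows "section_mean d h i x = (\<integral>y. h (\<lambda>j\<in>{1..d}. if j = i then x else y j) \<partial>PiM ({1..d} - {i}) (\<lambda>_. N))"
  unfolding section_mean_def by (rule section_eq(2)[OF assms rest_index])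

lemma section_mean_measurable:
  assumes i: "i \<in> {1..d}" and h: "h \<in> borel_measurable (PiM {1..d} (\<lambda>_. S))"
  shows "section_mean d h i \<in> borel_measurable S"
proof -
  have "(\<lambda>p. (fst p, \<lambda>j\<in>{1..d} - {i}. X j (snd p))) \<in> S \<Otimes>\<^sub>M M \<rightarrow>\<^sub>M S \<Otimes>\<^sub>M PiM ({1..d} - {i}) (\<lambda>_. S)"
    by (intro measurable_Pair measurable_fst measurable_compose[OF measurable_snd rest_measurable])
  from measurable_compose[OF this section_fun_measurable[OF i h]]
  have "(\<lambda>p. h (\<lambda>j\<in>{1..d}. if j = i then fst p else (\<lambda>j\<in>{1..d} - {i}. X j (snd p)) j)) \<in> borel_measurable (S \<Otimes>\<^sub>M M)"
    by (simp only: case_prod_beta fst_conv snd_conv)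
  also have "(\<lambda>p. h (\<lambda>j\<in>{1..d}. if j = i then fst p else (\<lambda>j\<in>{1..d} - {i}. X j (snd p)) j))
      = (\<lambda>(x, \<omega>). h (\<lambda>j\<in>{1..d}. if j = i then x else X j \<omega>))"
    by (auto simp: fun_eq_iff intro!: arg_cong[where f = h])
  finally show ?thesis
    unfolding section_mean_def by (rule borel_measurable_lebesgue_integral)
qed

lemma
  fixes h :: "(nat \<Rightarrow> 's) \<Rightarrow> real"
  assumes i: "i \<in> {1..d}" and h: "h \<in> borel_measurable (PiM {1..d} (\<lambda>_. S))"
    and int: "integrable (PiM {1..d} (\<lambda>_. N)) h"
  shows AE_section_integrable: "AE x in N. integrable M (\<lambda>\<omega>. h (\<lambda>j\<in>{1..d}. if j = i then x else X j \<omega>))"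
    and section_mean_integrable: "integrable N (section_mean d h i)"
    and integral_section_mean: "integral\<^sup>L N (section_mean d h i) = integral\<^sup>L (PiM {1..d} (\<lambda>_. N)) h"
proof -
  let ?Q = "PiM ({1..d} - {i}) (\<lambda>_. N)"
  interpret Q: prob_space ?Q by (rule prob_space_PiM_N)
  interpret NQ: pair_sigma_finite N ?Q by standard
  have int2: "integrable (N \<Otimes>\<^sub>M ?Q) (\<lambda>(x, y). h (\<lambda>j\<in>{1..d}. if j = i then x else y j))"
    using integrable_pair_iff(1)[OF i h] int by simp
  show "AE x in N. integrable M (\<lambda>\<omega>. h (\<lambda>j\<in>{1..d}. if j = i then x else X j \<omega>))"
    using NQ.AE_integrable_fst'[OF int2] AE_space
    by eventually_elim (use section_eq(1)[OF i h _ rest_index] in simp)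
  have eq: "x \<in> space N \<Longrightarrow> section_mean d h i x
      = (\<integral>y. (case (x, y) of (x, y) \<Rightarrow> h (\<lambda>j\<in>{1..d}. if j = i then x else y j)) \<partial>?Q)" for x
    using section_mean_eq[OF i h] by simp
  show "integrable N (section_mean d h i)"
    using NQ.integrable_fst'[OF int2] by (subst Bochner_Integration.integrable_cong[OF refl eq])
  show "integral\<^sup>L N (section_mean d h i) = integral\<^sup>L (PiM {1..d} (\<lambda>_. N)) h"
    using NQ.integral_fst'[OF int2] integrable_pair_iff(2)[OF i h]
    by (subst Bochner_Integration.integral_cong[OF refl eq]) auto
qed

text \<open>Conditional Jensen: for almost every \<open>x\<close> the squared section mean is at
  most the section mean of the square, and the latter is integrable by Fubini's theorem.\<close>

lemma section_mean_square_integrable: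
  fixes h :: "(nat \<Rightarrow> 's) \<Rightarrow> real"
  assumes i: "i \<in> {1..d}" and h: "h \<in> borel_measurable (PiM {1..d} (\<lambda>_. S))"
    and int: "integrable (PiM {1..d} (\<lambda>_. N)) (\<lambda>z. (h z)\<^sup>2)"
  shows "integrable N (\<lambda>x. (section_mean d h i x)\<^sup>2)"
proof -
  have h2: "(\<lambda>z. (h z)\<^sup>2) \<in> borel_measurable (PiM {1..d} (\<lambda>_. S))" using h by measurable
  show ?thesis
  proof (rule Bochner_Integration.integrable_bound[OF section_mean_integrable[OF i h2 int]])
    show "(\<lambda>x. (section_mean d h i x)\<^sup>2) \<in> borel_measurable N"
      using section_mean_measurable[OF i h] by measurable
    show "AE x in N. norm ((section_mean d h i x)\<^sup>2) \<le> norm (section_mean d (\<lambda>z. (h z)\<^sup>2) i x)"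
      using AE_section_integrable[OF i h2 int] AE_space
    proof eventually_elim
      case (elim x)
      have "(\<lambda>\<omega>. \<lambda>j\<in>{1..d}. if j = i then x else X j \<omega>) \<in> M \<rightarrow>\<^sub>M PiM {1..d} (\<lambda>_. S)"
      proof (rule measurable_restrict)
        show "(\<lambda>\<omega>. if j = i then x else X j \<omega>) \<in> M \<rightarrow>\<^sub>M S" if "j \<in> {1..d}" for j
          using that elim by (cases "j = i") auto
      qed
      then have "(\<lambda>\<omega>. h (\<lambda>j\<in>{1..d}. if j = i then x else X j \<omega>)) \<in> borel_measurable M"
        using h by (rule measurable_compose)
      from square_expectation_le[OF this elim(1)] show ?case
        unfolding section_mean_def by (simp add: order_trans[OF _ abs_ge_self])
    qed
  qed
qed

text \<open>Pick \<open>k\<close> in \<open>B\<close> such that \<open>A\<close> and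
  \<open>B\<close> share no other point, and condition on the X_j with \<open>j\<close> in
  \<open>A\<close> or \<open>j = k\<close>. The first factor is then fixed, while the other
  arguments of the second are independent of the condition, so its conditional mean is the section
  mean at X_k, which vanishes almost surely.\<close>

lemma expectation_mult_samples_eq_0:
  fixes h :: "(nat \<Rightarrow> 's) \<Rightarrow> real"
  assumes d: "d \<ge> 1" and h: "h \<in> borel_measurable (PiM {1..d} (\<lambda>_. S))"
    and int: "integrable (PiM {1..d} (\<lambda>_. N)) (\<lambda>z. (h z)\<^sup>2)"
    and sec: "\<And>i. i \<in> {1..d} \<Longrightarrow> AE x in N. section_mean d h i x = 0"
    and A: "A \<in> subsets_of_size n d" and B: "B \<in> subsets_of_size n d" and AB: "card (A \<inter> B) \<le> 1"
  shows "expectation (\<lambda>\<omega>. h (sample d A \<omega>) * h (sample d B \<omega>)) = 0"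
proof -
  note DA = subsets_of_sizeD[OF A] and DB = subsets_of_sizeD[OF B]
  have "B \<noteq> {}" using DB d by auto
  \<comment> \<open>For disjoint sets any point of \<open>B\<close> serves, so this case needs no
    argument of its own later.\<close>
  have "\<exists>k\<in>B. A \<inter> B \<subseteq> {k}"
  proof (cases "A \<inter> B = {}")
    case True then show ?thesis using \<open>B \<noteq> {}\<close> by blast
  next
    case False
    then obtain k where "k \<in> A \<inter> B" by blast
    moreover have "\<forall>x\<in>A \<inter> B. \<forall>y\<in>A \<inter> B. x = y"
      using AB DA card_le_Suc0_iff_eq[of "A \<inter> B"] by simp
    ultimately show ?thesis by blast
  qed
  then obtain k where k: "k \<in> B" "A \<inter> B \<subseteq> {k}" by blast
  obtain i where i: "i \<in> {1..d}" "enum B i = k" using enum_image[OF DB(3)] DB(2) k(1) by (metis imageE)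
  \<comment> \<open>\<open>k\<close> belongs to \<open>P\<close> even if it is not in
    \<open>A\<close>: conditioning on \<open>P\<close> has to fix X_k.\<close>
  define P where "P = insert k A"
  define Q where "Q = B - {k}"
  have PQ: "P \<inter> Q = {}" "P \<subseteq> {1..}" "Q \<subseteq> {1..}" using k DA DB by (auto simp: P_def Q_def)
  have Bj: "enum B j \<in> Q" if "j \<in> {1..d}" "j \<noteq> i" for j
  proof -
    have "enum B j \<in> B" using enum_in[OF DB(3)] DB(2) that(1) by simp
    moreover have "enum B j \<noteq> k"
      using inj_onD[OF inj_on_enum[OF DB(3)], of j i] DB(2) that i by metis
    ultimately show ?thesis by (simp add: Q_def)
  qed
  have Aj: "enum A j \<in> P" if "j \<in> {1..d}" for j using that enum_in[of A j] DA by (simp add: P_def)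
  have iv: "indep_var (PiM P (\<lambda>_. S)) (\<lambda>\<omega>. restrict (\<lambda>i. X i \<omega>) P) (PiM Q (\<lambda>_. S)) (\<lambda>\<omega>. restrict (\<lambda>i. X i \<omega>) Q)"
    by (rule indep_var_restrict[OF indep PQ])
  define DP where "DP = distr M (PiM P (\<lambda>_. S)) (\<lambda>\<omega>. restrict (\<lambda>i. X i \<omega>) P)"
  define DQ where "DQ = distr M (PiM Q (\<lambda>_. S)) (\<lambda>\<omega>. restrict (\<lambda>i. X i \<omega>) Q)"
  have mP: "(\<lambda>\<omega>. restrict (\<lambda>i. X i \<omega>) P) \<in> M \<rightarrow>\<^sub>M PiM P (\<lambda>_. S)"
    and mQ: "(\<lambda>\<omega>. restrict (\<lambda>i. X i \<omega>) Q) \<in> M \<rightarrow>\<^sub>M PiM Q (\<lambda>_. S)"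
    and joint: "distr M (PiM P (\<lambda>_. S) \<Otimes>\<^sub>M PiM Q (\<lambda>_. S)) (\<lambda>\<omega>. (restrict (\<lambda>i. X i \<omega>) P, restrict (\<lambda>i. X i \<omega>) Q)) = DP \<Otimes>\<^sub>M DQ"
    using iv unfolding indep_var_distribution_eq DP_def DQ_def by auto
  have DP: "DP = PiM P (\<lambda>_. N)"
    unfolding DP_def using distr_tuple[of "\<lambda>j. j" P] PQ by auto
  have sets_DP [measurable_cong]: "sets DP = sets (PiM P (\<lambda>_. S))" and sets_DQ [measurable_cong]: "sets DQ = sets (PiM Q (\<lambda>_. S))"
    by (simp_all add: DP_def DQ_def)
  interpret DP: prob_space DP unfolding DP_def by (rule prob_space_distr[OF mP])
  interpret DQ: prob_space DQ unfolding DQ_def by (rule prob_space_distr[OF mQ])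
  interpret PQ: pair_sigma_finite DP DQ by standard
  define u where "u a = h (\<lambda>j\<in>{1..d}. a (enum A j))" for a
  define v where "v x b = h (\<lambda>j\<in>{1..d}. if j = i then x else b (enum B j))" for x b
  define F where "F p = u (fst p) * v (fst p k) (snd p)" for p
  have mu: "u \<in> borel_measurable (PiM P (\<lambda>_. S))"
    unfolding u_def using Aj by (intro measurable_compose[OF _ h] measurable_restrict measurable_component_singleton)
  have mv: "(\<lambda>p. v (fst p k) (snd p)) \<in> borel_measurable (PiM P (\<lambda>_. S) \<Otimes>\<^sub>M PiM Q (\<lambda>_. S))"
    unfolding v_def
  proof (intro measurable_compose[OF _ h] measurable_restrict)
    fix j assume "j \<in> {1..d}"
    then show "(\<lambda>p. if j = i then fst p k else snd p (enum B j)) \<in> PiM P (\<lambda>_. S) \<Otimes>\<^sub>M PiM Q (\<lambda>_. S) \<rightarrow>\<^sub>M S"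
      using Bj[of j] by (cases "j = i")
        (auto intro: measurable_compose[OF measurable_fst measurable_component_singleton]
            measurable_compose[OF measurable_snd measurable_component_singleton] simp: P_def)
  qed
  have mF: "F \<in> borel_measurable (PiM P (\<lambda>_. S) \<Otimes>\<^sub>M PiM Q (\<lambda>_. S))"
    unfolding F_def using mv measurable_compose[OF measurable_fst mu] by measurable
  have uA: "u (restrict (\<lambda>i. X i \<omega>) P) = h (sample d A \<omega>)" for \<omega>
    unfolding u_def sample_def using Aj by (intro arg_cong[where f = h]) auto
  have vB: "v (X k \<omega>) (restrict (\<lambda>i. X i \<omega>) Q) = h (sample d B \<omega>)" for \<omega>
    unfolding v_def sample_def using Bj i by (intro arg_cong[where f = h]) auto
  have F_eq: "F (restrict (\<lambda>i. X i \<omega>) P, restrict (\<lambda>i. X i \<omega>) Q) = h (sample d A \<omega>) * h (sample d B \<omega>)" for \<omega>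
    using uA vB by (simp add: F_def P_def)
  have mPQ: "(\<lambda>\<omega>. (restrict (\<lambda>i. X i \<omega>) P, restrict (\<lambda>i. X i \<omega>) Q)) \<in> M \<rightarrow>\<^sub>M PiM P (\<lambda>_. S) \<Otimes>\<^sub>M PiM Q (\<lambda>_. S)"
    using mP mQ by measurable
  have h2: "(\<lambda>z. (h z)\<^sup>2) \<in> borel_measurable (PiM {1..d} (\<lambda>_. S))" using h by measurable
  have "integrable M (\<lambda>\<omega>. h (sample d A \<omega>) * h (sample d B \<omega>))"
    using int integrable_sample_iff[OF A h2] integrable_sample_iff[OF B h2]
    by (intro integrable_mult_square sample_comp_measurable[OF A h] sample_comp_measurable[OF B h]) auto
  then have intF: "integrable (DP \<Otimes>\<^sub>M DQ) F"
    unfolding joint[symmetric] integrable_distr_eq[OF mPQ mF] F_eq .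
  have "expectation (\<lambda>\<omega>. h (sample d A \<omega>) * h (sample d B \<omega>)) = integral\<^sup>L (DP \<Otimes>\<^sub>M DQ) F"
    unfolding joint[symmetric] integral_distr[OF mPQ mF] F_eq ..
  also have "\<dots> = (\<integral>a. (\<integral>b. F (a, b) \<partial>DQ) \<partial>DP)"
    by (rule PQ.integral_fst'[OF intF, symmetric])
  also have "\<dots> = (\<integral>a. 0 \<partial>DP)"
  proof (rule integral_cong_AE)
    show "(\<lambda>a. \<integral>b. F (a, b) \<partial>DQ) \<in> borel_measurable DP"
      using PQ.integrable_fst'[OF intF] by (rule borel_measurable_integrable)
    \<comment> \<open>\<open>DP\<close> is a product of copies of \<open>N\<close>, so the
      exceptional null set of \<open>sec\<close> stays null when read off at coordinate
      \<open>k\<close>.\<close>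
    have "AE a in DP. section_mean d h i (a k) = 0"
      unfolding DP by (rule AE_PiM_component[OF prob_space_N _ sec[OF i(1)]]) (simp add: P_def)
    then show "AE a in DP. (\<integral>b. F (a, b) \<partial>DQ) = 0"
      using AE_space
    proof eventually_elim
      case (elim a)
      have ak: "a k \<in> space S"
        using elim(2) sets_eq_imp_space_eq[OF sets_DP] by (auto simp: space_PiM P_def)
      have "(\<integral>b. v (a k) b \<partial>DQ) = expectation (\<lambda>\<omega>. v (a k) (restrict (\<lambda>i. X i \<omega>) Q))"
        unfolding DQ_def
      proof (rule integral_distr[OF mQ])
        have "a \<in> space (PiM P (\<lambda>_. S))" using elim(2) sets_eq_imp_space_eq[OF sets_DP] by simp
        from measurable_compose[OF measurable_Pair1'[OF this] mv]
        show "v (a k) \<in> borel_measurable (PiM Q (\<lambda>_. S))" by simp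
      qed
      also have "(\<lambda>\<omega>. v (a k) (restrict (\<lambda>i. X i \<omega>) Q)) = (\<lambda>\<omega>. h (\<lambda>j\<in>{1..d}. if j = i then a k else X (enum B j) \<omega>))"
        unfolding v_def using Bj by (intro ext arg_cong[where f = h]) auto
      \<comment> \<open>The free arguments carry the indices \<open>enum B j\<close> instead of
        \<open>j\<close>; by equidistribution this does not change the mean.\<close>
      also have "expectation \<dots> = section_mean d h i (a k)"
      proof -
        have "inj_on (enum B) ({1..d} - {i})" "enum B ` ({1..d} - {i}) \<subseteq> {1..}"
          using sample_index[OF B] by (auto intro: inj_on_subset)
        then show ?thesis
          using section_eq(2)[OF i(1) h ak] section_mean_eq[OF i(1) h ak] by simp
      qed
      finally show ?case using elim(1) by (simp add: F_def)
    qed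
  qed simp
  finally show ?thesis by simp
qed

text \<open>After expanding the square only pairs of sets with at least two common points survive.
  Each contributes at most the second moment of \<open>h\<close>, since a product is bounded by the
  mean of the squares.\<close>

lemma second_moment_subset_sum_le:
  fixes h :: "(nat \<Rightarrow> 's) \<Rightarrow> real"
  assumes d: "d \<ge> 1" and h: "h \<in> borel_measurable (PiM {1..d} (\<lambda>_. S))"
    and int: "integrable (PiM {1..d} (\<lambda>_. N)) (\<lambda>z. (h z)\<^sup>2)"
    and sec: "\<And>i. i \<in> {1..d} \<Longrightarrow> AE x in N. section_mean d h i x = 0"
  shows "expectation (\<lambda>\<omega>. (\<Sum>A\<in>subsets_of_size n d. h (sample d A \<omega>))\<^sup>2)
     \<le> real n ^ (2 * d - 2) * (\<integral>z. (h z)\<^sup>2 \<partial>PiM {1..d} (\<lambda>_. N))"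
proof -
  let ?D = "subsets_of_size n d"
  define v where "v = (\<integral>z. (h z)\<^sup>2 \<partial>PiM {1..d} (\<lambda>_. N))"
  have v0: "v \<ge> 0" by (simp add: v_def)
  have h2: "(\<lambda>z. (h z)\<^sup>2) \<in> borel_measurable (PiM {1..d} (\<lambda>_. S))" using h by measurable
  have i2: "integrable M (\<lambda>\<omega>. (h (sample d A \<omega>))\<^sup>2)" "expectation (\<lambda>\<omega>. (h (sample d A \<omega>))\<^sup>2) = v"
    if "A \<in> ?D" for A
    using integrable_sample_iff[OF that h2] expectation_sample[OF that h2] int by (auto simp: v_def)
  have im: "integrable M (\<lambda>\<omega>. h (sample d A \<omega>) * h (sample d B \<omega>))" if "A \<in> ?D" "B \<in> ?D" for A B
    using i2 that by (intro integrable_mult_square sample_comp_measurable[OF that(1) h] sample_comp_measurable[OF that(2) h]) auto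
  have "expectation (\<lambda>\<omega>. (\<Sum>A\<in>?D. h (sample d A \<omega>))\<^sup>2)
      = (\<Sum>p\<in>?D \<times> ?D. expectation (\<lambda>\<omega>. h (sample d (fst p) \<omega>) * h (sample d (snd p) \<omega>)))"
    unfolding power2_eq_square sum_product sum.cartesian_product case_prod_beta
    by (rule Bochner_Integration.integral_sum) (use im in auto)
  also have "\<dots> = (\<Sum>p\<in>{(A, B). A \<in> ?D \<and> B \<in> ?D \<and> card (A \<inter> B) \<ge> 2}.
      expectation (\<lambda>\<omega>. h (sample d (fst p) \<omega>) * h (sample d (snd p) \<omega>)))"
    by (rule sum.mono_neutral_right)
      (auto intro!: expectation_mult_samples_eq_0[OF d h int sec])
  also have "\<dots> \<le> (\<Sum>p\<in>{(A, B). A \<in> ?D \<and> B \<in> ?D \<and> card (A \<inter> B) \<ge> 2}. v)"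
  proof (rule sum_mono)
    fix p assume "p \<in> {(A, B). A \<in> ?D \<and> B \<in> ?D \<and> card (A \<inter> B) \<ge> 2}"
    then have p: "fst p \<in> ?D" "snd p \<in> ?D" by auto
    have "expectation (\<lambda>\<omega>. h (sample d (fst p) \<omega>) * h (sample d (snd p) \<omega>))
       \<le> expectation (\<lambda>\<omega>. ((h (sample d (fst p) \<omega>))\<^sup>2 + (h (sample d (snd p) \<omega>))\<^sup>2) / 2)"
      using i2 p by (intro integral_mono im order_trans[OF abs_ge_self abs_mult_le_squares]) auto
    also have "\<dots> = v" using i2 p by simp
    finally show "expectation (\<lambda>\<omega>. h (sample d (fst p) \<omega>) * h (sample d (snd p) \<omega>)) \<le> v" .
  qed
  also have "\<dots> \<le> real n ^ (2 * d - 2) * v"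
  proof -
    have "real (card {(A, B). A \<in> ?D \<and> B \<in> ?D \<and> card (A \<inter> B) \<ge> 2}) \<le> real (n ^ (2 * d - 2))"
      using card_pairs_meeting_twice_le of_nat_le_iff by blast
    then show ?thesis using v0 by (simp add: mult_right_mono)
  qed
  finally show ?thesis unfolding v_def .
qed

end

section \<open>Lindeberg theorem and Hoeffding decomposition\<close>

lemma exp_minus_approx:
  fixes y :: real assumes "y \<ge> 0"
  shows "\<bar>exp (- y) - (1 - y)\<bar> \<le> y\<^sup>2"
proof -
  have "exp (- y) \<le> 1 / (1 + y)"
    using exp_ge_add_one_self[of y] assms by (simp add: exp_minus field_simps)
  also have "\<dots> \<le> 1 - y + y\<^sup>2"
    using assms by (simp add: field_simps power2_eq_square)
  finally have "exp (- y) - (1 - y) \<le> y\<^sup>2" by simp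
  moreover have "exp (- y) - (1 - y) \<ge> 0" using exp_ge_add_one_self[of "- y"] by simp
  ultimately show ?thesis by simp
qed

text \<open>The map x to exp(i x) is 1-Lipschitz. This takes the place of Slutsky's lemma: a
  perturbation that is small in L^1 does not affect limits of characteristic functions.\<close>

lemma (in prob_space) char_distr_diff_le:
  fixes U V :: "'a \<Rightarrow> real"
  assumes [measurable]: "U \<in> borel_measurable M" "V \<in> borel_measurable M"
    and int: "integrable M (\<lambda>\<omega>. U \<omega> - V \<omega>)"
  shows "cmod (char (distr M borel U) t - char (distr M borel V) t) \<le> \<bar>t\<bar> * expectation (\<lambda>\<omega>. \<bar>U \<omega> - V \<omega>\<bar>)"
proof -
  have i: "integrable M (\<lambda>\<omega>. iexp (t * W \<omega>))" if "W \<in> borel_measurable M" for W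
    using that by (intro integrable_iexp) auto
  have "char (distr M borel U) t - char (distr M borel V) t = (CLINT \<omega>|M. iexp (t * U \<omega>) - iexp (t * V \<omega>))"
    unfolding char_def using Bochner_Integration.integral_diff[OF i[OF assms(1)] i[OF assms(2)]]
    by (simp add: integral_distr)
  also have "cmod \<dots> \<le> expectation (\<lambda>\<omega>. cmod (iexp (t * U \<omega>) - iexp (t * V \<omega>)))"
    by (rule integral_norm_bound)
  also have "\<dots> \<le> expectation (\<lambda>\<omega>. \<bar>t\<bar> * \<bar>U \<omega> - V \<omega>\<bar>)"
  proof (rule integral_mono)
    fix \<omega>
    have "iexp (t * U \<omega>) - iexp (t * V \<omega>) = iexp (t * V \<omega>) * (iexp (t * U \<omega> - t * V \<omega>) - 1)"
      by (simp add: exp_add[symmetric] algebra_simps)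
    moreover have "cmod (iexp (t * U \<omega> - t * V \<omega>) - 1) \<le> \<bar>t * U \<omega> - t * V \<omega>\<bar>"
      using iexp_approx1[of "t * U \<omega> - t * V \<omega>" 0] by simp
    ultimately show "cmod (iexp (t * U \<omega>) - iexp (t * V \<omega>)) \<le> \<bar>t\<bar> * \<bar>U \<omega> - V \<omega>\<bar>"
      by (simp add: norm_mult right_diff_distrib[symmetric] abs_mult)
  qed (use int i in auto)
  also have "\<dots> = \<bar>t\<bar> * expectation (\<lambda>\<omega>. \<bar>U \<omega> - V \<omega>\<bar>)" by simp
  finally show ?thesis .
qed

context iid_sequence
begin

text \<open>
  A Lindeberg theorem in which the Lindeberg condition comes for free from the domination of the
  \<open>n\<close>-th row by \<open>G / sqrt n\<close>.
\<close>

lemma char_dominated_array_tendsto: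
  fixes z :: "nat \<Rightarrow> nat \<Rightarrow> 's \<Rightarrow> real" and G :: "'s \<Rightarrow> real"
  assumes z: "\<And>n k. z n k \<in> borel_measurable S" and G: "G \<in> borel_measurable S"
    and G2: "integrable N (\<lambda>x. (G x)\<^sup>2)"
    and bound: "\<And>n k x. k \<in> {1..n} \<Longrightarrow> x \<in> space S \<Longrightarrow> \<bar>z n k x\<bar> \<le> G x / sqrt (real n)"
    and mean: "\<And>n k. k \<in> {1..n} \<Longrightarrow> integral\<^sup>L N (z n k) = 0"
    and var: "(\<lambda>n. \<Sum>k=1..n. \<integral>x. (z n k x)\<^sup>2 \<partial>N) \<longlonglongrightarrow> v"
  shows "(\<lambda>n. char (distr M borel (\<lambda>\<omega>. \<Sum>k=1..n. z n k (X k \<omega>))) t) \<longlonglongrightarrow> of_real (exp (- (t\<^sup>2 * v / 2)))"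
proof -
  define w where "w n k = (\<integral>x. (z n k x)\<^sup>2 \<partial>N)" for n k
  define g where "g = (\<integral>x. (G x)\<^sup>2 \<partial>N)"
  \<comment> \<open>The second-order expansion of a characteristic function leaves a remainder with
    the integrand min(6 z^2, |t| |z|^3). Inserting the bound G / sqrt n for |z| gives
    \<open>e n / n\<close>, and \<open>e\<close> tends to 0 by domination by 6 G^2.\<close>
  define e where "e n = (\<integral>x. min (6 * (G x)\<^sup>2) (\<bar>t\<bar> * \<bar>G x\<bar> ^ 3 / sqrt (real n)) \<partial>N)" for n :: nat
  note [measurable] = z G
  have w0: "w n k \<ge> 0" for n k by (simp add: w_def)
  have zb: "(z n k x)\<^sup>2 \<le> (G x)\<^sup>2 / real n" if "k \<in> {1..n}" "x \<in> space S" for n k x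
    using power_mono[OF bound[OF that], of 2] by (simp add: power_divide)
  have z2: "integrable N (\<lambda>x. (z n k x)\<^sup>2)" if "k \<in> {1..n}" for n k
    by (rule Bochner_Integration.integrable_bound[where f = "\<lambda>x. (G x)\<^sup>2 / real n"])
      (use G2 zb[OF that] in auto)
  have wle: "w n k \<le> g / real n" if "k \<in> {1..n}" for n k
    using integral_mono[OF z2[OF that] integrable_divide[OF G2, of "real n"]] zb[OF that] by (simp add: w_def g_def)
  have e: "e \<longlonglongrightarrow> 0"
  proof -
    have "(\<lambda>n. min (6 * (G x)\<^sup>2) (\<bar>t\<bar> * \<bar>G x\<bar> ^ 3 / sqrt (real n))) \<longlonglongrightarrow> 0" for x
    proof -
      have "(\<lambda>n. \<bar>t\<bar> * \<bar>G x\<bar> ^ 3 / sqrt (real n)) \<longlonglongrightarrow> 0"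
        by (intro tendsto_divide_0[OF tendsto_const] filterlim_at_top_imp_at_infinity
            filterlim_compose[OF sqrt_at_top filterlim_real_sequentially])
      from tendsto_min[OF tendsto_const this, of "6 * (G x)\<^sup>2"] show ?thesis by simp
    qed
    then have "(\<lambda>n. e n) \<longlonglongrightarrow> (\<integral>x. 0 \<partial>N)"
      unfolding e_def using G2
      by (intro integral_dominated_convergence[where w = "\<lambda>x. 6 * (G x)\<^sup>2"]) auto
    then show ?thesis by simp
  qed
  define c where "c n k = char (distr M borel (\<lambda>\<omega>. z n k (X k \<omega>))) t" for n k
  have step: "cmod (c n k - of_real (exp (- (t\<^sup>2 * w n k / 2)))) \<le> (t\<^sup>2 / 6 * e n + t ^ 4 / 4 * g\<^sup>2 / real n) / real n"
    if k: "k \<in> {1..n}" for n k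
  proof -
    have n: "n > 0" "k \<ge> 1" using k by auto
    have m[measurable]: "(\<lambda>\<omega>. z n k (X k \<omega>)) \<in> borel_measurable M"
      using measurable_compose[OF X_measurable[OF n(2)] z] .
    have sq: "integrable M (\<lambda>\<omega>. (z n k (X k \<omega>))\<^sup>2)" "expectation (\<lambda>\<omega>. (z n k (X k \<omega>))\<^sup>2) = w n k"
      using integrable_X_iff[of "\<lambda>x. (z n k x)\<^sup>2" k] expectation_X[of "\<lambda>x. (z n k x)\<^sup>2" k] z2[OF k] n
      by (auto simp: w_def)
    have int: "integrable M (\<lambda>\<omega>. z n k (X k \<omega>))" by (rule square_integrable_imp_integrable[OF m sq(1)])
    have ex: "expectation (\<lambda>\<omega>. z n k (X k \<omega>)) = 0" using expectation_X[OF z n(2)] mean[OF k] by simp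
    have "expectation (\<lambda>\<omega>. min (6 * (z n k (X k \<omega>))\<^sup>2) (\<bar>t\<bar> * \<bar>z n k (X k \<omega>)\<bar> ^ 3))
        = (\<integral>x. min (6 * (z n k x)\<^sup>2) (\<bar>t\<bar> * \<bar>z n k x\<bar> ^ 3) \<partial>N)"
      using n by (intro expectation_X) auto
    also have "\<dots> \<le> (\<integral>x. min (6 * (G x)\<^sup>2) (\<bar>t\<bar> * \<bar>G x\<bar> ^ 3 / sqrt (real n)) / real n \<partial>N)"
    proof (rule integral_mono)
      show "integrable N (\<lambda>x. min (6 * (z n k x)\<^sup>2) (\<bar>t\<bar> * \<bar>z n k x\<bar> ^ 3))"
        by (rule Bochner_Integration.integrable_bound[where f = "\<lambda>x. 6 * (z n k x)\<^sup>2"]) (use z2[OF k] in auto)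
      show "integrable N (\<lambda>x. min (6 * (G x)\<^sup>2) (\<bar>t\<bar> * \<bar>G x\<bar> ^ 3 / sqrt (real n)) / real n)"
        by (rule integrable_divide, rule Bochner_Integration.integrable_bound[where f = "\<lambda>x. 6 * (G x)\<^sup>2"])
          (use G2 in auto)
      fix x assume "x \<in> space N"
      then have x: "x \<in> space S" by simp
      have "\<bar>z n k x\<bar> ^ 3 \<le> (G x / sqrt (real n)) ^ 3" by (intro power_mono bound[OF k x]) auto
      also have "\<dots> \<le> \<bar>G x\<bar> ^ 3 / sqrt (real n) ^ 3"
        using abs_ge_self[of "G x ^ 3"] by (simp add: power_divide power_abs divide_right_mono)
      also have "sqrt (real n) ^ 3 = sqrt (real n) * real n" by (simp add: power3_eq_cube)
      finally have "\<bar>t\<bar> * \<bar>z n k x\<bar> ^ 3 \<le> \<bar>t\<bar> * (\<bar>G x\<bar> ^ 3 / (sqrt (real n) * real n))"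
        by (rule mult_left_mono) simp
      then have 1: "\<bar>t\<bar> * \<bar>z n k x\<bar> ^ 3 \<le> \<bar>t\<bar> * \<bar>G x\<bar> ^ 3 / sqrt (real n) / real n" by simp
      have 2: "6 * (z n k x)\<^sup>2 \<le> 6 * (G x)\<^sup>2 / real n" using zb[OF k x] by simp
      show "min (6 * (z n k x)\<^sup>2) (\<bar>t\<bar> * \<bar>z n k x\<bar> ^ 3)
          \<le> min (6 * (G x)\<^sup>2) (\<bar>t\<bar> * \<bar>G x\<bar> ^ 3 / sqrt (real n)) / real n"
        using min.mono[OF 2 1] n by (simp add: min_divide_distrib_right)
    qed
    also have "\<dots> = e n / real n" by (simp add: e_def)
    finally have E: "expectation (\<lambda>\<omega>. min (6 * (z n k (X k \<omega>))\<^sup>2) (\<bar>t\<bar> * \<bar>z n k (X k \<omega>)\<bar> ^ 3)) \<le> e n / real n" .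
    have "cmod (c n k - (1 - t\<^sup>2 * w n k / 2))
        \<le> t\<^sup>2 / 6 * expectation (\<lambda>\<omega>. min (6 * (z n k (X k \<omega>))\<^sup>2) (\<bar>t\<bar> * \<bar>z n k (X k \<omega>)\<bar> ^ 3))"
      unfolding c_def using char_approx3'[OF m int sq(1) ex _ refl, of "w n k" t] ex sq by simp
    also have "\<dots> \<le> t\<^sup>2 / 6 * (e n / real n)" by (intro mult_left_mono E) simp
    finally have 1: "cmod (c n k - (1 - t\<^sup>2 * w n k / 2)) \<le> t\<^sup>2 / 6 * (e n / real n)" .
    \<comment> \<open>Each variance is at most g/n, so this error is of order n^(-2) and stays
      negligible after adding \<open>n\<close> of them.\<close>
    have "\<bar>exp (- (t\<^sup>2 * w n k / 2)) - (1 - t\<^sup>2 * w n k / 2)\<bar> \<le> (t\<^sup>2 * w n k / 2)\<^sup>2"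
      using w0 by (intro exp_minus_approx) auto
    also have "\<dots> \<le> (t\<^sup>2 * (g / real n) / 2)\<^sup>2"
      using wle[OF k] w0 by (intro power_mono divide_right_mono mult_left_mono) auto
    also have "\<dots> = t ^ 4 / 4 * g\<^sup>2 / real n / real n"
      by (simp add: field_simps power2_eq_square power4_eq_xxxx)
    finally have "cmod (of_real (exp (- (t\<^sup>2 * w n k / 2))) - of_real (1 - t\<^sup>2 * w n k / 2)) \<le> t ^ 4 / 4 * g\<^sup>2 / real n / real n"
      unfolding of_real_diff[symmetric] norm_of_real .
    then have 2: "cmod ((1 - t\<^sup>2 * w n k / 2) - of_real (exp (- (t\<^sup>2 * w n k / 2)))) \<le> t ^ 4 / 4 * g\<^sup>2 / real n / real n"
      by (simp add: norm_minus_commute)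
    show ?thesis
      using norm_triangle_mono[OF 1 2] by (simp add: add_divide_distrib)
  qed
  have char_prod: "char (distr M borel (\<lambda>\<omega>. \<Sum>k=1..n. z n k (X k \<omega>))) t = (\<Prod>k=1..n. c n k)" for n
    unfolding c_def
    by (rule char_distr_sum, rule indep_vars_compose2[OF indep_vars_subset[OF indep]]) auto
  have exp_prod: "(\<Prod>k=1..n. complex_of_real (exp (- (t\<^sup>2 * w n k / 2)))) = of_real (exp (- (t\<^sup>2 * (\<Sum>k=1..n. w n k) / 2)))" for n
    by (simp add: exp_sum[symmetric] sum_distrib_left sum_divide_distrib sum_negf flip: of_real_prod)
  \<comment> \<open>The comparison is with Gaussian factors having the variances of the row itself;
    \<open>v\<close> enters only at the end, by continuity of exp.\<close>
  have "(\<lambda>n. char (distr M borel (\<lambda>\<omega>. \<Sum>k=1..n. z n k (X k \<omega>))) t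
      - of_real (exp (- (t\<^sup>2 * (\<Sum>k=1..n. w n k) / 2)))) \<longlonglongrightarrow> 0"
  proof (rule Lim_null_comparison)
    show "\<forall>\<^sub>F n in sequentially. norm (char (distr M borel (\<lambda>\<omega>. \<Sum>k=1..n. z n k (X k \<omega>))) t
      - of_real (exp (- (t\<^sup>2 * (\<Sum>k=1..n. w n k) / 2)))) \<le> t\<^sup>2 / 6 * e n + t ^ 4 / 4 * g\<^sup>2 / real n"
      using eventually_gt_at_top[of 0]
    proof eventually_elim
      case (elim n)
      \<comment> \<open>All factors have modulus at most 1, so replacing them one by one adds up the
        individual errors.\<close>
      have "norm ((\<Prod>k=1..n. c n k) - (\<Prod>k=1..n. complex_of_real (exp (- (t\<^sup>2 * w n k / 2)))))
        \<le> (\<Sum>k=1..n. cmod (c n k - of_real (exp (- (t\<^sup>2 * w n k / 2)))))"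
      proof (rule norm_prod_diff)
        fix k assume k: "k \<in> {1..n}"
        have m: "(\<lambda>\<omega>. z n k (X k \<omega>)) \<in> borel_measurable M"
          by (rule measurable_compose[OF X_measurable z]) (use k in auto)
        interpret D: real_distribution "distr M borel (\<lambda>\<omega>. z n k (X k \<omega>))"
          by (rule real_distribution_distr[OF m])
        show "cmod (c n k) \<le> 1" unfolding c_def by (rule D.cmod_char_le_1)
        show "cmod (complex_of_real (exp (- (t\<^sup>2 * w n k / 2)))) \<le> 1"
          using w0[of n k] by simp
      qed
      also have "\<dots> \<le> (\<Sum>k=1..n. (t\<^sup>2 / 6 * e n + t ^ 4 / 4 * g\<^sup>2 / real n) / real n)"
        by (intro sum_mono step)
      also have "\<dots> = t\<^sup>2 / 6 * e n + t ^ 4 / 4 * g\<^sup>2 / real n" using elim by simp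
      finally show ?case unfolding char_prod exp_prod .
    qed
    show "(\<lambda>n. t\<^sup>2 / 6 * e n + t ^ 4 / 4 * g\<^sup>2 / real n) \<longlonglongrightarrow> 0"
      using tendsto_add[OF tendsto_mult_right_zero[OF e, of "t\<^sup>2 / 6"] lim_const_over_n[of "t ^ 4 / 4 * g\<^sup>2"]] by simp
  qed
  note conv0 = this
  have conv: "(\<lambda>n. char (distr M borel (\<lambda>\<omega>. \<Sum>k=1..n. z n k (X k \<omega>))) t) \<longlonglongrightarrow> 0 + b"
    if "(\<lambda>n. complex_of_real (exp (- (t\<^sup>2 * (\<Sum>k=1..n. w n k) / 2)))) \<longlonglongrightarrow> b" for b
    using tendsto_add[OF conv0 that] by (simp only: diff_add_cancel)
  have "(\<lambda>n. complex_of_real (exp (- (t\<^sup>2 * (\<Sum>k=1..n. w n k) / 2)))) \<longlonglongrightarrow> of_real (exp (- (t\<^sup>2 * v / 2)))"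
    using var unfolding w_def[symmetric] by (intro tendsto_intros) auto
  from conv[OF this] show ?thesis by simp
qed

section \<open>Hoeffding decomposition of the statistic\<close>

lemma U_mean_eq:
  "f \<in> borel_measurable (PiM {1..d} (\<lambda>_. S)) \<Longrightarrow> U_mean M d f X = integral\<^sup>L (PiM {1..d} (\<lambda>_. N)) f"
  unfolding U_mean_def by (rule expectation_tuple[OF initial_index])

lemma U_proj_eq: "U_proj M d f X i x = section_mean d f i x - U_mean M d f X"
  by (simp add: U_proj_def section_mean_def)

lemma square_integrable_PiM:
  fixes h :: "(nat \<Rightarrow> 's) \<Rightarrow> real"
  assumes h: "h \<in> borel_measurable (PiM {1..d} (\<lambda>_. S))"
    and int: "integrable (PiM {1..d} (\<lambda>_. N)) (\<lambda>z. (h z)\<^sup>2)"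
  shows "integrable (PiM {1..d} (\<lambda>_. N)) h"
proof -
  interpret P: prob_space "PiM {1..d} (\<lambda>_. N)" by (rule prob_space_PiM_N)
  show ?thesis
    by (rule P.square_integrable_imp_integrable[OF _ int])
      (use h in \<open>simp only: measurable_cong_sets[OF sets_PiM_N refl]\<close>)
qed

lemma
  fixes f :: "(nat \<Rightarrow> 's) \<Rightarrow> real"
  assumes i: "i \<in> {1..d}" and f: "f \<in> borel_measurable (PiM {1..d} (\<lambda>_. S))"
  shows U_proj_measurable: "U_proj M d f X i \<in> borel_measurable S"
    and U_proj_square_integrable: "integrable (PiM {1..d} (\<lambda>_. N)) (\<lambda>z. (f z)\<^sup>2) \<Longrightarrow> integrable N (\<lambda>x. (U_proj M d f X i x)\<^sup>2)"
    and U_proj_integrable: "integrable (PiM {1..d} (\<lambda>_. N)) (\<lambda>z. (f z)\<^sup>2) \<Longrightarrow> integrable N (U_proj M d f X i)"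
    and integral_U_proj: "integrable (PiM {1..d} (\<lambda>_. N)) (\<lambda>z. (f z)\<^sup>2) \<Longrightarrow> integral\<^sup>L N (U_proj M d f X i) = 0"
proof -
  show m: "U_proj M d f X i \<in> borel_measurable S"
    unfolding U_proj_eq using section_mean_measurable[OF i f] by measurable
  assume int: "integrable (PiM {1..d} (\<lambda>_. N)) (\<lambda>z. (f z)\<^sup>2)"
  note int1 = square_integrable_PiM[OF f int]
  have sm: "integrable N (section_mean d f i)" by (rule section_mean_integrable[OF i f int1])
  have sm': "integral\<^sup>L N (section_mean d f i) = U_mean M d f X"
    unfolding U_mean_eq[OF f] by (rule integral_section_mean[OF i f int1])
  have meq: "borel_measurable N = borel_measurable S" by (rule measurable_cong_sets[OF sets_N refl])
  show "integrable N (U_proj M d f X i)" unfolding U_proj_eq using sm by simp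
  show "integral\<^sup>L N (U_proj M d f X i) = 0"
    unfolding U_proj_eq using sm sm' by (simp add: N.prob_space del: space_N)
  show "integrable N (\<lambda>x. (U_proj M d f X i x)\<^sup>2)"
    unfolding U_proj_eq
    using integrable_square_add[of "section_mean d f i" N "\<lambda>_. - U_mean M d f X"]
      section_mean_square_integrable[OF i f int] section_mean_measurable[OF i f]
    by (simp add: meq)
qed

text \<open>Only the terms of order 0 and 1 of the Hoeffding decomposition are split off; all higher
  orders stay together, as a bound on their joint second moment is enough.\<close>

definition hoeffding_remainder :: "nat \<Rightarrow> ((nat \<Rightarrow> 's) \<Rightarrow> real) \<Rightarrow> (nat \<Rightarrow> 's) \<Rightarrow> real" where
  "hoeffding_remainder d f z = f z - U_mean M d f X - (\<Sum>i=1..d. U_proj M d f X i (z i))"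

text \<open>For the last claim: given that the \<open>i\<close>-th argument is \<open>x\<close>, the
  centred \<open>f\<close> has mean \<open>U_proj M d f X i x\<close>, the \<open>i\<close>-th
  projection is that same number, and the other projections have mean 0. It holds almost everywhere
  because the section of \<open>f\<close> at \<open>x\<close> is integrable only for almost every
  \<open>x\<close>.\<close>

lemma
  fixes f :: "(nat \<Rightarrow> 's) \<Rightarrow> real"
  assumes f: "f \<in> borel_measurable (PiM {1..d} (\<lambda>_. S))"
    and int: "integrable (PiM {1..d} (\<lambda>_. N)) (\<lambda>z. (f z)\<^sup>2)"
  shows hoeffding_remainder_measurable: "hoeffding_remainder d f \<in> borel_measurable (PiM {1..d} (\<lambda>_. S))"
    and hoeffding_remainder_square_integrable: "integrable (PiM {1..d} (\<lambda>_. N)) (\<lambda>z. (hoeffding_remainder d f z)\<^sup>2)"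
    and hoeffding_remainder_section: "i \<in> {1..d} \<Longrightarrow> AE x in N. section_mean d (hoeffding_remainder d f) i x = 0"
proof -
  let ?P = "PiM {1..d} (\<lambda>_. N)"
  interpret P: prob_space ?P by (rule prob_space_PiM_N)
  have pm: "(\<lambda>z. U_proj M d f X i (z i)) \<in> borel_measurable (PiM {1..d} (\<lambda>_. S))" if "i \<in> {1..d}" for i
    by (rule measurable_compose[OF measurable_component_singleton[OF that] U_proj_measurable[OF that f]])
  have psq: "integrable ?P (\<lambda>z. (U_proj M d f X i (z i))\<^sup>2)" if i: "i \<in> {1..d}" for i
  proof -
    have "(\<lambda>z. (U_proj M d f X i (z i))\<^sup>2) \<in> borel_measurable (PiM {1..d} (\<lambda>_. S))" using pm[OF i] by measurable
    from integrable_tuple_iff[OF initial_index this]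
    have "integrable ?P (\<lambda>z. (U_proj M d f X i (z i))\<^sup>2) \<longleftrightarrow> integrable M (\<lambda>\<omega>. (U_proj M d f X i (X i \<omega>))\<^sup>2)"
      using i by simp
    also have "\<dots> \<longleftrightarrow> integrable N (\<lambda>x. (U_proj M d f X i x)\<^sup>2)"
      using i U_proj_measurable[OF i f] by (intro integrable_X_iff) auto
    finally show ?thesis using U_proj_square_integrable[OF i f int] by simp
  qed
  show m: "hoeffding_remainder d f \<in> borel_measurable (PiM {1..d} (\<lambda>_. S))"
    unfolding hoeffding_remainder_def using f pm by measurable
  have ms: "(\<lambda>z. \<Sum>i=1..d. - U_proj M d f X i (z i)) \<in> borel_measurable ?P"
    by (rule borel_measurable_sum) (use pm in measurable)
  have "integrable ?P (\<lambda>z. (\<Sum>i=1..d. - U_proj M d f X i (z i))\<^sup>2)"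
    by (rule integrable_square_sum) (use pm psq in \<open>simp_all add: measurable_cong_sets[OF sets_PiM_N refl]\<close>)
  then have "integrable ?P (\<lambda>z. (- U_mean M d f X + (\<Sum>i=1..d. - U_proj M d f X i (z i)))\<^sup>2)"
    by (intro integrable_square_add ms borel_measurable_const P.integrable_const)
  then have "integrable ?P (\<lambda>z. (f z + (- U_mean M d f X + (\<Sum>i=1..d. - U_proj M d f X i (z i))))\<^sup>2)"
    using f by (intro integrable_square_add[OF _ borel_measurable_add[OF borel_measurable_const ms] int])
      (simp_all only: measurable_cong_sets[OF sets_PiM_N refl])
  also have "(\<lambda>z. (f z + (- U_mean M d f X + (\<Sum>i=1..d. - U_proj M d f X i (z i))))\<^sup>2)
      = (\<lambda>z. (hoeffding_remainder d f z)\<^sup>2)"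
    unfolding hoeffding_remainder_def sum_negf by (intro ext arg_cong[where f = "\<lambda>x. x\<^sup>2"]) linarith
  finally show "integrable ?P (\<lambda>z. (hoeffding_remainder d f z)\<^sup>2)" .
  assume i: "i \<in> {1..d}"
  show "AE x in N. section_mean d (hoeffding_remainder d f) i x = 0"
    using AE_section_integrable[OF i f square_integrable_PiM[OF f int]]
  proof eventually_elim
    case (elim x)
    let ?u = "\<lambda>j \<omega>. U_proj M d f X j (if j = i then x else X j \<omega>)"
    \<comment> \<open>For \<open>j = i\<close> the summand is constant in the sample point.\<close>
    have u: "integrable M (?u j)" "expectation (?u j) = (if j = i then U_proj M d f X i x else 0)" if "j \<in> {1..d}" for j
      using that integrable_X_iff[OF U_proj_measurable[OF that f]] expectation_X[OF U_proj_measurable[OF that f]]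
        U_proj_integrable[OF that f int] integral_U_proj[OF that f int]
      by (cases "j = i"; simp add: prob_space)+
    have "section_mean d (hoeffding_remainder d f) i x
      = expectation (\<lambda>\<omega>. f (\<lambda>j\<in>{1..d}. if j = i then x else X j \<omega>) - U_mean M d f X - (\<Sum>j=1..d. ?u j \<omega>))"
      unfolding section_mean_def hoeffding_remainder_def by (intro Bochner_Integration.integral_cong) auto
    also have "\<dots> = section_mean d f i x - U_mean M d f X - (\<Sum>j=1..d. expectation (?u j))"
    proof -
      have I: "integrable M (\<lambda>\<omega>. \<Sum>j=1..d. ?u j \<omega>)" by (rule Bochner_Integration.integrable_sum) (rule u)
      have E: "expectation (\<lambda>\<omega>. \<Sum>j=1..d. ?u j \<omega>) = (\<Sum>j=1..d. expectation (?u j))"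
        by (rule Bochner_Integration.integral_sum) (rule u)
      have C: "integrable M (\<lambda>_. U_mean M d f X)" by simp
      show ?thesis
        unfolding Bochner_Integration.integral_diff[OF Bochner_Integration.integrable_diff[OF elim C] I]
          Bochner_Integration.integral_diff[OF elim C] E by (simp add: section_mean_def prob_space)
    qed
    also have "(\<Sum>j=1..d. expectation (?u j)) = U_proj M d f X i x"
      using i by (simp add: u sum.delta)
    finally show ?case by (simp add: U_proj_eq)
  qed
qed

lemma U_stat_eq: "U_stat d f X n \<omega> = (\<Sum>A\<in>subsets_of_size n d. f (sample d A \<omega>))"
  unfolding U_stat_def sum_strict_mono_eq_sum_subsets sample_def
  by (rule sum.cong[OF refl], rule arg_cong[where f = f]) (auto simp: fun_eq_iff)

lemma sum_over_ranks:
  fixes \<phi> :: "nat \<Rightarrow> real"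
  assumes i: "i \<in> {1..d}"
  shows "(\<Sum>A\<in>subsets_of_size n d. \<phi> (enum A i)) = (\<Sum>k=1..n. real (rank_count d n i k) * \<phi> k)"
proof -
  have "(\<lambda>A. enum A i) ` subsets_of_size n d \<subseteq> {1..n}"
  proof clarify
    fix A assume A: "A \<in> subsets_of_size n d"
    note D = subsets_of_sizeD[OF A]
    have "enum A i \<in> A" using enum_in[OF D(3), of i] i D(2) by simp
    then show "enum A i \<in> {1..n}" using D(1) by blast
  qed
  then have "(\<Sum>A\<in>subsets_of_size n d. \<phi> (enum A i))
      = (\<Sum>k=1..n. \<Sum>A\<in>{A \<in> subsets_of_size n d. enum A i = k}. \<phi> (enum A i))"
    by (intro sum.group[symmetric]) auto
  also have "\<dots> = (\<Sum>k=1..n. \<Sum>A\<in>{A \<in> subsets_of_size n d. enum A i = k}. \<phi> k)"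
    by (intro sum.cong) auto
  also have "\<dots> = (\<Sum>k=1..n. real (rank_count d n i k) * \<phi> k)"
    using card_enum_eq[OF i] by (intro sum.cong) (auto simp: rank_count_def)
  finally show ?thesis .
qed

text \<open>Grouping the index sets by their \<open>i\<close>-th element turns the sum of the
  \<open>i\<close>-th projections over all sets into a weighted sum over \<open>k\<close>, so the
  linear part becomes a sum of independent variables.\<close>

lemma U_stat_decomposition:
  "U_stat d f X n \<omega> - real (n choose d) * U_mean M d f X
     = (\<Sum>A\<in>subsets_of_size n d. hoeffding_remainder d f (sample d A \<omega>))
       + (\<Sum>k=1..n. \<Sum>i=1..d. real (rank_count d n i k) * U_proj M d f X i (X k \<omega>))"
proof -
  have "(\<Sum>A\<in>subsets_of_size n d. hoeffding_remainder d f (sample d A \<omega>))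
      = U_stat d f X n \<omega> - real (n choose d) * U_mean M d f X
        - (\<Sum>A\<in>subsets_of_size n d. \<Sum>i=1..d. U_proj M d f X i (X (enum A i) \<omega>))"
  proof -
    have "(\<Sum>i=1..d. U_proj M d f X i (sample d A \<omega> i)) = (\<Sum>i=1..d. U_proj M d f X i (X (enum A i) \<omega>))" for A
      by (rule sum.cong) (auto simp: sample_def)
    then show ?thesis
      unfolding hoeffding_remainder_def U_stat_eq by (simp add: sum_subtractf card_subsets_of_size)
  qed
  also have "(\<Sum>A\<in>subsets_of_size n d. \<Sum>i=1..d. U_proj M d f X i (X (enum A i) \<omega>))
      = (\<Sum>i=1..d. \<Sum>k=1..n. real (rank_count d n i k) * U_proj M d f X i (X k \<omega>))"
    by (subst sum.swap, rule sum.cong[OF refl], rule sum_over_ranks)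
  also have "\<dots> = (\<Sum>k=1..n. \<Sum>i=1..d. real (rank_count d n i k) * U_proj M d f X i (X k \<omega>))"
    by (rule sum.swap)
  finally show ?thesis by simp
qed

end

section \<open>Normal laws and convergence of integrals\<close>

text \<open>A scaled standard normal variable covers the degenerate case and the case with a density
  at once, so characteristic function and moments need no further case distinction.\<close>

lemma normal_law_eq_distr:
  assumes "v \<ge> 0"
  shows "normal_law 0 v = distr std_normal_distribution borel (\<lambda>x. sqrt v * x)"
proof -
  interpret D: prob_space std_normal_distribution by (rule prob_space_normal_density) simp
  show ?thesis
  proof (cases "v = 0")
    case True
    then show ?thesis by (simp add: normal_law_def)
  next
    case False
    have "distributed std_normal_distribution lborel (\<lambda>x. x) (normal_density 0 1)"
      by (simp add: distributed_def distr_id2 normal_density_nonneg)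
    from D.normal_density_affine[OF this, of "sqrt v" 0] False assms
    have "distributed std_normal_distribution lborel (\<lambda>x. sqrt v * x) (normal_density 0 (sqrt v))" by simp
    then have "distr std_normal_distribution lborel (\<lambda>x. sqrt v * x) = density lborel (normal_density 0 (sqrt v))"
      by (simp add: distributed_def)
    moreover have "distr std_normal_distribution lborel (\<lambda>x. sqrt v * x) = distr std_normal_distribution borel (\<lambda>x. sqrt v * x)"
      by (rule distr_cong) auto
    ultimately show ?thesis using False by (simp add: normal_law_def)
  qed
qed

lemma real_distribution_normal_law:
  assumes "v \<ge> 0" shows "real_distribution (normal_law 0 v)"
proof -
  interpret D: prob_space std_normal_distribution by (rule prob_space_normal_density) simp
  show ?thesis unfolding normal_law_eq_distr[OF assms] by (rule D.real_distribution_distr) simp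
qed

lemma char_normal_law:
  assumes "v \<ge> 0" shows "char (normal_law 0 v) t = of_real (exp (- (t\<^sup>2 * v / 2)))"
proof -
  have "char (normal_law 0 v) t = char std_normal_distribution (t * sqrt v)"
    unfolding normal_law_eq_distr[OF assms] char_def by (simp add: integral_distr mult_ac)
  also have "\<dots> = of_real (exp (- (t\<^sup>2 * v / 2)))"
    unfolding char_std_normal_distribution using assms by (simp add: power_mult_distrib)
  finally show ?thesis .
qed

lemma integrable_normal_law_powr:
  assumes "v \<ge> 0" "p \<ge> 0" shows "integrable (normal_law 0 v) (\<lambda>x. \<bar>x\<bar> powr p)"
proof -
  interpret D: prob_space std_normal_distribution by (rule prob_space_normal_density) simp
  \<comment> \<open>The exponent \<open>2 * m\<close> is even and at least \<open>p\<close>.\<close>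
  define m where "m = nat \<lceil>p\<rceil>"
  have "integrable std_normal_distribution (\<lambda>x. \<bar>x\<bar> powr real (2 * m))"
  proof (rule Bochner_Integration.integrable_bound)
    show "integrable std_normal_distribution (\<lambda>x. 1 + x ^ (2 * m))"
      using std_normal_distribution_even_moments(2)[of m] by simp
    show "AE x in std_normal_distribution. norm (\<bar>x\<bar> powr real (2 * m)) \<le> norm (1 + x ^ (2 * m))"
    proof (rule AE_I2)
      fix x :: real
      have "\<bar>x\<bar> powr real (2 * m) \<le> 1 + \<bar>x\<bar> ^ (2 * m)"
        by (cases "x = 0") (auto simp: powr_realpow simp del: of_nat_mult)
      then show "norm (\<bar>x\<bar> powr real (2 * m)) \<le> norm (1 + x ^ (2 * m))" by (simp add: power_even_abs)
    qed
  qed simp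
  then have "integrable std_normal_distribution (\<lambda>x. \<bar>x\<bar> powr p)"
    by (rule D.integrable_powr_mono[rotated]) (use assms in \<open>auto simp: m_def, linarith\<close>)
  then show ?thesis
    unfolding normal_law_eq_distr[OF assms(1)] by (simp add: integrable_distr_eq abs_mult powr_mult)
qed

section \<open>Convergence of integrals under uniform integrability\<close>

lemma tail_tendsto_0:
  fixes g :: "'a \<Rightarrow> real"
  assumes [measurable]: "g \<in> borel_measurable M" and int: "integrable M (\<lambda>x. \<bar>g x\<bar> powr p)"
  shows "(\<lambda>n. \<integral>x. \<bar>g x\<bar> powr p * indicator {real n<..} \<bar>g x\<bar> \<partial>M) \<longlonglongrightarrow> 0"
proof -
  have "(\<lambda>n. \<bar>g x\<bar> powr p * indicator {real n<..} \<bar>g x\<bar>) \<longlonglongrightarrow> 0" for x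
  proof (rule tendsto_eventually)
    show "\<forall>\<^sub>F n in sequentially. \<bar>g x\<bar> powr p * indicator {real n<..} \<bar>g x\<bar> = 0"
      using eventually_ge_at_top[of "nat \<lceil>\<bar>g x\<bar>\<rceil>"]
      by eventually_elim (simp add: indicator_def not_less nat_ceiling_le_eq)
  qed
  then have "(\<lambda>n. \<integral>x. \<bar>g x\<bar> powr p * indicator {real n<..} \<bar>g x\<bar> \<partial>M) \<longlonglongrightarrow> (\<integral>x. 0 \<partial>M)"
    using int by (intro integral_dominated_convergence[where w = "\<lambda>x. \<bar>g x\<bar> powr p"])
      (auto simp: indicator_def)
  then show ?thesis by simp
qed

text \<open>Replace \<open>g\<close> by a bounded continuous function that agrees with it on
  [-L, L]. Weak convergence handles that function, and the tails of |V_n|^p and of the limit law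
  bound the replacement errors uniformly in \<open>n\<close>.\<close>

lemma (in prob_space) weak_conv_integral_tendsto:
  fixes V :: "nat \<Rightarrow> 'a \<Rightarrow> real" and g :: "real \<Rightarrow> real"
  assumes V[measurable]: "\<And>n. V n \<in> borel_measurable M"
    and conv: "weak_conv_m (\<lambda>n. distr M borel (V n)) \<nu>" and \<nu>: "real_distribution \<nu>"
    and p: "p > 0" and int: "\<And>n. integrable M (\<lambda>\<omega>. \<bar>V n \<omega>\<bar> powr p)"
    and ui: "\<And>\<epsilon>. \<epsilon> > 0 \<Longrightarrow> \<exists>L. \<forall>n. expectation (\<lambda>\<omega>. \<bar>V n \<omega>\<bar> powr p * indicator {L<..} \<bar>V n \<omega>\<bar>) \<le> \<epsilon>"
    and \<nu>int: "integrable \<nu> (\<lambda>x. \<bar>x\<bar> powr p)"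
    and g: "\<And>x. isCont g x" and gb: "\<And>x. \<bar>g x\<bar> \<le> 1 + \<bar>x\<bar> powr p"
  shows "integrable M (\<lambda>\<omega>. g (V n \<omega>))"
    and "(\<lambda>n. expectation (\<lambda>\<omega>. g (V n \<omega>))) \<longlonglongrightarrow> integral\<^sup>L \<nu> g"
proof -
  interpret \<nu>: real_distribution \<nu> by fact
  have gm[measurable]: "g \<in> borel_measurable borel"
    using g by (intro borel_measurable_continuous_onI continuous_at_imp_continuous_on) auto
  have gV: "integrable M (\<lambda>\<omega>. g (V n \<omega>))" for n
    by (rule Bochner_Integration.integrable_bound[where f = "\<lambda>\<omega>. 1 + \<bar>V n \<omega>\<bar> powr p"])
      (use int gb in auto)
  then show "integrable M (\<lambda>\<omega>. g (V n \<omega>))" .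
  have g\<nu>: "integrable \<nu> g"
    by (rule Bochner_Integration.integrable_bound[where f = "\<lambda>x. 1 + \<bar>x\<bar> powr p"])
      (use \<nu>int gb in auto)
  \<comment> \<open>Clipping the argument, rather than multiplying by an indicator, keeps the
    function continuous.\<close>
  define cl where "cl L x = max (- L) (min L x)" for L x :: real
  have clm[measurable]: "cl L \<in> borel_measurable borel" for L unfolding cl_def by measurable
  have clb: "\<bar>g (cl L x)\<bar> \<le> 1 + L powr p" if "L \<ge> 1" for L x
  proof -
    have "\<bar>cl L x\<bar> powr p \<le> L powr p" using that p by (intro powr_mono2) (auto simp: cl_def)
    then show ?thesis using gb[of "cl L x"] by linarith
  qed
  \<comment> \<open>Outside [-L, L] both values are at most 1 + |x|^p, hence at most 2 |x|^p since
    \<open>L\<close> is at least 1; together this makes the 4. The separate threshold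
    \<open>L'\<close> lets tail bounds with different thresholds serve one common
    \<open>L\<close>.\<close>
  have err: "\<bar>g x - g (cl L x)\<bar> \<le> 4 * (\<bar>x\<bar> powr p * indicator {L'<..} \<bar>x\<bar>)" if L: "L \<ge> 1" "L' \<le> L" for L L' x
  proof (cases "\<bar>x\<bar> \<le> L")
    case True
    then have "cl L x = x" by (auto simp: cl_def)
    then show ?thesis by simp
  next
    case False
    have "1 \<le> L powr p" using L p by (intro ge_one_powr_ge_zero) auto
    moreover have "L powr p \<le> \<bar>x\<bar> powr p" using L p False by (intro powr_mono2) auto
    ultimately have "\<bar>g x - g (cl L x)\<bar> \<le> 4 * \<bar>x\<bar> powr p"
      using gb[of x] clb[OF L(1), of x] by linarith
    then show ?thesis using False L by simp
  qed
  show "(\<lambda>n. expectation (\<lambda>\<omega>. g (V n \<omega>))) \<longlonglongrightarrow> integral\<^sup>L \<nu> g"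
  proof (rule LIMSEQ_I)
    fix r :: real assume r: "r > 0"
    \<comment> \<open>With the factor 4 of \<open>err\<close>, a tail of r/16 gives an error of r/4.
      Three such errors, one of them strict, stay below \<open>r\<close>.\<close>
    obtain L1 where L1: "\<And>n. expectation (\<lambda>\<omega>. \<bar>V n \<omega>\<bar> powr p * indicator {L1<..} \<bar>V n \<omega>\<bar>) \<le> r / 16"
      using ui[of "r / 16"] r by auto
    have "\<forall>\<^sub>F n in sequentially. (\<integral>x. \<bar>x\<bar> powr p * indicator {real n<..} \<bar>x\<bar> \<partial>\<nu>) < r / 16"
      using order_tendstoD(2)[OF tail_tendsto_0[of "\<lambda>x. x" \<nu> p], of "r / 16"] \<nu>int r by simp
    then obtain n2 where L2: "(\<integral>x. \<bar>x\<bar> powr p * indicator {real n2<..} \<bar>x\<bar> \<partial>\<nu>) < r / 16"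
      unfolding eventually_sequentially by blast
    define L where "L = max 1 (max L1 (real n2))"
    have L: "L \<ge> 1" "L1 \<le> L" "real n2 \<le> L" by (auto simp: L_def)
    have glV: "integrable M (\<lambda>\<omega>. g (cl L (V n \<omega>)))" for n
      by (rule integrable_const_bound[where B = "1 + L powr p"]) (use clb[OF L(1)] in auto)
    have gl\<nu>: "integrable \<nu> (\<lambda>x. g (cl L x))"
      by (rule \<nu>.integrable_const_bound[where B = "1 + L powr p"]) (use clb[OF L(1)] in auto)
    have eV: "\<bar>expectation (\<lambda>\<omega>. g (V n \<omega>)) - expectation (\<lambda>\<omega>. g (cl L (V n \<omega>)))\<bar> \<le> r / 4" for n
    proof -
      have "\<bar>expectation (\<lambda>\<omega>. g (V n \<omega>)) - expectation (\<lambda>\<omega>. g (cl L (V n \<omega>)))\<bar>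
          = \<bar>expectation (\<lambda>\<omega>. g (V n \<omega>) - g (cl L (V n \<omega>)))\<bar>"
        using gV glV by simp
      also have "\<dots> \<le> expectation (\<lambda>\<omega>. \<bar>g (V n \<omega>) - g (cl L (V n \<omega>))\<bar>)" by (rule integral_abs_bound)
      also have "\<dots> \<le> expectation (\<lambda>\<omega>. 4 * (\<bar>V n \<omega>\<bar> powr p * indicator {L1<..} \<bar>V n \<omega>\<bar>))"
      proof (rule integral_mono)
        show "integrable M (\<lambda>\<omega>. 4 * (\<bar>V n \<omega>\<bar> powr p * indicator {L1<..} \<bar>V n \<omega>\<bar>))"
          by (rule integrable_mult_right, rule Bochner_Integration.integrable_bound[OF int[of n]])
            (auto simp: indicator_def)
      qed (use gV glV err[OF L(1,2)] in auto)
      also have "\<dots> \<le> 4 * (r / 16)" using L1[of n] by simp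
      finally show ?thesis by simp
    qed
    have e\<nu>: "\<bar>integral\<^sup>L \<nu> g - (\<integral>x. g (cl L x) \<partial>\<nu>)\<bar> \<le> r / 4"
    proof -
      have "\<bar>integral\<^sup>L \<nu> g - (\<integral>x. g (cl L x) \<partial>\<nu>)\<bar> = \<bar>\<integral>x. g x - g (cl L x) \<partial>\<nu>\<bar>"
        using g\<nu> gl\<nu> by simp
      also have "\<dots> \<le> (\<integral>x. \<bar>g x - g (cl L x)\<bar> \<partial>\<nu>)" by (rule integral_abs_bound)
      also have "\<dots> \<le> (\<integral>x. 4 * (\<bar>x\<bar> powr p * indicator {real n2<..} \<bar>x\<bar>) \<partial>\<nu>)"
      proof (rule integral_mono)
        show "integrable \<nu> (\<lambda>x. 4 * (\<bar>x\<bar> powr p * indicator {real n2<..} \<bar>x\<bar>))"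
          by (rule integrable_mult_right, rule Bochner_Integration.integrable_bound[OF \<nu>int])
            (auto simp: indicator_def)
      qed (use g\<nu> gl\<nu> err[OF L(1,3)] in auto)
      also have "\<dots> \<le> 4 * (r / 16)" using L2 by simp
      finally show ?thesis by simp
    qed
    have "(\<lambda>n. \<integral>x. g (cl L x) \<partial>distr M borel (V n)) \<longlonglongrightarrow> (\<integral>x. g (cl L x) \<partial>\<nu>)"
    proof (rule weak_conv_imp_integral_bdd_continuous_conv[OF _ \<nu> conv])
      show "real_distribution (distr M borel (V n))" for n by (rule real_distribution_distr[OF V])
      show "isCont (\<lambda>x. g (cl L x)) x" for x
        unfolding cl_def by (intro isCont_o2[OF _ g] continuous_intros)
      show "norm (g (cl L x)) \<le> 1 + L powr p" for x using clb[OF L(1)] by simp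
    qed
    then have "(\<lambda>n. expectation (\<lambda>\<omega>. g (cl L (V n \<omega>)))) \<longlonglongrightarrow> (\<integral>x. g (cl L x) \<partial>\<nu>)"
      by (simp add: integral_distr)
    then obtain n0 where n0: "\<And>n. n \<ge> n0 \<Longrightarrow> \<bar>expectation (\<lambda>\<omega>. g (cl L (V n \<omega>))) - (\<integral>x. g (cl L x) \<partial>\<nu>)\<bar> < r / 4"
      using LIMSEQ_D[of _ _ "r / 4"] r by fastforce
    show "\<exists>n0. \<forall>n\<ge>n0. norm (expectation (\<lambda>\<omega>. g (V n \<omega>)) - integral\<^sup>L \<nu> g) < r"
    proof (intro exI allI impI)
      fix n assume "n \<ge> n0"
      from n0[OF this] eV[of n] e\<nu> r
      show "norm (expectation (\<lambda>\<omega>. g (V n \<omega>)) - integral\<^sup>L \<nu> g) < r" unfolding real_norm_def by linarith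
    qed
  qed
qed

section \<open>Weak convergence\<close>

text \<open>In this order: the domination of the linear terms by a multiple of n^(-1/2), the
  normalization of their variance, and the factor 1/n that makes the remainder negligible.\<close>

lemma U_stat_scale:
  assumes "d \<ge> 1" "n \<ge> 1"
  shows "real n ^ (d - 1) / real n powr (real d - 1 / 2) = 1 / sqrt (real n)"
    and "(real n powr (real d - 1 / 2))\<^sup>2 = real n ^ (2 * d - 1)"
    and "real n ^ (2 * d - 2) / (real n powr (real d - 1 / 2))\<^sup>2 = 1 / real n"
proof -
  have n: "real n > 0" using assms by simp
  have "real n ^ (d - 1) = real n powr (real d - 1)"
    using n assms by (simp add: powr_realpow[symmetric] of_nat_diff)
  then show "real n ^ (d - 1) / real n powr (real d - 1 / 2) = 1 / sqrt (real n)"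
    using n by (simp add: powr_diff[symmetric] powr_half_sqrt[symmetric] powr_minus_divide[symmetric])
  have "(real n powr (real d - 1 / 2))\<^sup>2 = real n powr (real (2 * d - 1))"
    using assms by (simp add: powr_power of_nat_diff algebra_simps)
  then show *: "(real n powr (real d - 1 / 2))\<^sup>2 = real n ^ (2 * d - 1)"
    using n by (simp only: powr_realpow)
  have "2 * d - 1 = Suc (2 * d - 2)" using assms by simp
  then show "real n ^ (2 * d - 2) / (real n powr (real d - 1 / 2))\<^sup>2 = 1 / real n"
    unfolding * using n by simp
qed

context iid_sequence
begin

text \<open>A covariance, because the projections of a square integrable \<open>f\<close> have mean
  0 under \<open>N\<close>.\<close>

definition proj_cov :: "nat \<Rightarrow> ((nat \<Rightarrow> 's) \<Rightarrow> real) \<Rightarrow> nat \<Rightarrow> nat \<Rightarrow> real" where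
  "proj_cov d f i j = (\<integral>x. U_proj M d f X i x * U_proj M d f X j x \<partial>N)"

definition limit_var :: "nat \<Rightarrow> ((nat \<Rightarrow> 's) \<Rightarrow> real) \<Rightarrow> real" where
  "limit_var d f = (\<Sum>i=1..d. \<Sum>j=1..d.
        (fact (i + j - 2) * fact (2 * d - i - j)) /
        (fact (i - 1) * fact (j - 1) * fact (d - i) * fact (d - j) * fact (2 * d - 1)) * proj_cov d f i j)"

text \<open>The summand of X_k in the normalized linear part: entry \<open>k\<close> of row
  \<open>n\<close> of the array for the Lindeberg theorem.\<close>

definition linear_part :: "nat \<Rightarrow> ((nat \<Rightarrow> 's) \<Rightarrow> real) \<Rightarrow> nat \<Rightarrow> nat \<Rightarrow> 's \<Rightarrow> real" where
  "linear_part d f n k x = (\<Sum>i=1..d. real (rank_count d n i k) * U_proj M d f X i x) / real n powr (real d - 1 / 2)"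

lemma linear_part_var_tendsto:
  assumes d: "d \<ge> 1" and f: "f \<in> borel_measurable (PiM {1..d} (\<lambda>_. S))"
    and int: "integrable (PiM {1..d} (\<lambda>_. N)) (\<lambda>z. (f z)\<^sup>2)"
  shows "(\<lambda>n. \<Sum>k=1..n. \<integral>x. (linear_part d f n k x)\<^sup>2 \<partial>N) \<longlonglongrightarrow> limit_var d f"
proof -
  let ?\<phi> = "U_proj M d f X"
  have mN: "borel_measurable N = borel_measurable S" by (rule measurable_cong_sets) simp_all
  have i2: "integrable N (\<lambda>x. ?\<phi> i x * ?\<phi> j x)" if "i \<in> {1..d}" "j \<in> {1..d}" for i j
    using that U_proj_measurable[OF _ f] U_proj_square_integrable[OF _ f int]
    by (intro integrable_mult_square) (auto simp: mN)
  have "(\<integral>x. (linear_part d f n k x)\<^sup>2 \<partial>N)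
      = (\<Sum>i=1..d. \<Sum>j=1..d. real (rank_count d n i k) * real (rank_count d n j k) * proj_cov d f i j / real n ^ (2 * d - 1))"
    if "k \<in> {1..n}" for n k
  proof -
    have "(linear_part d f n k x)\<^sup>2 = (\<Sum>i=1..d. \<Sum>j=1..d. (real (rank_count d n i k) * real (rank_count d n j k) / real n ^ (2 * d - 1)) * (?\<phi> i x * ?\<phi> j x))" for x
      using that U_stat_scale(2)[OF d, of n]
      by (simp add: linear_part_def power_divide) (simp add: power2_eq_square sum_product sum_divide_distrib mult_ac)
    then have "(\<integral>x. (linear_part d f n k x)\<^sup>2 \<partial>N)
      = (\<integral>x. (\<Sum>i=1..d. \<Sum>j=1..d. (real (rank_count d n i k) * real (rank_count d n j k) / real n ^ (2 * d - 1)) * (?\<phi> i x * ?\<phi> j x)) \<partial>N)"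
      by (simp only:)
    also have "\<dots> = (\<Sum>i=1..d. \<integral>x. (\<Sum>j=1..d. (real (rank_count d n i k) * real (rank_count d n j k) / real n ^ (2 * d - 1)) * (?\<phi> i x * ?\<phi> j x)) \<partial>N)"
      by (rule Bochner_Integration.integral_sum)
        (rule Bochner_Integration.integrable_sum, rule integrable_mult_right, rule i2)
    also have "\<dots> = (\<Sum>i=1..d. \<Sum>j=1..d. \<integral>x. (real (rank_count d n i k) * real (rank_count d n j k) / real n ^ (2 * d - 1)) * (?\<phi> i x * ?\<phi> j x) \<partial>N)"
      by (rule sum.cong[OF refl], rule Bochner_Integration.integral_sum) (rule integrable_mult_right, rule i2)
    finally show ?thesis by (simp add: proj_cov_def)
  qed
  note second_moment = this
  have "(\<Sum>k=1..n. \<integral>x. (linear_part d f n k x)\<^sup>2 \<partial>N)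
      = (\<Sum>i=1..d. \<Sum>j=1..d. (\<Sum>k=1..n. real (rank_count d n i k) * real (rank_count d n j k)) / real n ^ (2 * d - 1) * proj_cov d f i j)" for n
  proof -
    let ?t = "\<lambda>i j k. real (rank_count d n i k) * real (rank_count d n j k) * proj_cov d f i j / real n ^ (2 * d - 1)"
    have "(\<Sum>k=1..n. \<integral>x. (linear_part d f n k x)\<^sup>2 \<partial>N) = (\<Sum>k=1..n. \<Sum>i=1..d. \<Sum>j=1..d. ?t i j k)"
      using second_moment by (intro sum.cong refl)
    also have "\<dots> = (\<Sum>i=1..d. \<Sum>k=1..n. \<Sum>j=1..d. ?t i j k)" by (rule sum.swap)
    also have "\<dots> = (\<Sum>i=1..d. \<Sum>j=1..d. \<Sum>k=1..n. ?t i j k)" by (rule sum.cong[OF refl], rule sum.swap)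
    also have "\<dots> = (\<Sum>i=1..d. \<Sum>j=1..d. (\<Sum>k=1..n. real (rank_count d n i k) * real (rank_count d n j k)) / real n ^ (2 * d - 1) * proj_cov d f i j)"
      by (simp add: sum_divide_distrib sum_distrib_right)
    finally show ?thesis .
  qed
  then show ?thesis
    unfolding limit_var_def by (simp only:) (intro tendsto_sum tendsto_mult_right rank_count_sum_tendsto)
qed

text \<open>Not evident from the formula; it holds because \<open>limit_var\<close> is a limit of
  sums of second moments.\<close>

lemma limit_var_nonneg:
  assumes "d \<ge> 1" "f \<in> borel_measurable (PiM {1..d} (\<lambda>_. S))"
    and "integrable (PiM {1..d} (\<lambda>_. N)) (\<lambda>z. (f z)\<^sup>2)"
  shows "limit_var d f \<ge> 0"
  by (rule LIMSEQ_le_const[OF linear_part_var_tendsto[OF assms]]) (auto intro!: sum_nonneg)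

definition norm_U_stat :: "nat \<Rightarrow> ((nat \<Rightarrow> 's) \<Rightarrow> real) \<Rightarrow> nat \<Rightarrow> 'a \<Rightarrow> real" where
  "norm_U_stat d f n \<omega> = (U_stat d f X n \<omega> - real (n choose d) * U_mean M d f X) / real n powr (real d - 1 / 2)"

lemma sum_samples_measurable:
  fixes h :: "(nat \<Rightarrow> 's) \<Rightarrow> real"
  assumes "h \<in> borel_measurable (PiM {1..d} (\<lambda>_. S))"
  shows "(\<lambda>\<omega>. \<Sum>A\<in>subsets_of_size n d. h (sample d A \<omega>)) \<in> borel_measurable M"
  by (intro borel_measurable_sum sample_comp_measurable assms)

lemma norm_U_stat_measurable:
  assumes "f \<in> borel_measurable (PiM {1..d} (\<lambda>_. S))"
  shows "norm_U_stat d f n \<in> borel_measurable M"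
  unfolding norm_U_stat_def U_stat_eq using sum_samples_measurable[OF assms] by measurable

text \<open>The linear part \<open>T\<close> obeys the Lindeberg theorem. The rest is R / n^(d-1/2),
  whose L^1 norm is at most its L^2 norm and hence of order n^(-1/2).\<close>

lemma char_norm_U_stat_tendsto:
  assumes d: "d \<ge> 1" and f: "f \<in> borel_measurable (PiM {1..d} (\<lambda>_. S))"
    and int: "integrable (PiM {1..d} (\<lambda>_. N)) (\<lambda>z. (f z)\<^sup>2)"
  shows "(\<lambda>n. char (distr M borel (norm_U_stat d f n)) t) \<longlonglongrightarrow> of_real (exp (- (t\<^sup>2 * limit_var d f / 2)))"
proof -
  let ?\<phi> = "U_proj M d f X" and ?h = "hoeffding_remainder d f"
  define sc where "sc n = real n powr (real d - 1 / 2)" for n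
  define T where "T n \<omega> = (\<Sum>k=1..n. linear_part d f n k (X k \<omega>))" for n \<omega>
  define R where "R n \<omega> = (\<Sum>A\<in>subsets_of_size n d. ?h (sample d A \<omega>))" for n \<omega>
  define c where "c = (\<integral>z. (?h z)\<^sup>2 \<partial>PiM {1..d} (\<lambda>_. N))"
  have mN: "borel_measurable N = borel_measurable S" by (rule measurable_cong_sets) simp_all
  have \<phi>[measurable]: "i \<in> {1..d} \<Longrightarrow> ?\<phi> i \<in> borel_measurable S" for i by (rule U_proj_measurable[OF _ f])
  have lm: "linear_part d f n k \<in> borel_measurable S" for n k
    unfolding linear_part_def by (intro borel_measurable_divide borel_measurable_sum borel_measurable_times \<phi>) auto
  have T: "(\<lambda>n. char (distr M borel (T n)) t) \<longlonglongrightarrow> of_real (exp (- (t\<^sup>2 * limit_var d f / 2)))"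
    unfolding T_def
  \<comment> \<open>All weights are at most n^(d-1), so the sum of the absolute projections
    dominates every entry of the array after scaling.\<close>
  proof (rule char_dominated_array_tendsto[where G = "\<lambda>x. \<Sum>i=1..d. \<bar>?\<phi> i x\<bar>"])
    show "(\<lambda>x. \<Sum>i=1..d. \<bar>?\<phi> i x\<bar>) \<in> borel_measurable S"
      by (intro borel_measurable_sum borel_measurable_abs \<phi>)
    show "integrable N (\<lambda>x. (\<Sum>i=1..d. \<bar>?\<phi> i x\<bar>)\<^sup>2)"
      by (rule integrable_square_sum) (use U_proj_square_integrable[OF _ f int] \<phi> in \<open>auto simp: mN\<close>)
    show "\<bar>linear_part d f n k x\<bar> \<le> (\<Sum>i=1..d. \<bar>?\<phi> i x\<bar>) / sqrt (real n)" if "k \<in> {1..n}" for n k x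
    proof -
      have "\<bar>\<Sum>i=1..d. real (rank_count d n i k) * ?\<phi> i x\<bar> \<le> (\<Sum>i=1..d. real n ^ (d - 1) * \<bar>?\<phi> i x\<bar>)"
        by (rule order_trans[OF sum_abs sum_mono])
          (use rank_count_le that in \<open>auto simp: abs_mult intro!: mult_right_mono\<close>)
      then have "\<bar>linear_part d f n k x\<bar> \<le> (real n ^ (d - 1) * (\<Sum>i=1..d. \<bar>?\<phi> i x\<bar>)) / sc n"
        unfolding linear_part_def sc_def abs_divide by (simp add: sum_distrib_left divide_right_mono)
      also have "\<dots> = real n ^ (d - 1) / sc n * (\<Sum>i=1..d. \<bar>?\<phi> i x\<bar>)" by simp
      also have "real n ^ (d - 1) / sc n = 1 / sqrt (real n)"
        unfolding sc_def using that d by (intro U_stat_scale) auto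
      finally show ?thesis by simp
    qed
    show "integral\<^sup>L N (linear_part d f n k) = 0" for n k
    proof -
      have "(\<integral>x. (\<Sum>i=1..d. real (rank_count d n i k) * ?\<phi> i x) \<partial>N) = (\<Sum>i=1..d. \<integral>x. real (rank_count d n i k) * ?\<phi> i x \<partial>N)"
        by (rule Bochner_Integration.integral_sum) (intro integrable_mult_right U_proj_integrable f int)
      also have "\<dots> = 0"
        by (intro sum.neutral ballI) (simp add: integral_U_proj[OF _ f int])
      finally show ?thesis unfolding linear_part_def by simp
    qed
    show "(\<lambda>n. \<Sum>k=1..n. \<integral>x. (linear_part d f n k x)\<^sup>2 \<partial>N) \<longlonglongrightarrow> limit_var d f"
      by (rule linear_part_var_tendsto[OF d f int])
  qed (rule lm)
  have Tm: "T n \<in> borel_measurable M" for n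
    unfolding T_def by (intro borel_measurable_sum measurable_compose[OF X_measurable lm]) auto
  have hm: "?h \<in> borel_measurable (PiM {1..d} (\<lambda>_. S))" by (rule hoeffding_remainder_measurable[OF f int])
  have h2: "integrable (PiM {1..d} (\<lambda>_. N)) (\<lambda>z. (?h z)\<^sup>2)" by (rule hoeffding_remainder_square_integrable[OF f int])
  have h2m: "(\<lambda>z. (?h z)\<^sup>2) \<in> borel_measurable (PiM {1..d} (\<lambda>_. S))" using hm by measurable
  have Rm: "R n \<in> borel_measurable M" for n unfolding R_def by (rule sum_samples_measurable[OF hm])
  have R2: "integrable M (\<lambda>\<omega>. (R n \<omega>)\<^sup>2)" for n
    unfolding R_def using integrable_sample_iff[OF _ h2m] h2
    by (intro integrable_square_sum sample_comp_measurable[OF _ hm]) auto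
  have V: "norm_U_stat d f n \<omega> = R n \<omega> / sc n + T n \<omega>" for n \<omega>
    unfolding norm_U_stat_def U_stat_decomposition R_def T_def linear_part_def sc_def
    by (simp add: add_divide_distrib sum_divide_distrib)
  have Rint: "integrable M (\<lambda>\<omega>. norm_U_stat d f n \<omega> - T n \<omega>)" for n
    unfolding V using square_integrable_imp_integrable[OF Rm R2] by simp
  have Rb: "expectation (\<lambda>\<omega>. \<bar>norm_U_stat d f n \<omega> - T n \<omega>\<bar>) \<le> sqrt (c / real n)" if "n \<ge> 1" for n
  proof (rule real_le_rsqrt)
    have "(expectation (\<lambda>\<omega>. \<bar>norm_U_stat d f n \<omega> - T n \<omega>\<bar>))\<^sup>2 \<le> expectation (\<lambda>\<omega>. \<bar>norm_U_stat d f n \<omega> - T n \<omega>\<bar>\<^sup>2)"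
      unfolding V using Rm R2 by (intro square_expectation_le) (auto simp: power_divide)
    also have "\<dots> = expectation (\<lambda>\<omega>. (R n \<omega>)\<^sup>2) / (sc n)\<^sup>2" unfolding V by (simp add: power_divide)
    also have "\<dots> \<le> (real n ^ (2 * d - 2) * c) / (sc n)\<^sup>2"
      unfolding R_def c_def
      by (intro divide_right_mono second_moment_subset_sum_le d hm h2 hoeffding_remainder_section f int) auto
    also have "\<dots> = real n ^ (2 * d - 2) / (sc n)\<^sup>2 * c" by simp
    also have "real n ^ (2 * d - 2) / (sc n)\<^sup>2 = 1 / real n"
      unfolding sc_def by (rule U_stat_scale[OF d that])
    finally show "(expectation (\<lambda>\<omega>. \<bar>norm_U_stat d f n \<omega> - T n \<omega>\<bar>))\<^sup>2 \<le> c / real n" by simp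
  qed
  have "(\<lambda>n. char (distr M borel (norm_U_stat d f n)) t - char (distr M borel (T n)) t) \<longlonglongrightarrow> 0"
  proof (rule Lim_null_comparison)
    show "\<forall>\<^sub>F n in sequentially. norm (char (distr M borel (norm_U_stat d f n)) t - char (distr M borel (T n)) t) \<le> \<bar>t\<bar> * sqrt (c / real n)"
      using eventually_ge_at_top[of 1]
    proof eventually_elim
      case (elim n)
      show ?case
        by (rule order_trans[OF char_distr_diff_le[OF norm_U_stat_measurable[OF f] Tm Rint]])
          (intro mult_left_mono Rb elim, simp)
    qed
    have "(\<lambda>n. sqrt (c / real n)) \<longlonglongrightarrow> 0"
      using tendsto_real_sqrt[OF lim_const_over_n[of c]] by simp
    then show "(\<lambda>n. \<bar>t\<bar> * sqrt (c / real n)) \<longlonglongrightarrow> 0" by (rule tendsto_mult_right_zero)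
  qed
  from tendsto_add[OF this T] show ?thesis by (simp only: diff_add_cancel add_0)
qed

lemma weak_conv_norm_U_stat:
  assumes "d \<ge> 1" "f \<in> borel_measurable (PiM {1..d} (\<lambda>_. S))"
    and "integrable (PiM {1..d} (\<lambda>_. N)) (\<lambda>z. (f z)\<^sup>2)"
  shows "weak_conv_m (\<lambda>n. distr M borel (norm_U_stat d f n)) (normal_law 0 (limit_var d f))"
proof (rule levy_continuity)
  show "real_distribution (distr M borel (norm_U_stat d f n))" for n
    by (rule real_distribution_distr[OF norm_U_stat_measurable[OF assms(2)]])
  note v = limit_var_nonneg[OF assms]
  show "real_distribution (normal_law 0 (limit_var d f))" by (rule real_distribution_normal_law[OF v])
  show "(\<lambda>n. char (distr M borel (norm_U_stat d f n)) t) \<longlonglongrightarrow> char (normal_law 0 (limit_var d f)) t" for t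
    unfolding char_normal_law[OF v] by (rule char_norm_U_stat_tendsto[OF assms])
qed

section \<open>Moment bounds for normalized sums\<close>

lemma moment_normalized_sum_le:
  fixes h :: "(nat \<Rightarrow> 's) \<Rightarrow> real"
  assumes d: "d \<ge> 1" and h: "h \<in> borel_measurable (PiM {1..d} (\<lambda>_. S))" and q: "q \<ge> 2" and B: "B > 0"
    and int: "integrable (PiM {1..d} (\<lambda>_. N)) (\<lambda>x. \<bar>h x\<bar> powr q)"
    and bound: "(\<integral>x. \<bar>h x\<bar> powr q \<partial>PiM {1..d} (\<lambda>_. N)) \<le> B powr q"
    and mean: "integral\<^sup>L (PiM {1..d} (\<lambda>_. N)) h = 0"
  defines "W \<equiv> \<lambda>n \<omega>. (\<Sum>A\<in>subsets_of_size n d. h (sample d A \<omega>)) / real n powr (real d - 1 / 2)"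
  shows "integrable M (\<lambda>\<omega>. \<bar>W n \<omega>\<bar> powr q)"
    and "expectation (\<lambda>\<omega>. \<bar>W n \<omega>\<bar> powr q) \<le> moment_const q * (2 * real d) powr (q / 2) * B powr q"
proof -
  have hq: "(\<lambda>x. \<bar>h x\<bar> powr q) \<in> borel_measurable (PiM {1..d} (\<lambda>_. S))" using h by measurable
  have W: "\<bar>W n \<omega>\<bar> powr q = \<bar>\<Sum>A\<in>subsets_of_size n d. h (sample d A \<omega>)\<bar> powr q / (real n powr (real d - 1 / 2)) powr q" for \<omega>
    by (simp add: W_def powr_divide)
  have "integrable M (\<lambda>\<omega>. \<bar>\<Sum>A\<in>subsets_of_size n d. h (sample d A \<omega>)\<bar> powr q)"
    using q integrable_sample_iff[OF _ hq] int sample_comp_measurable[OF _ h]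
    by (intro integrable_powr_sum) auto
  then show "integrable M (\<lambda>\<omega>. \<bar>W n \<omega>\<bar> powr q)" unfolding W by (rule integrable_divide)
  show "expectation (\<lambda>\<omega>. \<bar>W n \<omega>\<bar> powr q) \<le> moment_const q * (2 * real d) powr (q / 2) * B powr q"
  proof (cases "n = 0")
    \<comment> \<open>Here the denominator is 0, and \<open>W\<close> vanishes by the convention for
      division by 0.\<close>
    case True
    then show ?thesis by (simp add: W_def moment_const_def)
  next
    case False
    then have "(real n powr (real d - 1 / 2)) powr q > 0" by simp
    then show ?thesis
      unfolding W integral_divide_zero
      using moment_subset_sum_le[OF d h q B int bound mean, of n] by (simp add: field_simps)
  qed
qed

end

section \<open>Uniform integrability\<close>

lemma (in prob_space) expectation_centred:
  fixes g :: "'a \<Rightarrow> real"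
  shows "integrable M g \<Longrightarrow> expectation (\<lambda>x. g x - expectation g) = 0"
  by (simp add: prob_space)

text \<open>The p-th moment of the tail and its mean both tend to 0 by dominated convergence, and
  recentring costs no more than a factor 2^p. The tail of a truncation needs recentring before the
  moment bound for sums applies to it.\<close>

lemma (in prob_space) centred_tail_moment_tendsto_0:
  fixes g :: "'a \<Rightarrow> real"
  assumes g[measurable]: "g \<in> borel_measurable M" and int: "integrable M (\<lambda>x. \<bar>g x\<bar> powr p)" and p: "p \<ge> 1"
  defines "r \<equiv> \<lambda>K x. g x * indicator {real K<..} \<bar>g x\<bar>"
  shows "(\<lambda>K. expectation (\<lambda>x. \<bar>r K x - expectation (r K)\<bar> powr p)) \<longlonglongrightarrow> 0"
proof -
  have rm[measurable]: "r K \<in> borel_measurable M" for K unfolding r_def by measurable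
  have rp: "\<bar>r K x\<bar> powr q = \<bar>g x\<bar> powr q * indicator {real K<..} \<bar>g x\<bar>" for K x q
    by (simp add: r_def indicator_def)
  have ri: "integrable M (\<lambda>x. \<bar>r K x\<bar> powr q)" if "0 \<le> q" "q \<le> p" for K q
    by (rule Bochner_Integration.integrable_bound[OF integrable_powr_mono[OF g int that]])
      (auto simp: rp indicator_def)
  have i1: "integrable M (\<lambda>x. \<bar>g x\<bar> powr 1)" using integrable_powr_mono[OF g int, of 1] p by simp
  have tp: "(\<lambda>K. expectation (\<lambda>x. \<bar>r K x\<bar> powr p)) \<longlonglongrightarrow> 0"
    unfolding rp by (rule tail_tendsto_0[OF g int])
  have t1: "(\<lambda>K. expectation (\<lambda>x. \<bar>r K x\<bar> powr 1)) \<longlonglongrightarrow> 0"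
    unfolding rp by (rule tail_tendsto_0[OF g i1])
  have "(\<lambda>K. expectation (r K)) \<longlonglongrightarrow> 0"
    by (rule Lim_null_comparison[OF _ t1]) (auto intro!: always_eventually)
  then have "(\<lambda>K. \<bar>expectation (r K)\<bar>) \<longlonglongrightarrow> 0" by (rule tendsto_rabs_zero)
  then have "(\<lambda>K. \<bar>expectation (r K)\<bar> powr p) \<longlonglongrightarrow> 0 powr p"
    by (rule tendsto_powr'[OF _ tendsto_const]) (use p in auto)
  from tendsto_add[OF tp this]
  have lim: "(\<lambda>K. 2 powr p * (expectation (\<lambda>x. \<bar>r K x\<bar> powr p) + \<bar>expectation (r K)\<bar> powr p)) \<longlonglongrightarrow> 0"
    by (intro tendsto_mult_right_zero) simp
  show ?thesis
  proof (rule Lim_null_comparison[OF always_eventually[OF allI] lim])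
    fix K
    have "expectation (\<lambda>x. \<bar>r K x - expectation (r K)\<bar> powr p)
        \<le> expectation (\<lambda>x. 2 powr p * (\<bar>r K x\<bar> powr p + \<bar>expectation (r K)\<bar> powr p))"
    proof (rule integral_mono)
      show "integrable M (\<lambda>x. \<bar>r K x - expectation (r K)\<bar> powr p)"
        using integrable_powr_add[of "r K" M "\<lambda>_. - expectation (r K)" p] ri[of p K] p by simp
      show "integrable M (\<lambda>x. 2 powr p * (\<bar>r K x\<bar> powr p + \<bar>expectation (r K)\<bar> powr p))"
        using ri[of p K] p by simp
      show "\<bar>r K x - expectation (r K)\<bar> powr p \<le> 2 powr p * (\<bar>r K x\<bar> powr p + \<bar>expectation (r K)\<bar> powr p)" for x
        using abs_add_powr_le_two[of p "r K x" "- expectation (r K)"] p by simp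
    qed
    also have "\<dots> = 2 powr p * (expectation (\<lambda>x. \<bar>r K x\<bar> powr p) + \<bar>expectation (r K)\<bar> powr p)"
      using ri[of p K] p by (simp add: prob_space)
    finally show "norm (expectation (\<lambda>x. \<bar>r K x - expectation (r K)\<bar> powr p))
        \<le> 2 powr p * (expectation (\<lambda>x. \<bar>r K x\<bar> powr p) + \<bar>expectation (r K)\<bar> powr p)" by simp
  qed
qed

text \<open>If |a + b| exceeds 2L, the larger of |a| and |b| is at least half of |a + b| and exceeds
  L. If it is |b|, its p-th power suffices; if it is |a|, the factor (|a| / L)^p can be inserted,
  which is what the moment of order 2p is for.\<close>

lemma powr_tail_sum_le:
  fixes a b L p :: real
  assumes "p > 0" "L > 0"
  shows "\<bar>a + b\<bar> powr p * indicator {2 * L<..} \<bar>a + b\<bar>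
          \<le> 2 powr p * (L powr (- p) * \<bar>a\<bar> powr (2 * p) + \<bar>b\<bar> powr p)"
proof (cases "\<bar>a + b\<bar> > 2 * L")
  case False then show ?thesis by simp
next
  case True
  show ?thesis
  proof (cases "\<bar>a\<bar> \<le> \<bar>b\<bar>")
    case ab: True
    have "\<bar>a + b\<bar> powr p \<le> (2 * \<bar>b\<bar>) powr p" using ab assms by (intro powr_mono2) auto
    then show ?thesis using True by (simp add: powr_mult distrib_left add_increasing)
  next
    case False
    then have "L < \<bar>a\<bar>" using True by linarith
    then have "L powr p \<le> \<bar>a\<bar> powr p" using assms by (intro powr_mono2) auto
    then have "1 \<le> L powr (- p) * \<bar>a\<bar> powr p" using assms by (simp add: powr_minus field_simps)
    then have "\<bar>a\<bar> powr p * 1 \<le> \<bar>a\<bar> powr p * (L powr (- p) * \<bar>a\<bar> powr p)" by (rule mult_left_mono) simp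
    also have "\<dots> = L powr (- p) * \<bar>a\<bar> powr (2 * p)" by (simp add: powr_add[symmetric] mult_ac flip: mult_2)
    finally have 1: "\<bar>a\<bar> powr p \<le> L powr (- p) * \<bar>a\<bar> powr (2 * p)" by simp
    have "\<bar>a + b\<bar> powr p \<le> (2 * \<bar>a\<bar>) powr p" using False assms by (intro powr_mono2) auto
    also have "\<dots> = 2 powr p * \<bar>a\<bar> powr p" by (simp add: powr_mult)
    also have "\<dots> \<le> 2 powr p * (L powr (- p) * \<bar>a\<bar> powr (2 * p) + \<bar>b\<bar> powr p)"
      using 1 by (intro mult_left_mono) (auto simp: add_increasing2)
    finally show ?thesis using True by simp
  qed
qed

context iid_sequence
begin

text \<open>
  Truncate \<open>f\<close> at a level \<open>K\<close> and centre both pieces. The normalized sum of the bounded piece has bounded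
  moments of order \<open>2 p\<close>, and that of the other piece is uniformly small in \<open>L\<^sup>p\<close>.
\<close>

lemma norm_U_stat_split:
  assumes d: "d \<ge> 1" and f: "f \<in> borel_measurable (PiM {1..d} (\<lambda>_. S))" and p: "p \<ge> 2"
    and int: "integrable (PiM {1..d} (\<lambda>_. N)) (\<lambda>z. \<bar>f z\<bar> powr p)" and \<delta>: "\<delta> > 0"
  obtains a b C where "\<And>n \<omega>. norm_U_stat d f n \<omega> = a n \<omega> + b n \<omega>"
    and "\<And>n. a n \<in> borel_measurable M" "\<And>n. b n \<in> borel_measurable M"
    and "\<And>n. integrable M (\<lambda>\<omega>. \<bar>a n \<omega>\<bar> powr (2 * p))" "\<And>n. expectation (\<lambda>\<omega>. \<bar>a n \<omega>\<bar> powr (2 * p)) \<le> C"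
    and "\<And>n. integrable M (\<lambda>\<omega>. \<bar>b n \<omega>\<bar> powr p)" "\<And>n. expectation (\<lambda>\<omega>. \<bar>b n \<omega>\<bar> powr p) \<le> \<delta>"
proof -
  let ?P = "PiM {1..d} (\<lambda>_. N)"
  interpret P: prob_space ?P by (rule prob_space_PiM_N)
  have mP: "borel_measurable ?P = borel_measurable (PiM {1..d} (\<lambda>_. S))"
    by (rule measurable_cong_sets[OF sets_PiM_N refl])
  have fP[measurable]: "f \<in> borel_measurable ?P" using f by (simp only: mP)
  have fi: "integrable ?P f"
    by (rule integrable_if_powr_1[OF fP P.integrable_powr_mono[OF fP int]]) (use p in auto)
  \<comment> \<open>\<open>D\<close> is the constant of the moment bound of order \<open>p\<close>,
    and \<open>B\<close> is then chosen so that \<open>D * B powr p\<close> equals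
    \<open>\<delta>\<close>.\<close>
  define D where "D = moment_const p * (2 * real d) powr (p / 2)"
  have D: "D > 0" using d expansion_const_ge_1[of p] p by (simp add: D_def moment_const_def)
  define B where "B = (\<delta> / D) powr (1 / p)"
  have B: "B > 0" "B powr p = \<delta> / D" using \<delta> D p by (auto simp: B_def powr_powr)
  define r where "r K z = f z * indicator {real K<..} \<bar>f z\<bar>" for K :: nat and z
  have "\<forall>\<^sub>F K in sequentially. P.expectation (\<lambda>z. \<bar>r K z - P.expectation (r K)\<bar> powr p) < B powr p"
    by (rule order_tendstoD(2)[OF P.centred_tail_moment_tendsto_0[OF fP int, folded r_def]]) (use p B \<delta> D in auto)
  then obtain K where K: "P.expectation (\<lambda>z. \<bar>r K z - P.expectation (r K)\<bar> powr p) < B powr p"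
    unfolding eventually_sequentially by blast
  define \<rho> where "\<rho> z = r K z - P.expectation (r K)" for z
  define t where "t z = f z - r K z" for z
  define \<eta> where "\<eta> z = t z - P.expectation t" for z
  have rm[measurable]: "r K \<in> borel_measurable ?P" unfolding r_def by measurable
  have tm[measurable]: "t \<in> borel_measurable ?P" unfolding t_def by measurable
  have ri: "integrable ?P (r K)"
    by (rule Bochner_Integration.integrable_bound[OF fi rm]) (auto simp: r_def indicator_def)
  have ti: "integrable ?P t" unfolding t_def using fi ri by simp
  have tb: "\<bar>t z\<bar> \<le> real K" for z by (auto simp: t_def r_def indicator_def)
  have Et: "\<bar>P.expectation t\<bar> \<le> real K"
  proof -
    have "\<bar>P.expectation t\<bar> \<le> P.expectation (\<lambda>z. \<bar>t z\<bar>)" by (rule integral_abs_bound)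
    also have "\<dots> \<le> real K"
      by (rule P.integral_le_const) (use ti tb in auto)
    finally show ?thesis .
  qed
  have \<eta>m: "\<eta> \<in> borel_measurable ?P" and \<rho>m: "\<rho> \<in> borel_measurable ?P"
    unfolding \<eta>_def \<rho>_def by measurable
  have \<eta>0: "P.expectation \<eta> = 0" and \<rho>0: "P.expectation \<rho> = 0"
    unfolding \<eta>_def \<rho>_def by (rule P.expectation_centred[OF ti], rule P.expectation_centred[OF ri])
  \<comment> \<open>Both \<open>t\<close> and its mean are bounded by \<open>K\<close>, so
    |\<open>\<eta>\<close>| is at most 2K; the added 1 keeps the bound positive for
    \<open>K = 0\<close>.\<close>
  define B' where "B' = 2 * real K + 1"
  have \<eta>b: "\<bar>\<eta> z\<bar> powr (2 * p) \<le> B' powr (2 * p)" for z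
    using tb[of z] Et p unfolding \<eta>_def B'_def by (intro powr_mono2) auto
  have \<eta>i: "integrable ?P (\<lambda>z. \<bar>\<eta> z\<bar> powr (2 * p))"
    by (rule P.integrable_const_bound[where B = "B' powr (2 * p)"]) (use \<eta>b \<eta>m in auto)
  have \<eta>E: "P.expectation (\<lambda>z. \<bar>\<eta> z\<bar> powr (2 * p)) \<le> B' powr (2 * p)"
    by (rule P.integral_le_const[OF \<eta>i]) (use \<eta>b in simp)
  have \<rho>i: "integrable ?P (\<lambda>z. \<bar>\<rho> z\<bar> powr p)"
  proof -
    have "(\<lambda>z. \<bar>r K z\<bar> powr p) \<in> borel_measurable ?P" by measurable
    then have "integrable ?P (\<lambda>z. \<bar>r K z\<bar> powr p)"
      by (rule Bochner_Integration.integrable_bound[OF int]) (auto simp: r_def indicator_def)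
    then show ?thesis
      unfolding \<rho>_def diff_conv_add_uminus
      by (rule integrable_powr_add[OF rm borel_measurable_const _ P.integrable_const]) (use p in simp)
  qed
  have \<rho>E: "P.expectation (\<lambda>z. \<bar>\<rho> z\<bar> powr p) \<le> B powr p" unfolding \<rho>_def using K by simp
  have \<eta>m': "\<eta> \<in> borel_measurable (PiM {1..d} (\<lambda>_. S))" and \<rho>m': "\<rho> \<in> borel_measurable (PiM {1..d} (\<lambda>_. S))"
    using \<eta>m \<rho>m by (simp_all only: mP)
  have B': "B' > 0" by (simp add: B'_def)
  have p2: "2 * p \<ge> 2" using p by simp
  define a where "a n \<omega> = (\<Sum>A\<in>subsets_of_size n d. \<eta> (sample d A \<omega>)) / real n powr (real d - 1 / 2)" for n \<omega>
  define b where "b n \<omega> = (\<Sum>A\<in>subsets_of_size n d. \<rho> (sample d A \<omega>)) / real n powr (real d - 1 / 2)" for n \<omega>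
  show ?thesis
  proof (rule that)
    have "f z - U_mean M d f X = \<eta> z + \<rho> z" for z
    proof -
      have "U_mean M d f X = P.expectation t + P.expectation (r K)"
        unfolding U_mean_eq[OF f] t_def using fi ri by simp
      then show ?thesis by (simp add: \<eta>_def \<rho>_def t_def)
    qed
    then have "U_stat d f X n \<omega> - real (n choose d) * U_mean M d f X
       = (\<Sum>A\<in>subsets_of_size n d. \<eta> (sample d A \<omega>)) + (\<Sum>A\<in>subsets_of_size n d. \<rho> (sample d A \<omega>))" for n \<omega>
      unfolding U_stat_eq sum.distrib[symmetric] by (simp add: sum_subtractf card_subsets_of_size flip: \<open>\<And>z. f z - U_mean M d f X = \<eta> z + \<rho> z\<close>)
    then show "norm_U_stat d f n \<omega> = a n \<omega> + b n \<omega>" for n \<omega>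
      unfolding norm_U_stat_def a_def b_def by (simp add: add_divide_distrib)
    show "a n \<in> borel_measurable M" "b n \<in> borel_measurable M" for n
      unfolding a_def b_def using sum_samples_measurable[OF \<eta>m'] sum_samples_measurable[OF \<rho>m']
      by (simp_all add: borel_measurable_divide)
    show "integrable M (\<lambda>\<omega>. \<bar>a n \<omega>\<bar> powr (2 * p))" for n
      unfolding a_def by (rule moment_normalized_sum_le(1)[OF d \<eta>m' p2 B' \<eta>i \<eta>E \<eta>0])
    show "expectation (\<lambda>\<omega>. \<bar>a n \<omega>\<bar> powr (2 * p)) \<le> moment_const (2 * p) * (2 * real d) powr (2 * p / 2) * B' powr (2 * p)" for n
      unfolding a_def by (rule moment_normalized_sum_le(2)[OF d \<eta>m' p2 B' \<eta>i \<eta>E \<eta>0])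
    show "integrable M (\<lambda>\<omega>. \<bar>b n \<omega>\<bar> powr p)" for n
      unfolding b_def by (rule moment_normalized_sum_le(1)[OF d \<rho>m' p B(1) \<rho>i \<rho>E \<rho>0])
    show "expectation (\<lambda>\<omega>. \<bar>b n \<omega>\<bar> powr p) \<le> \<delta>" for n
      using moment_normalized_sum_le(2)[OF d \<rho>m' p B(1) \<rho>i \<rho>E \<rho>0, of n] D
      unfolding b_def D_def[symmetric] B(2) by simp
  qed
qed

text \<open>The order of choices matters: \<open>\<delta>\<close> depends on
  \<open>\<epsilon>\<close> only, the split and its bound \<open>C\<close> on
  \<open>\<delta>\<close>, and the threshold is taken large in terms of \<open>C\<close>. All of
  them are independent of \<open>n\<close>.\<close>

lemma
  assumes d: "d \<ge> 1" and f: "f \<in> borel_measurable (PiM {1..d} (\<lambda>_. S))" and p: "p \<ge> 2"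
    and int: "integrable (PiM {1..d} (\<lambda>_. N)) (\<lambda>z. \<bar>f z\<bar> powr p)"
  shows norm_U_stat_powr_integrable: "integrable M (\<lambda>\<omega>. \<bar>norm_U_stat d f n \<omega>\<bar> powr p)"
    and norm_U_stat_uniformly_integrable: "\<epsilon> > 0 \<Longrightarrow>
      \<exists>L. \<forall>n. expectation (\<lambda>\<omega>. \<bar>norm_U_stat d f n \<omega>\<bar> powr p * indicator {L<..} \<bar>norm_U_stat d f n \<omega>\<bar>) \<le> \<epsilon>"
proof -
  have *: "(\<forall>n. integrable M (\<lambda>\<omega>. \<bar>norm_U_stat d f n \<omega>\<bar> powr p)) \<and>
      (\<exists>L. \<forall>n. expectation (\<lambda>\<omega>. \<bar>norm_U_stat d f n \<omega>\<bar> powr p * indicator {L<..} \<bar>norm_U_stat d f n \<omega>\<bar>) \<le> \<epsilon>)"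
    if \<epsilon>: "\<epsilon> > 0" for \<epsilon>
  proof -
    \<comment> \<open>With the factor \<open>2 powr p\<close> of \<open>powr_tail_sum_le\<close>,
      the part \<open>b\<close> uses up one half of \<open>\<epsilon>\<close>; \<open>L\<close>
      below is chosen so that the part \<open>a\<close> uses up the other half.\<close>
    define \<delta> where "\<delta> = \<epsilon> / (2 * 2 powr p)"
    have \<delta>: "\<delta> > 0" using \<epsilon> by (simp add: \<delta>_def)
    obtain a b C where V: "\<And>n \<omega>. norm_U_stat d f n \<omega> = a n \<omega> + b n \<omega>"
      and m[measurable]: "\<And>n. a n \<in> borel_measurable M" "\<And>n. b n \<in> borel_measurable M"
      and ai: "\<And>n. integrable M (\<lambda>\<omega>. \<bar>a n \<omega>\<bar> powr (2 * p))" and aE: "\<And>n. expectation (\<lambda>\<omega>. \<bar>a n \<omega>\<bar> powr (2 * p)) \<le> C"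
      and bi: "\<And>n. integrable M (\<lambda>\<omega>. \<bar>b n \<omega>\<bar> powr p)" and bE: "\<And>n. expectation (\<lambda>\<omega>. \<bar>b n \<omega>\<bar> powr p) \<le> \<delta>"
      by (rule norm_U_stat_split[OF d f p int \<delta>]) (rule that; assumption)
    have Vi: "integrable M (\<lambda>\<omega>. \<bar>norm_U_stat d f n \<omega>\<bar> powr p)" for n
      unfolding V using p by (intro integrable_powr_add m bi integrable_powr_mono[OF m(1) ai]) auto
    \<comment> \<open>Raising the bound to at least 1 makes \<open>L\<close> positive.\<close>
    define C' where "C' = max C 1"
    define L where "L = (2 * 2 powr p * C' / \<epsilon>) powr (1 / p)"
    have L: "L > 0" "L powr (- p) = \<epsilon> / (2 * 2 powr p * C')"
      using \<epsilon> p by (auto simp: L_def C'_def powr_powr powr_minus)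
    have "expectation (\<lambda>\<omega>. \<bar>norm_U_stat d f n \<omega>\<bar> powr p * indicator {2 * L<..} \<bar>norm_U_stat d f n \<omega>\<bar>) \<le> \<epsilon>" for n
    proof -
      have "expectation (\<lambda>\<omega>. \<bar>norm_U_stat d f n \<omega>\<bar> powr p * indicator {2 * L<..} \<bar>norm_U_stat d f n \<omega>\<bar>)
        \<le> expectation (\<lambda>\<omega>. 2 powr p * (L powr (- p) * \<bar>a n \<omega>\<bar> powr (2 * p) + \<bar>b n \<omega>\<bar> powr p))"
      proof (rule integral_mono)
        show "integrable M (\<lambda>\<omega>. \<bar>norm_U_stat d f n \<omega>\<bar> powr p * indicator {2 * L<..} \<bar>norm_U_stat d f n \<omega>\<bar>)"
          by (rule Bochner_Integration.integrable_bound[OF Vi[of n]])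
            (use norm_U_stat_measurable[OF f, of n] in \<open>auto simp: indicator_def\<close>)
        show "integrable M (\<lambda>\<omega>. 2 powr p * (L powr (- p) * \<bar>a n \<omega>\<bar> powr (2 * p) + \<bar>b n \<omega>\<bar> powr p))"
          using ai bi by simp
        show "\<bar>norm_U_stat d f n \<omega>\<bar> powr p * indicator {2 * L<..} \<bar>norm_U_stat d f n \<omega>\<bar>
            \<le> 2 powr p * (L powr (- p) * \<bar>a n \<omega>\<bar> powr (2 * p) + \<bar>b n \<omega>\<bar> powr p)" for \<omega>
          unfolding V using p L(1) by (intro powr_tail_sum_le) auto
      qed
      also have "\<dots> = 2 powr p * (L powr (- p) * expectation (\<lambda>\<omega>. \<bar>a n \<omega>\<bar> powr (2 * p)) + expectation (\<lambda>\<omega>. \<bar>b n \<omega>\<bar> powr p))"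
        using ai bi by simp
      also have "\<dots> \<le> 2 powr p * (L powr (- p) * C' + \<delta>)"
        using aE[of n] bE[of n] by (intro mult_left_mono add_mono) (auto simp: C'_def)
      also have "\<dots> = \<epsilon>"
      proof -
        have "C' > 0" by (simp add: C'_def)
        then show ?thesis unfolding L(2) \<delta>_def by (simp add: field_simps)
      qed
      finally show ?thesis .
    qed
    then show ?thesis using Vi by blast
  qed
  \<comment> \<open>Integrability comes out of the split for any positive
    \<open>\<epsilon>\<close>.\<close>
  from *[of 1] show "integrable M (\<lambda>\<omega>. \<bar>norm_U_stat d f n \<omega>\<bar> powr p)" by simp
  show "\<epsilon> > 0 \<Longrightarrow>
      \<exists>L. \<forall>n. expectation (\<lambda>\<omega>. \<bar>norm_U_stat d f n \<omega>\<bar> powr p * indicator {L<..} \<bar>norm_U_stat d f n \<omega>\<bar>) \<le> \<epsilon>"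
    using * by blast
qed

end

theorem theorem3p15:
  fixes M :: "'a measure" and S :: "'s measure"
    and X :: "nat \<Rightarrow> 'a \<Rightarrow> 's" and Y :: "'a \<Rightarrow> 's"
    and f :: "(nat \<Rightarrow> 's) \<Rightarrow> real" and d :: nat and p :: real
  defines "V \<equiv> \<lambda>n \<omega>. (U_stat d f X n \<omega> - real (n choose d) * U_mean M d f X)
                       / real n powr (real d - 1 / 2)"
    and "var \<equiv> U_asymp_var M d f X Y"
  assumes "prob_space M"
    and "prob_space.indep_vars M (\<lambda>_. S) X {1..}"
    and "Y \<in> M \<rightarrow>\<^sub>M S"
    and "\<And>i. i \<ge> 1 \<Longrightarrow> distr M S (X i) = distr M S Y"
    and "d \<ge> 1"
    and "f \<in> borel_measurable (PiM {1..d} (\<lambda>_. S))"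
    and "p \<ge> 2"
    and "integrable M (\<lambda>\<omega>. \<bar>f (\<lambda>j\<in>{1..d}. X j \<omega>)\<bar> powr p)"
  shows "0 \<le> var
    \<and> weak_conv_m (\<lambda>n. distr M borel (V n)) (normal_law 0 var)
    \<and> (\<forall>k::nat. 1 \<le> k \<and> real k \<le> p \<longrightarrow>
         (\<forall>n. integrable M (\<lambda>\<omega>. V n \<omega> ^ k)) \<and>
         (\<lambda>n. LINT \<omega>|M. V n \<omega> ^ k) \<longlonglongrightarrow> (LINT x|normal_law 0 var. x ^ k))
    \<and> (\<forall>r::real. 0 < r \<and> r \<le> p \<longrightarrow>
         (\<forall>n. integrable M (\<lambda>\<omega>. \<bar>V n \<omega>\<bar> powr r)) \<and>
         (\<lambda>n. LINT \<omega>|M. \<bar>V n \<omega>\<bar> powr r) \<longlonglongrightarrow> (LINT x|normal_law 0 var. \<bar>x\<bar> powr r))"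
proof -
  note d = assms(7) and f = assms(8) and p = assms(9)
  interpret prob_space M by fact
  interpret iid_sequence M S X "distr M S Y"
    by unfold_locales (use assms(4,6) in auto)
  let ?N = "distr M S Y"
  let ?P = "PiM {1..d} (\<lambda>_. ?N)"
  interpret P: prob_space ?P by (rule prob_space_PiM_N)
  have fP: "f \<in> borel_measurable ?P" using f by (simp only: measurable_cong_sets[OF sets_PiM_N refl])
  have "(\<lambda>z. \<bar>f z\<bar> powr p) \<in> borel_measurable (PiM {1..d} (\<lambda>_. S))" using f by measurable
  from integrable_tuple_iff[OF initial_index this] assms(10)
  have int: "integrable ?P (\<lambda>z. \<bar>f z\<bar> powr p)" by blast
  have int2: "integrable ?P (\<lambda>z. (f z)\<^sup>2)"
    using P.integrable_powr_mono[OF fP int, of 2] p by simp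
  have V: "V = norm_U_stat d f" unfolding V_def norm_U_stat_def by (intro ext) simp
  \<comment> \<open>The projections are centred under the law of \<open>Y\<close>, so the covariance
    is the integral of their product.\<close>
  have cov: "covariance M (\<lambda>\<omega>. U_proj M d f X i (Y \<omega>)) (\<lambda>\<omega>. U_proj M d f X j (Y \<omega>)) = proj_cov d f i j"
    if "i \<in> {1..d}" "j \<in> {1..d}" for i j
  proof -
    have m: "U_proj M d f X i \<in> borel_measurable S" "U_proj M d f X j \<in> borel_measurable S"
      using that U_proj_measurable[OF _ f] by auto
    have z: "expectation (\<lambda>\<omega>. U_proj M d f X l (Y \<omega>)) = 0" if "l \<in> {1..d}" for l
      using integral_distr[OF assms(5) U_proj_measurable[OF that f]] integral_U_proj[OF that f int2] by simp
    have "(\<lambda>x. U_proj M d f X i x * U_proj M d f X j x) \<in> borel_measurable S"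
      using m by measurable
    from integral_distr[OF assms(5) this] show ?thesis
      by (simp only: covariance_def proj_cov_def z[OF that(1)] z[OF that(2)] diff_0_right)
  qed
  have var: "var = limit_var d f"
    unfolding var_def U_asymp_var_def limit_var_def using cov by (intro sum.cong refl) simp
  have var0: "0 \<le> var" unfolding var by (rule limit_var_nonneg[OF d f int2])
  have conv: "weak_conv_m (\<lambda>n. distr M borel (V n)) (normal_law 0 var)"
    unfolding V var by (rule weak_conv_norm_U_stat[OF d f int2])
  have lim: "integrable M (\<lambda>\<omega>. g (V n \<omega>))" "(\<lambda>n. LINT \<omega>|M. g (V n \<omega>)) \<longlonglongrightarrow> integral\<^sup>L (normal_law 0 var) g"
    if g: "\<And>x. isCont g x" "\<And>x. \<bar>g x\<bar> \<le> 1 + \<bar>x\<bar> powr p" for g n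
  proof -
    note H = norm_U_stat_measurable[OF f, folded V] conv real_distribution_normal_law[OF var0] _
      norm_U_stat_powr_integrable[OF d f p int, folded V] norm_U_stat_uniformly_integrable[OF d f p int, folded V]
      integrable_normal_law_powr[OF var0] g
    show "integrable M (\<lambda>\<omega>. g (V n \<omega>))" by (rule weak_conv_integral_tendsto(1)[OF H]) (use p in auto)
    show "(\<lambda>n. LINT \<omega>|M. g (V n \<omega>)) \<longlonglongrightarrow> integral\<^sup>L (normal_law 0 var) g"
      by (rule weak_conv_integral_tendsto(2)[OF H]) (use p in auto)
  qed
  \<comment> \<open>Every lower power is dominated by 1 + |x|^p, so uniform integrability at the
    order \<open>p\<close> settles all smaller orders too.\<close>
  have powr: "\<bar>x\<bar> powr r \<le> 1 + \<bar>x\<bar> powr p" if "0 < r" "r \<le> p" for x r :: real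
    using powr_le_split[of "\<bar>x\<bar>" 1 r p] that by simp
  have k: "(\<forall>n. integrable M (\<lambda>\<omega>. V n \<omega> ^ k)) \<and>
         (\<lambda>n. LINT \<omega>|M. V n \<omega> ^ k) \<longlonglongrightarrow> (LINT x|normal_law 0 var. x ^ k)" if k: "1 \<le> k \<and> real k \<le> p" for k :: nat
  proof -
    have "\<bar>x ^ k\<bar> \<le> 1 + \<bar>x\<bar> powr p" for x :: real
      using powr[of "real k" x] k by (cases "x = 0") (auto simp: powr_realpow power_abs power_0_left)
    then show ?thesis using lim[of "\<lambda>x. x ^ k"] by (auto intro: continuous_intros)
  qed
  have r: "(\<forall>n. integrable M (\<lambda>\<omega>. \<bar>V n \<omega>\<bar> powr r)) \<and>
         (\<lambda>n. LINT \<omega>|M. \<bar>V n \<omega>\<bar> powr r) \<longlonglongrightarrow> (LINT x|normal_law 0 var. \<bar>x\<bar> powr r)" if r: "0 < r \<and> r \<le> p" for r :: real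
  proof -
    \<comment> \<open>At the origin continuity depends on \<open>r\<close> being positive.\<close>
    have "isCont (\<lambda>x. \<bar>x\<bar> powr r) x" for x :: real
      unfolding isCont_def by (rule tendsto_powr') (use r in \<open>auto intro!: tendsto_eq_intros\<close>)
    then show ?thesis using lim[of "\<lambda>x. \<bar>x\<bar> powr r"] powr r by auto
  qed
  from var0 conv k r show ?thesis by blast
qed

end
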